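(* There exist constants $\varepsilon_{\mathrm{ED}}>0$, $C_{\mathrm{ED}}\ge1$ and $d_{\mathrm{ED}}>0$, depending only on the normalized Couette profile and the channel geometry (so not on $A,E_0,D_\pm,\lambda_{\mathrm D},c_0$), such that the following holds for all $A\in\mathbb R\setminus\{0\}$, $E_0\in\mathbb R$ and $D_+,D_-,\lambda_{\mathrm D},c_0>0$, with $\kappa_{\mathrm D}:=c_0/\lambda_{\mathrm D}^2$, $D_{\min}:=\min\{D_+,D_-\}$, $D_{\max}:=\max\{D_+,D_-\}$. If $$\frac{D_{\max}}{|A|}\le\varepsilon_{\mathrm{ED}},\qquad 4C_{\mathrm{ED}}\kappa_{\mathrm D}D_{\max}\le d_{\mathrm{ED}}D_{\min}^{1/3}|A|^{2/3},$$ then every solution $(a_+,a_-)$ of the linearized ionic subsystem on $\Omega=\mathbb T_{2\pi}\times(-1,1)$ with homogeneous Dirichlet conditions (see context) satisfies $$\|(a_{+,\neq0},a_{-,\neq0})(t)\|_{L^2\times L^2}\le C_{\mathrm{ED}}\exp\!\Bigl[-\frac{d_{\mathrm{ED}}}{2}D_{\min}^{1/3}|A|^{2/3}t\Bigr]\|(a_{+,\neq0},a_{-,\neq0})(0)\|_{L^2\times L^2},\qquad t\ge0.$$ The constants in this estimate are independent of $E_0$. If $D_+=D_-=D$, the second condition is unnecessary: under the single assumption $D/|A|\le\varepsilon_{\mathrm{ED}}$, the sharper estimate $$\|(a_{+,\neq0},a_{-,\neq0})(t)\|_{L^2\times L^2}\le C_{\mathrm{ED}}\exp\!\bigl[-d_{\mathrm{ED}}D^{1/3}|A|^{2/3}t\bigr]\|(a_{+,\neq0},a_{-,\neq0})(0)\|_{L^2\times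 L^2}$$ holds for all $t\ge0$, uniformly in $E_0$ and $\kappa_{\mathrm D}$.
   Context: $\mathbb T_{2\pi}=\mathbb R/2\pi\mathbb Z$; functions on $\Omega$ are $2\pi$-periodic in $x$, coordinates $(x,y)$. The linearized ionic subsystem is $$\partial_ta_++Ay\,\partial_xa_+=D_+\Delta a_+-D_+E_0\partial_xa_+-D_+\kappa_{\mathrm D}(a_+-a_-),$$ $$\partial_ta_-+Ay\,\partial_xa_-=D_-\Delta a_-+D_-E_0\partial_xa_-+D_-\kappa_{\mathrm D}(a_+-a_-),$$ with $a_\pm=0$ at $y=\pm1$. (It arises from terms $\pm D_\pm c_0\Delta\varphi$ with $-\lambda_{\mathrm D}^2\Delta\varphi=a_+-a_-$, $\varphi|_{y=\pm1}=0$.) Solutions are those given by the associated analytic semigroup on $L^2(\Omega)^2$ (generator domain $(H^2(\Omega)\cap H_0^1(\Omega))^2$) with initial data in $L^2(\Omega)^2$. For a function $f$ on $\Omega$, $f_{\neq0}:=f-\frac1{2\pi}\int_0^{2\pi}f(x,\cdot)\,dx$. The norm is $\|(f,g)\|_{L^2\times L^2}^2=\|f\|_{L^2}^2+\|g\|_{L^2}^2$. *)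

theory Defs
  imports "HOL-Analysis.Analysis"
begin

section \<open>The channel and square-integrable functions\<close>

text \<open>
  The torus R / 2 pi Z is represented by its fundamental cell [0, 2 pi).  Functions on
  the channel are functions on the plane of which only the values on
  [0, 2 pi) x (-1, 1) matter; periodicity in x enters through the test functions below.
  All functions are complex-valued (real-valued ones are a special case), since analytic
  semigroups live on complex spaces.
\<close>

definition torus_measure :: "real measure" where
  "torus_measure = restrict_space lborel {0..<2*pi}"

definition height_measure :: "real measure" where
  "height_measure = restrict_space lborel {-1<..<1}"

definition channel :: "(real \<times> real) measure" where
  "channel = torus_measure \<Otimes>\<^sub>M height_measure"

definition square_integrable :: "(real \<times> real \<Rightarrow> complex) \<Rightarrow> bool" where
  "square_integrable f \<longleftrightarrow>
     f \<in> borel_measurable channel \<and> integrable channel (\<lambda>p. (cmod (f p))\<^sup>2)"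

definition L2_rel :: "(real \<times> real \<Rightarrow> complex) \<Rightarrow> (real \<times> real \<Rightarrow> complex) \<Rightarrow> bool" where
  "L2_rel f g \<longleftrightarrow>
     square_integrable f \<and> square_integrable g \<and> (AE p in channel. f p = g p)"

lemma finite_measure_torus: "finite_measure torus_measure"
  unfolding torus_measure_def
  by (intro finite_measureI) (simp add: emeasure_restrict_space space_restrict_space)

lemma finite_measure_height: "finite_measure height_measure"
  unfolding height_measure_def
  by (intro finite_measureI) (simp add: emeasure_restrict_space space_restrict_space)

lemma measure_torus: "measure torus_measure (space torus_measure) = 2 * pi"
  unfolding torus_measure_def
  by (simp add: measure_restrict_space space_restrict_space)

interpretation torus: finite_measure torus_measure by (rule finite_measure_torus)
interpretation height: finite_measure height_measure by (rule finite_measure_height)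
interpretation chan: pair_sigma_finite torus_measure height_measure ..

lemma square_integrable_zero: "square_integrable (\<lambda>_. 0)"
  by (simp add: square_integrable_def)

lemma square_integrable_cmult: "square_integrable f \<Longrightarrow> square_integrable (\<lambda>p. c * f p)"
  by (auto simp: square_integrable_def norm_mult power_mult_distrib)

lemma square_integrable_add:
  assumes "square_integrable f" "square_integrable g"
  shows "square_integrable (\<lambda>p. f p + g p)"
proof -
  have [measurable]: "f \<in> borel_measurable channel" "g \<in> borel_measurable channel"
    using assms by (auto simp: square_integrable_def)
  have "integrable channel (\<lambda>p. (cmod (f p + g p))\<^sup>2)"
  proof (rule Bochner_Integration.integrable_bound)
    show "integrable channel (\<lambda>p. 2 * (cmod (f p))\<^sup>2 + 2 * (cmod (g p))\<^sup>2)"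
      using assms by (auto simp: square_integrable_def)
    have "(cmod (f p + g p))\<^sup>2 \<le> 2 * (cmod (f p))\<^sup>2 + 2 * (cmod (g p))\<^sup>2" for p
    proof -
      have "(cmod (f p + g p))\<^sup>2 \<le> (cmod (f p) + cmod (g p))\<^sup>2"
        by (intro power_mono norm_triangle_ineq norm_ge_zero)
      also have "\<dots> \<le> 2 * (cmod (f p))\<^sup>2 + 2 * (cmod (g p))\<^sup>2"
        using zero_le_power2[of "cmod (f p) - cmod (g p)"]
        by (simp add: power2_eq_square algebra_simps)
      finally show ?thesis .
    qed
    then show "AE p in channel. norm ((cmod (f p + g p))\<^sup>2)
        \<le> norm (2 * (cmod (f p))\<^sup>2 + 2 * (cmod (g p))\<^sup>2)"
      by (simp add: abs_of_nonneg)
  qed measurable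
  then show ?thesis by (auto simp: square_integrable_def)
qed

lemma square_integrable_minus: "square_integrable f \<Longrightarrow> square_integrable (\<lambda>p. - f p)"
  by (auto simp: square_integrable_def)

lemma square_integrable_diff:
  "square_integrable f \<Longrightarrow> square_integrable g \<Longrightarrow> square_integrable (\<lambda>p. f p - g p)"
  using square_integrable_add[OF _ square_integrable_minus, of f g] by simp

lemma integrable_inner_channel:
  assumes "square_integrable f" "square_integrable g"
  shows "integrable channel (\<lambda>p. f p \<bullet> g p)"
proof -
  have [measurable]: "f \<in> borel_measurable channel" "g \<in> borel_measurable channel"
    using assms by (auto simp: square_integrable_def)
  show ?thesis
  proof (rule Bochner_Integration.integrable_bound)
    show "integrable channel (\<lambda>p. (cmod (f p))\<^sup>2 + (cmod (g p))\<^sup>2)"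
      using assms by (auto simp: square_integrable_def)
    have "\<bar>f p \<bullet> g p\<bar> \<le> (cmod (f p))\<^sup>2 + (cmod (g p))\<^sup>2" for p
    proof -
      have "\<bar>f p \<bullet> g p\<bar> \<le> cmod (f p) * cmod (g p)"
        by (rule Cauchy_Schwarz_ineq2)
      also have "\<dots> \<le> (cmod (f p))\<^sup>2 + (cmod (g p))\<^sup>2"
        using zero_le_power2[of "cmod (f p) - cmod (g p)"]
          mult_nonneg_nonneg[OF norm_ge_zero[of "f p"] norm_ge_zero[of "g p"]]
        unfolding power2_diff by linarith
      finally show ?thesis .
    qed
    then show "AE p in channel. norm (f p \<bullet> g p) \<le> norm ((cmod (f p))\<^sup>2 + (cmod (g p))\<^sup>2)"
      by (simp add: abs_of_nonneg)
  qed measurable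
qed

lemma part_equivp_L2_rel: "part_equivp L2_rel"
proof (rule part_equivpI)
  show "\<exists>f. L2_rel f f"
    using square_integrable_zero by (auto simp: L2_rel_def)
  show "symp L2_rel"
    by (auto simp: symp_def L2_rel_def elim: AE_mp)
  show "transp L2_rel"
    unfolding transp_def L2_rel_def by (auto elim: AE_mp)
qed

quotient_type L2 = "real \<times> real \<Rightarrow> complex" / partial: L2_rel
  morphisms rep_L2 to_L2
  by (rule part_equivp_L2_rel)

instantiation L2 :: real_inner
begin

lift_definition zero_L2 :: L2 is "\<lambda>_. 0"
  by (simp add: L2_rel_def square_integrable_zero)

lift_definition plus_L2 :: "L2 \<Rightarrow> L2 \<Rightarrow> L2" is "\<lambda>f g p. f p + g p"
  unfolding L2_rel_def by (auto intro: square_integrable_add)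

lift_definition uminus_L2 :: "L2 \<Rightarrow> L2" is "\<lambda>f p. - f p"
  unfolding L2_rel_def by (auto intro: square_integrable_minus)

lift_definition minus_L2 :: "L2 \<Rightarrow> L2 \<Rightarrow> L2" is "\<lambda>f g p. f p - g p"
  unfolding L2_rel_def by (auto intro: square_integrable_diff)

lift_definition scaleR_L2 :: "real \<Rightarrow> L2 \<Rightarrow> L2" is "\<lambda>r f p. complex_of_real r * f p"
  unfolding L2_rel_def by (auto intro: square_integrable_cmult)

text \<open>The real part of the usual Hermitian inner product; it induces the usual norm.\<close>

lift_definition inner_L2 :: "L2 \<Rightarrow> L2 \<Rightarrow> real" is "\<lambda>f g. \<integral>p. f p \<bullet> g p \<partial>channel"
proof -
  fix f f' g g' :: "real \<times> real \<Rightarrow> complex"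
  assume a: "L2_rel f f'" "L2_rel g g'"
  then have [measurable]: "f \<in> borel_measurable channel" "g \<in> borel_measurable channel"
      "f' \<in> borel_measurable channel" "g' \<in> borel_measurable channel"
    by (auto simp: L2_rel_def square_integrable_def)
  show "(\<integral>p. f p \<bullet> g p \<partial>channel) = (\<integral>p. f' p \<bullet> g' p \<partial>channel)"
    by (rule integral_cong_AE) (use a in \<open>auto simp: L2_rel_def\<close>)
qed

definition norm_L2 :: "L2 \<Rightarrow> real" where "norm_L2 f = sqrt (f \<bullet> f)"
definition sgn_L2 :: "L2 \<Rightarrow> L2" where "sgn_L2 f = scaleR (inverse (norm f)) f"
definition dist_L2 :: "L2 \<Rightarrow> L2 \<Rightarrow> real" where "dist_L2 f g = norm (f - g)"
definition uniformity_L2 :: "(L2 \<times> L2) filter" where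
  "uniformity_L2 = (INF e\<in>{0 <..}. principal {(x, y). dist x y < e})"
definition open_L2 :: "L2 set \<Rightarrow> bool" where
  "open_L2 U \<longleftrightarrow> (\<forall>x\<in>U. eventually (\<lambda>(x', y). x' = x \<longrightarrow> y \<in> U) uniformity)"

instance
proof
  fix f g h :: L2 and r s :: real
  show "f + g + h = f + (g + h)"
    by transfer (auto simp: L2_rel_def algebra_simps intro!: square_integrable_add)
  show "f + g = g + f"
    by transfer (auto simp: L2_rel_def algebra_simps intro!: square_integrable_add)
  show "0 + f = f" by transfer (auto simp: L2_rel_def)
  show "- f + f = 0" by transfer (auto simp: L2_rel_def square_integrable_zero)
  show "f - g = f + - g"
    by transfer (auto simp: L2_rel_def intro: square_integrable_diff)
  show "r *\<^sub>R (f + g) = r *\<^sub>R f + r *\<^sub>R g"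
    by transfer (auto simp: L2_rel_def distrib_left
        intro!: square_integrable_add square_integrable_cmult)
  show "(r + s) *\<^sub>R f = r *\<^sub>R f + s *\<^sub>R f"
    by transfer (auto simp: L2_rel_def distrib_right
        intro!: square_integrable_add square_integrable_cmult)
  show "r *\<^sub>R s *\<^sub>R f = (r * s) *\<^sub>R f"
    by transfer (auto simp: L2_rel_def mult.assoc
        intro!: square_integrable_cmult)
  show "1 *\<^sub>R f = f" by transfer (auto simp: L2_rel_def)
  show "dist f g = norm (f - g)" by (rule dist_L2_def)
  show "sgn f = scaleR (inverse (norm f)) f" by (rule sgn_L2_def)
  show "uniformity = (INF e\<in>{0 <..}. principal {(x :: L2, y). dist x y < e})"
    by (rule uniformity_L2_def)
  show "open U \<longleftrightarrow> (\<forall>x\<in>U. eventually (\<lambda>(x', y). x' = x \<longrightarrow> y \<in> U) uniformity)"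
    for U :: "L2 set" by (rule open_L2_def)
  show "f \<bullet> g = g \<bullet> f" by transfer (simp add: inner_commute)
  show "(f + g) \<bullet> h = f \<bullet> h + g \<bullet> h"
    by transfer (simp add: inner_add_left L2_rel_def integrable_inner_channel)
  show "(r *\<^sub>R f) \<bullet> g = r * (f \<bullet> g)"
    by transfer (simp flip: scaleR_conv_of_real)
  show "0 \<le> f \<bullet> f" by transfer simp
  show "f \<bullet> f = 0 \<longleftrightarrow> f = 0"
  proof transfer
    fix f assume f: "L2_rel f f"
    then have "(\<integral>p. f p \<bullet> f p \<partial>channel) = 0 \<longleftrightarrow> (AE p in channel. f p \<bullet> f p = 0)"
      by (intro integral_nonneg_eq_0_iff_AE integrable_inner_channel) (auto simp: L2_rel_def)
    then show "(\<integral>p. f p \<bullet> f p \<partial>channel) = 0 \<longleftrightarrow> L2_rel f (\<lambda>_. 0)"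
      using f by (simp add: L2_rel_def square_integrable_zero)
  qed
  show "norm f = sqrt (f \<bullet> f)" by (rule norm_L2_def)
qed

end

lemma norm_to_L2:
  assumes "square_integrable f"
  shows "norm (to_L2 f) = sqrt (\<integral>p. (cmod (f p))\<^sup>2 \<partial>channel)"
proof -
  have "L2_rel f f" using assms by (simp add: L2_rel_def)
  then show ?thesis
    by (simp add: norm_eq_sqrt_inner inner_L2.abs_eq power2_norm_eq_inner)
qed

lift_definition scaleC_L2 :: "complex \<Rightarrow> L2 \<Rightarrow> L2" is "\<lambda>c f p. c * f p"
  unfolding L2_rel_def by (auto intro: square_integrable_cmult)

text \<open>Multiplication by the normalized Couette profile y.\<close>

lift_definition mult_y :: "L2 \<Rightarrow> L2" is "\<lambda>f (x, y). complex_of_real y * f (x, y)"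
proof -
  fix f g assume a: "L2_rel f g"
  have *: "square_integrable (\<lambda>(x, y). complex_of_real y * f (x, y))"
    if f: "square_integrable f" for f
  proof -
    have [measurable]: "f \<in> borel_measurable (torus_measure \<Otimes>\<^sub>M height_measure)"
      using f by (simp add: square_integrable_def channel_def)
    have [measurable]: "(\<lambda>y. y) \<in> borel_measurable height_measure"
      unfolding height_measure_def by (intro measurable_restrict_space1) simp
    have m: "(\<lambda>(x, y). complex_of_real y * f (x, y)) \<in> borel_measurable channel"
      unfolding channel_def by measurable
    then have m2: "(\<lambda>p. (cmod (case p of (x, y) \<Rightarrow> complex_of_real y * f (x, y)))\<^sup>2)
        \<in> borel_measurable channel" by measurable
    have "integrable channel (\<lambda>p. (cmod (case p of (x, y) \<Rightarrow> complex_of_real y * f (x, y)))\<^sup>2)"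
    proof (rule Bochner_Integration.integrable_bound[OF _ m2])
      show "integrable channel (\<lambda>p. (cmod (f p))\<^sup>2)"
        using f by (simp add: square_integrable_def)
      show "AE p in channel. norm ((cmod (case p of (x, y) \<Rightarrow> complex_of_real y * f (x, y)))\<^sup>2)
          \<le> norm ((cmod (f p))\<^sup>2)"
      proof (rule AE_I2)
        fix p assume p: "p \<in> space channel"
        obtain x y where xy: "p = (x, y)" by (cases p)
        have "\<bar>y\<bar> \<le> 1"
          using p by (auto simp: xy channel_def space_pair_measure height_measure_def
              space_restrict_space)
        then have "\<bar>y\<bar> * cmod (f p) \<le> cmod (f p)"
          by (rule mult_left_le_one_le[OF norm_ge_zero abs_ge_zero])
        then show "norm ((cmod (case p of (x, y) \<Rightarrow> complex_of_real y * f (x, y)))\<^sup>2)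
          \<le> norm ((cmod (f p))\<^sup>2)"
          by (auto simp: xy norm_mult intro!: power_mono)
      qed
    qed
    with m show ?thesis by (simp add: square_integrable_def)
  qed
  show "L2_rel (\<lambda>(x, y). complex_of_real y * f (x, y)) (\<lambda>(x, y). complex_of_real y * g (x, y))"
    using a * by (auto simp: L2_rel_def)
qed

definition x_mean :: "(real \<times> real \<Rightarrow> complex) \<Rightarrow> real \<Rightarrow> complex" where
  "x_mean f y = complex_of_real (1 / (2 * pi)) * (\<integral>x. f (x, y) \<partial>torus_measure)"

lemma x_mean_bound:
  assumes m: "h \<in> borel_measurable torus_measure"
    and i: "integrable torus_measure (\<lambda>x. (cmod (h x))\<^sup>2)"
  shows "(cmod (complex_of_real (1 / (2 * pi)) * (\<integral>x. h x \<partial>torus_measure)))\<^sup>2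
    \<le> (1 / (2 * pi)) * (\<integral>x. (cmod (h x))\<^sup>2 \<partial>torus_measure)"
proof -
  have i1: "integrable torus_measure (\<lambda>x. cmod (h x))"
  proof (rule Bochner_Integration.integrable_bound)
    show "integrable torus_measure (\<lambda>x. 1 + (cmod (h x))\<^sup>2)"
      using i by simp
    have "c \<le> 1 + c\<^sup>2" if "c \<ge> 0" for c :: real
      using zero_le_power2[of "c - 1"] that unfolding power2_diff by simp
    then show "AE x in torus_measure. norm (cmod (h x)) \<le> norm (1 + (cmod (h x))\<^sup>2)"
      by (simp add: abs_of_nonneg add_nonneg_nonneg)
  qed (use m in measurable)
  define J where "J = (\<integral>x. cmod (h x) \<partial>torus_measure)"
  define c where "c = J / (2 * pi)"
  have "0 \<le> (\<integral>x. (cmod (h x) - c)\<^sup>2 \<partial>torus_measure)" by simp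
  also have "\<dots> = (\<integral>x. (cmod (h x))\<^sup>2 - (2 * c) * cmod (h x) + c\<^sup>2 \<partial>torus_measure)"
    by (intro Bochner_Integration.integral_cong) (auto simp: power2_diff)
  also have "\<dots> = (\<integral>x. (cmod (h x))\<^sup>2 \<partial>torus_measure) - 2 * c * J + c\<^sup>2 * (2 * pi)"
    using i i1 by (simp add: J_def measure_torus)
  also have "\<dots> = (\<integral>x. (cmod (h x))\<^sup>2 \<partial>torus_measure) - J\<^sup>2 / (2 * pi)"
    by (simp add: c_def power2_eq_square field_simps)
  finally have 1: "J\<^sup>2 / (2 * pi) \<le> (\<integral>x. (cmod (h x))\<^sup>2 \<partial>torus_measure)" by simp
  have "cmod (\<integral>x. h x \<partial>torus_measure) \<le> J"
    unfolding J_def by (rule integral_norm_bound)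
  then have "(cmod (\<integral>x. h x \<partial>torus_measure))\<^sup>2 \<le> J\<^sup>2" by (intro power_mono) auto
  then have "(cmod (\<integral>x. h x \<partial>torus_measure))\<^sup>2 / (2 * pi) \<le> J\<^sup>2 / (2 * pi)"
    by (intro divide_right_mono) auto
  with 1 have "(cmod (\<integral>x. h x \<partial>torus_measure))\<^sup>2 / (2 * pi)
      \<le> (\<integral>x. (cmod (h x))\<^sup>2 \<partial>torus_measure)" by linarith
  then have "(1 / (2 * pi)) * ((cmod (\<integral>x. h x \<partial>torus_measure))\<^sup>2 / (2 * pi))
      \<le> (1 / (2 * pi)) * (\<integral>x. (cmod (h x))\<^sup>2 \<partial>torus_measure)"
    by (intro mult_left_mono) auto
  then show ?thesis
    by (simp add: norm_mult norm_divide power_mult_distrib power_divide power2_eq_square)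
qed

lemma square_integrable_x_mean:
  assumes f: "square_integrable f"
  shows "square_integrable (\<lambda>(x, y). x_mean f y)"
proof -
  have fm[measurable]: "f \<in> borel_measurable (torus_measure \<Otimes>\<^sub>M height_measure)"
    using f by (simp add: square_integrable_def channel_def)
  have fi: "integrable (torus_measure \<Otimes>\<^sub>M height_measure) (\<lambda>(x, y). (cmod (f (x, y)))\<^sup>2)"
    using f by (simp add: square_integrable_def channel_def case_prod_beta')
  have mm[measurable]: "x_mean f \<in> borel_measurable height_measure"
    unfolding x_mean_def by measurable
  have m: "(\<lambda>(x, y). x_mean f y) \<in> borel_measurable (torus_measure \<Otimes>\<^sub>M height_measure)"
    by measurable
  define G where "G y = (1 / (2 * pi)) * (\<integral>x. (cmod (f (x, y)))\<^sup>2 \<partial>torus_measure)" for y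
  have iG: "integrable height_measure G"
    unfolding G_def using chan.integrable_snd[OF fi] by simp
  have ae: "AE y in height_measure. integrable torus_measure (\<lambda>x. (cmod (f (x, y)))\<^sup>2)"
    using chan.AE_integrable_snd[OF fi] by simp
  have "integrable height_measure (\<lambda>y. (cmod (x_mean f y))\<^sup>2)"
  proof (rule Bochner_Integration.integrable_bound[OF iG])
    show "AE y in height_measure. norm ((cmod (x_mean f y))\<^sup>2) \<le> norm (G y)"
      using ae AE_space
    proof eventually_elim
      case (elim y)
      have "(\<lambda>x. f (x, y)) \<in> borel_measurable torus_measure"
        using elim(2) by measurable
      from x_mean_bound[OF this elim(1)] show ?case
        by (simp add: x_mean_def G_def)
    qed
  qed measurable
  then have "integrable (torus_measure \<Otimes>\<^sub>M height_measure) (\<lambda>(x, y). (cmod (x_mean f y))\<^sup>2)"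
    by (intro chan.Fubini_integrable) auto
  with m show ?thesis
    by (simp add: square_integrable_def channel_def case_prod_beta')
qed

lemma AE_x_mean_eq:
  assumes "L2_rel f g"
  shows "AE p in channel. x_mean f (snd p) = x_mean g (snd p)"
proof -
  have [measurable]: "f \<in> borel_measurable (torus_measure \<Otimes>\<^sub>M height_measure)"
      "g \<in> borel_measurable (torus_measure \<Otimes>\<^sub>M height_measure)"
    using assms by (auto simp: L2_rel_def square_integrable_def channel_def)
  have mm[measurable]: "x_mean f \<in> borel_measurable height_measure"
      "x_mean g \<in> borel_measurable height_measure"
    unfolding x_mean_def by measurable
  have "AE p in torus_measure \<Otimes>\<^sub>M height_measure. f p = g p"
    using assms unfolding L2_rel_def channel_def by blast
  then have "AE x in torus_measure. AE y in height_measure. f (x, y) = g (x, y)"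
    by (rule chan.AE_pair)
  then have "AE y in height_measure. AE x in torus_measure. f (x, y) = g (x, y)"
    by (subst (asm) chan.AE_commute) measurable
  then have "AE y in height_measure. x_mean f y = x_mean g y"
    using AE_space
  proof eventually_elim
    case (elim y)
    have "(\<integral>x. f (x, y) \<partial>torus_measure) = (\<integral>x. g (x, y) \<partial>torus_measure)"
      using elim by (intro integral_cong_AE) measurable
    then show ?case by (simp add: x_mean_def)
  qed
  then have "AE x in torus_measure. AE y in height_measure. x_mean f y = x_mean g y"
    by simp
  then have "AE p in torus_measure \<Otimes>\<^sub>M height_measure. x_mean f (snd p) = x_mean g (snd p)"
    by (intro chan.AE_pair_measure) (simp_all, measurable)
  then show ?thesis unfolding channel_def .
qed

lift_definition nonzero_modes :: "L2 \<Rightarrow> L2" is "\<lambda>f (x, y). f (x, y) - x_mean f y"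
proof -
  fix f g assume a: "L2_rel f g"
  have *: "square_integrable (\<lambda>(x, y). f (x, y) - x_mean f y)" if "square_integrable f" for f
    using square_integrable_diff[OF that square_integrable_x_mean[OF that]]
    by (simp add: case_prod_beta')
  have "AE p in channel. (case p of (x, y) \<Rightarrow> f (x, y) - x_mean f y)
      = (case p of (x, y) \<Rightarrow> g (x, y) - x_mean g y)"
    using AE_x_mean_eq[OF a] a[unfolded L2_rel_def, THEN conjunct2, THEN conjunct2]
    by eventually_elim (simp add: case_prod_beta)
  then show "L2_rel (\<lambda>(x, y). f (x, y) - x_mean f y) (\<lambda>(x, y). g (x, y) - x_mean g y)"
    using a * by (simp add: L2_rel_def)
qed

section \<open>Sobolev spaces\<close>

definition pdx :: "(real \<times> real \<Rightarrow> complex) \<Rightarrow> real \<times> real \<Rightarrow> complex" where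
  "pdx f = (\<lambda>(x, y). vector_derivative (\<lambda>s. f (s, y)) (at x))"

definition pdy :: "(real \<times> real \<Rightarrow> complex) \<Rightarrow> real \<times> real \<Rightarrow> complex" where
  "pdy f = (\<lambda>(x, y). vector_derivative (\<lambda>s. f (x, s)) (at y))"

primrec Ck :: "nat \<Rightarrow> (real \<times> real \<Rightarrow> complex) \<Rightarrow> bool" where
  "Ck 0 f \<longleftrightarrow> continuous_on UNIV f"
| "Ck (Suc k) f \<longleftrightarrow> continuous_on UNIV f
     \<and> (\<forall>x y. (\<lambda>s. f (s, y)) differentiable at x)
     \<and> (\<forall>x y. (\<lambda>s. f (x, s)) differentiable at y)
     \<and> Ck k (pdx f) \<and> Ck k (pdy f)"

text \<open>
  Smooth functions with compact support in (R / 2 pi Z) x (-1, 1), extended by zero in y.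
\<close>

definition test_function :: "(real \<times> real \<Rightarrow> complex) \<Rightarrow> bool" where
  "test_function \<phi> \<longleftrightarrow> (\<forall>k. Ck k \<phi>)
     \<and> (\<forall>x y. \<phi> (x + 2 * pi, y) = \<phi> (x, y))
     \<and> (\<exists>r<1. \<forall>x y. \<bar>y\<bar> > r \<longrightarrow> \<phi> (x, y) = 0)"

text \<open>\<open>weak_deriv i j u v\<close>: the L2 function v is the weak derivative of u of order i in x
  and j in y.\<close>

definition weak_deriv :: "nat \<Rightarrow> nat \<Rightarrow> L2 \<Rightarrow> L2 \<Rightarrow> bool" where
  "weak_deriv i j u v \<longleftrightarrow> (\<forall>\<phi>. test_function \<phi> \<longrightarrow>
     (\<integral>p. rep_L2 u p * (pdx ^^ i) ((pdy ^^ j) \<phi>) p \<partial>channel)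
       = (- 1) ^ (i + j) * (\<integral>p. rep_L2 v p * \<phi> p \<partial>channel))"

definition H2 :: "L2 set" where
  "H2 = {u. \<forall>i j. i + j \<le> 2 \<longrightarrow> (\<exists>v. weak_deriv i j u v)}"

text \<open>The closure of the test functions in the norm of H1.\<close>

definition H1_0 :: "L2 set" where
  "H1_0 = {u. \<exists>ux uy \<phi>. weak_deriv 1 0 u ux \<and> weak_deriv 0 1 u uy
     \<and> (\<forall>n::nat. test_function (\<phi> n))
     \<and> (\<lambda>n. to_L2 (\<phi> n)) \<longlonglongrightarrow> u
     \<and> (\<lambda>n. to_L2 (pdx (\<phi> n))) \<longlonglongrightarrow> ux
     \<and> (\<lambda>n. to_L2 (pdy (\<phi> n))) \<longlonglongrightarrow> uy}"

section \<open>Semigroups and the linearized ionic subsystem\<close>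

type_synonym state = "L2 \<times> L2"

definition scaleC_state :: "complex \<Rightarrow> state \<Rightarrow> state" where
  "scaleC_state c = map_prod (scaleC_L2 c) (scaleC_L2 c)"

definition C0_semigroup :: "(real \<Rightarrow> state \<Rightarrow> state) \<Rightarrow> bool" where
  "C0_semigroup S \<longleftrightarrow>
     (\<forall>t\<ge>0. bounded_linear (S t)) \<and> S 0 = id
     \<and> (\<forall>s\<ge>0. \<forall>t\<ge>0. S (s + t) = S s \<circ> S t)
     \<and> (\<forall>w. continuous_on {0..} (\<lambda>t. S t w))"

definition sector :: "real \<Rightarrow> complex set" where
  "sector \<theta> = {z. z \<noteq> 0 \<and> \<bar>Arg z\<bar> < \<theta>}"

text \<open>
  A strongly continuous semigroup that extends holomorphically to an open sector of
  half-angle \<open>\<theta>\<close>, the extension being a semigroup of bounded complex-linear operators that is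
  strongly continuous at 0 in every smaller sector.
\<close>

definition analytic_semigroup :: "(real \<Rightarrow> state \<Rightarrow> state) \<Rightarrow> bool" where
  "analytic_semigroup S \<longleftrightarrow> C0_semigroup S \<and>
     (\<exists>\<theta> T. 0 < \<theta> \<and> \<theta> \<le> pi / 2
       \<and> (\<forall>t\<ge>0. T (complex_of_real t) = S t)
       \<and> (\<forall>z\<in>sector \<theta>. bounded_linear (T z)
            \<and> (\<forall>c w. T z (scaleC_state c w) = scaleC_state c (T z w)))
       \<and> (\<forall>z\<in>sector \<theta>. \<forall>z'\<in>sector \<theta>. T (z + z') = T z \<circ> T z')
       \<and> (\<forall>w. \<forall>z\<in>sector \<theta>. \<exists>w'.
            ((\<lambda>\<zeta>. T \<zeta> w) has_derivative (\<lambda>h. scaleC_state h w')) (at z))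
       \<and> (\<forall>w. \<forall>\<theta>'<\<theta>. ((\<lambda>z. T z w) \<longlongrightarrow> w) (at 0 within sector \<theta>')))"

text \<open>Unbounded operators are represented by their graphs.\<close>

definition generator :: "(real \<Rightarrow> state \<Rightarrow> state) \<Rightarrow> (state \<times> state) set" where
  "generator S = {(w, g). ((\<lambda>h. (1 / h) *\<^sub>R (S h w - w)) \<longlongrightarrow> g) (at_right 0)}"

text \<open>
  The operator with domain (H2 \<open>\<inter>\<close> H1_0) x (H2 \<open>\<inter>\<close> H1_0) that sends (p, m) to the
  right-hand sides of the equations for a_+ and a_-, the transport terms included.
\<close>

definition ionic_operator ::
  "real \<Rightarrow> real \<Rightarrow> real \<Rightarrow> real \<Rightarrow> real \<Rightarrow> (state \<times> state) set" where
  "ionic_operator A E\<^sub>0 D\<^sub>p D\<^sub>m \<kappa> =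
     {((p, m), (f, g)). p \<in> H2 \<inter> H1_0 \<and> m \<in> H2 \<inter> H1_0 \<and>
        (\<exists>px pxx pyy mx mxx myy.
           weak_deriv 1 0 p px \<and> weak_deriv 2 0 p pxx \<and> weak_deriv 0 2 p pyy \<and>
           weak_deriv 1 0 m mx \<and> weak_deriv 2 0 m mxx \<and> weak_deriv 0 2 m myy \<and>
           f = D\<^sub>p *\<^sub>R (pxx + pyy) - A *\<^sub>R mult_y px
                 - (D\<^sub>p * E\<^sub>0) *\<^sub>R px - (D\<^sub>p * \<kappa>) *\<^sub>R (p - m) \<and>
           g = D\<^sub>m *\<^sub>R (mxx + myy) - A *\<^sub>R mult_y mx
                 + (D\<^sub>m * E\<^sub>0) *\<^sub>R mx + (D\<^sub>m * \<kappa>) *\<^sub>R (p - m))}"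

text \<open>A solution is an orbit, with arbitrary initial data in L2 x L2, of the analytic
  semigroup generated by the ionic operator; only times \<open>t \<ge> 0\<close> matter.\<close>

definition ionic_solution ::
  "real \<Rightarrow> real \<Rightarrow> real \<Rightarrow> real \<Rightarrow> real \<Rightarrow> (real \<Rightarrow> state) \<Rightarrow> bool" where
  "ionic_solution A E\<^sub>0 D\<^sub>p D\<^sub>m \<kappa> a \<longleftrightarrow>
     (\<exists>S. analytic_semigroup S \<and> generator S = ionic_operator A E\<^sub>0 D\<^sub>p D\<^sub>m \<kappa>
        \<and> (\<forall>t\<ge>0. a t = S t (a 0)))"

text \<open>The norm of a pair is \<open>norm (f, g) = sqrt ((norm f)\<^sup>2 + (norm g)\<^sup>2)\<close>.\<close>

definition state_nonzero_modes :: "state \<Rightarrow> state" where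
  "state_nonzero_modes = map_prod nonzero_modes nonzero_modes"

end

theory Submission
  imports Defs
begin

text \<open>
  Enhanced dissipation for the linearized ionic subsystem in Couette flow, by a time-weighted energy.

  Along free transport by the shear \<open>A y\<close>, an \<open>x\<close>-derivative creates \<open>y\<close>-derivatives that grow linearly
  in time, and diffusion acts on these. The quadratic form
  \<open>\<parallel>w\<parallel>\<^sup>2 + 2\<delta>\<tau> \<parallel>w\<^sub>y\<parallel>\<^sup>2 + 2\<delta>A\<tau>\<^sup>2 \<langle>w\<^sub>x, w\<^sub>y\<rangle> + (2/3) \<delta>A\<^sup>2\<tau>\<^sup>3 \<parallel>w\<^sub>x\<parallel>\<^sup>2\<close>, where \<open>\<tau>\<close> is the elapsed time,
  quantifies this: its derivative along a single advection-diffusion equation with diffusivity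
  \<open>D \<ge> \<delta>\<close> is nonpositive, because the terms produced by the commutator of the shear with \<open>\<partial>\<^sub>y\<close> cancel
  those produced by the weights (\<open>flux_dissipation\<close>). The form equals \<open>\<parallel>w\<parallel>\<^sup>2\<close> at the beginning and
  dominates \<open>(1/6) \<delta>A\<^sup>2\<tau>\<^sup>3 \<parallel>w\<^sub>x\<parallel>\<^sup>2\<close> afterwards (\<open>energy_lower_bound\<close>). So after a time of order
  \<open>1 / (\<delta> powr (1/3) * \<bar>A\<bar> powr (2/3))\<close> the norm of \<open>w\<^sub>x\<close> is a small multiple of the initial norm of \<open>w\<close>. The
  Dirichlet condition does no harm: written as pairings of \<open>w\<^sub>t\<close> with second derivatives, the
  derivatives of all four terms involve no boundary contributions (\<open>regular_transport\<close>).

  The estimate is applied to the mean-free antiderivative \<open>w\<close> in \<open>x\<close> of the solution, which solves the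
  same equations. Then \<open>w\<^sub>x\<close> is the nonzero-mode part of the solution, the norm of \<open>w\<close> is at most
  \<open>\<pi>\<close> times the norm of \<open>w\<^sub>x\<close>, and \<open>w\<^sub>x\<close> satisfies the Dirichlet condition in the strong sense that the
  integrations by parts require (\<open>regular_anti\<close>). The estimate therefore bounds the nonzero modes by a small
  multiple of themselves, and iterating it gives exponential decay (\<open>decay_from_steps\<close>).

  The electric drift is a skew term that commutes with everything and drops out of every identity, for
  any \<open>E\<^sub>0\<close>. The coupling is dissipative for equal diffusivities. For different ones it lets the
  form grow at a rate of at most \<open>\<kappa> \<bar>D\<^sub>p - D\<^sub>m\<bar>\<close> (\<open>coupling_growth\<close>), which the smallness condition makes
  harmless over one step of the iteration.

  The orbit is known only through its semigroup. Holomorphy puts it into the domain of the generator at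
  positive times (\<open>orbit_derivative\<close>), and it also supplies the density of test functions
  (\<open>test_dense_if_ionic_semigroup\<close>). That the second derivatives depend continuously on time follows
  from the equation and the identity between the norm of the Laplacian and that of the Hessian
  (\<open>second_derivatives_continuous\<close>).
\<close>

section \<open>Smooth functions of two real variables\<close>

definition smooth :: "(real \<times> real \<Rightarrow> complex) \<Rightarrow> bool" where
  "smooth f \<longleftrightarrow> (\<forall>k. Ck k f)"

lemma Ck_continuous: "Ck k f \<Longrightarrow> continuous_on UNIV f"
  by (cases k) auto

lemma Ck_has_pdx:
  "Ck (Suc k) f \<Longrightarrow> ((\<lambda>s. f (s, y)) has_vector_derivative pdx f (x, y)) (at x within S)"
  by (auto simp: pdx_def vector_derivative_works
      intro: has_vector_derivative_at_within)

lemma Ck_has_pdy: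
  "Ck (Suc k) f \<Longrightarrow> ((\<lambda>s. f (x, s)) has_vector_derivative pdy f (x, y)) (at y within S)"
  by (auto simp: pdy_def vector_derivative_works
      intro: has_vector_derivative_at_within)

lemma pdx_eqI:
  assumes "\<And>x y. ((\<lambda>s. f (s, y)) has_vector_derivative g (x, y)) (at x)"
  shows "pdx f = g"
  using assms by (auto simp: pdx_def fun_eq_iff intro!: vector_derivative_at)

lemma pdy_eqI:
  assumes "\<And>x y. ((\<lambda>s. f (x, s)) has_vector_derivative g (x, y)) (at y)"
  shows "pdy f = g"
  using assms by (auto simp: pdy_def fun_eq_iff intro!: vector_derivative_at)

lemma Ck_SucI:
  assumes f: "continuous_on UNIV f"
    and x: "\<And>x y. ((\<lambda>s. f (s, y)) has_vector_derivative fx (x, y)) (at x)"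
    and y: "\<And>x y. ((\<lambda>s. f (x, s)) has_vector_derivative fy (x, y)) (at y)"
    and "Ck k fx" "Ck k fy"
  shows "Ck (Suc k) f"
proof -
  have "(\<lambda>s. f (s, y)) differentiable at x" "(\<lambda>s. f (x, s)) differentiable at y" for x y
    using x y by (blast intro: differentiableI_vector)+
  then show ?thesis
    using assms(4,5) f by (simp add: pdx_eqI[OF x] pdy_eqI[OF y])
qed

lemma Ck_SucD: "Ck (Suc k) f \<Longrightarrow> Ck k f"
proof (induction k arbitrary: f)
  case (Suc k)
  then show ?case
    using Ck.simps(2)[of "Suc k" f] Ck.simps(2)[of k f] by blast
qed simp

lemma Ck_add: "Ck k f \<Longrightarrow> Ck k g \<Longrightarrow> Ck k (\<lambda>p. f p + g p)"
proof (induction k arbitrary: f g)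
  case (Suc k)
  show ?case
  proof (rule Ck_SucI[where fx = "\<lambda>p. pdx f p + pdx g p" and fy = "\<lambda>p. pdy f p + pdy g p"])
    show "continuous_on UNIV (\<lambda>p. f p + g p)"
      by (intro continuous_on_add Ck_continuous[OF Suc.prems(1)] Ck_continuous[OF Suc.prems(2)])
    show "Ck k (\<lambda>p. pdx f p + pdx g p)" "Ck k (\<lambda>p. pdy f p + pdy g p)"
      using Suc.prems by (auto intro: Suc.IH)
  qed (intro has_vector_derivative_add Ck_has_pdx[OF Suc.prems(1)] Ck_has_pdx[OF Suc.prems(2)]
        Ck_has_pdy[OF Suc.prems(1)] Ck_has_pdy[OF Suc.prems(2)])+
qed (simp add: continuous_on_add)

lemma Ck_mult: "Ck k f \<Longrightarrow> Ck k g \<Longrightarrow> Ck k (\<lambda>p. f p * g p)"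
proof (induction k arbitrary: f g)
  case (Suc k)
  show ?case
  proof (rule Ck_SucI[where fx = "\<lambda>p. f p * pdx g p + pdx f p * g p"
        and fy = "\<lambda>p. f p * pdy g p + pdy f p * g p"])
    show "continuous_on UNIV (\<lambda>p. f p * g p)"
      by (intro continuous_on_mult Ck_continuous[OF Suc.prems(1)] Ck_continuous[OF Suc.prems(2)])
    show "Ck k (\<lambda>p. f p * pdx g p + pdx f p * g p)" "Ck k (\<lambda>p. f p * pdy g p + pdy f p * g p)"
      using Suc.prems by (auto intro!: Ck_add Suc.IH Ck_SucD[OF Suc.prems(1)] Ck_SucD[OF Suc.prems(2)])
  qed (intro has_vector_derivative_mult Ck_has_pdx[OF Suc.prems(1)] Ck_has_pdx[OF Suc.prems(2)]
        Ck_has_pdy[OF Suc.prems(1)] Ck_has_pdy[OF Suc.prems(2)])+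
qed (simp add: continuous_on_mult)

lemma Ck_cnj: "Ck k f \<Longrightarrow> Ck k (\<lambda>p. cnj (f p))"
proof (induction k arbitrary: f)
  case (Suc k)
  show ?case
  proof (rule Ck_SucI[where fx = "\<lambda>p. cnj (pdx f p)" and fy = "\<lambda>p. cnj (pdy f p)"])
    show "continuous_on UNIV (\<lambda>p. cnj (f p))"
      by (intro continuous_on_cnj Ck_continuous[OF Suc.prems])
    show "Ck k (\<lambda>p. cnj (pdx f p))" "Ck k (\<lambda>p. cnj (pdy f p))"
      using Suc.prems by (auto intro: Suc.IH)
  qed (intro has_vector_derivative_cnj Ck_has_pdx[OF Suc.prems] Ck_has_pdy[OF Suc.prems])+
qed (simp add: continuous_on_cnj)

lemma Ck_const: "Ck k (\<lambda>_. c)"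
proof (induction k arbitrary: c)
  case (Suc k)
  show ?case
    by (rule Ck_SucI[where fx = "\<lambda>_. 0" and fy = "\<lambda>_. 0"])
      (simp_all add: Suc has_vector_derivative_const)
qed auto

lemma smooth_const: "smooth (\<lambda>_. c)"
  by (simp add: smooth_def Ck_const)

lemma smooth_height: "smooth (\<lambda>p. complex_of_real (snd p))"
  unfolding smooth_def
proof
  fix k
  have c: "continuous_on UNIV (\<lambda>p::real \<times> real. complex_of_real (snd p))"
    by (intro continuous_on_of_real continuous_on_snd continuous_on_id)
  show "Ck k (\<lambda>p. complex_of_real (snd p))"
  proof (cases k)
    case (Suc m)
    show ?thesis unfolding Suc
      by (rule Ck_SucI[where fx = "\<lambda>_. 0" and fy = "\<lambda>_. 1", OF c])
        (simp_all add: Ck_const has_vector_derivative_const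
          has_vector_derivative_of_real[OF DERIV_ident, simplified])
  qed (use c in \<open>simp del: continuous_on_of_real_o_iff\<close>)
qed

lemma smooth_add: "smooth f \<Longrightarrow> smooth g \<Longrightarrow> smooth (\<lambda>p. f p + g p)"
  by (simp add: smooth_def Ck_add)

lemma smooth_mult: "smooth f \<Longrightarrow> smooth g \<Longrightarrow> smooth (\<lambda>p. f p * g p)"
  by (simp add: smooth_def Ck_mult)

lemma smooth_cnj: "smooth f \<Longrightarrow> smooth (\<lambda>p. cnj (f p))"
  by (simp add: smooth_def Ck_cnj)

lemma smooth_pd:
  assumes "smooth f" shows "smooth (pdx f)" "smooth (pdy f)"
  using assms unfolding smooth_def by (meson Ck.simps(2))+

lemma smooth_continuous: "smooth f \<Longrightarrow> continuous_on S f"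
  using Ck_continuous continuous_on_subset smooth_def by blast

lemma smooth_has_pdx:
  "smooth f \<Longrightarrow> ((\<lambda>s. f (s, y)) has_vector_derivative pdx f (x, y)) (at x within S)"
  using Ck_has_pdx smooth_def by blast

lemma smooth_has_pdy:
  "smooth f \<Longrightarrow> ((\<lambda>s. f (x, s)) has_vector_derivative pdy f (x, y)) (at y within S)"
  using Ck_has_pdy smooth_def by blast

lemma pd_mult:
  assumes "smooth f" "smooth g"
  shows "pdx (\<lambda>p. f p * g p) = (\<lambda>p. f p * pdx g p + pdx f p * g p)"
    "pdy (\<lambda>p. f p * g p) = (\<lambda>p. f p * pdy g p + pdy f p * g p)"
  by (rule pdx_eqI pdy_eqI,
      intro has_vector_derivative_mult smooth_has_pdx smooth_has_pdy assms)+

lemma pd_cnj: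
  assumes "smooth f"
  shows "pdx (\<lambda>p. cnj (f p)) = (\<lambda>p. cnj (pdx f p))"
    "pdy (\<lambda>p. cnj (f p)) = (\<lambda>p. cnj (pdy f p))"
  by (rule pdx_eqI pdy_eqI,
      intro has_vector_derivative_cnj smooth_has_pdx smooth_has_pdy assms)+

lemma pd_height:
  "pdx (\<lambda>p. complex_of_real (snd p)) = (\<lambda>_. 0)" "pdy (\<lambda>p. complex_of_real (snd p)) = (\<lambda>_. 1)"
  by (rule pdx_eqI pdy_eqI; simp add: has_vector_derivative_const
      has_vector_derivative_of_real[OF DERIV_ident, simplified])+

text \<open>
  Clairaut's theorem. Writing \<open>f\<close> as the integral of \<open>pdy f\<close> in \<open>y\<close> and differentiating in \<open>x\<close>
  under the integral exhibits \<open>pdx f\<close> as an indefinite integral of \<open>pdx (pdy f)\<close>.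
\<close>

lemma pdy_pdx_commute:
  assumes f: "smooth f"
  shows "pdy (pdx f) = pdx (pdy f)"
proof (rule pdy_eqI)
  fix x y :: real
  let ?g = "pdx (pdy f)"
  note cont = smooth_continuous[OF smooth_pd(1)[OF smooth_pd(2)[OF f]]]
  have 1: "((\<lambda>s. pdy f (x, s)) has_integral f (x, y') - f (x, y - 1)) {y - 1..y'}"
    if "y' \<in> {y - 1..y + 1}" for x y'
    by (rule fundamental_theorem_of_calculus) (use that smooth_has_pdy[OF f] in auto)
  have 2: "pdx f (x, y') = pdx f (x, y - 1) + integral {y - 1..y'} (\<lambda>s. ?g (x, s))"
    if y': "y' \<in> {y - 1..y + 1}" for y'
  proof -
    have "((\<lambda>u. integral (cbox (y - 1) y') (\<lambda>s. pdy f (u, s)))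
        has_vector_derivative integral (cbox (y - 1) y') (\<lambda>s. ?g (x, s))) (at x within UNIV)"
    proof (rule leibniz_rule_vector_derivative)
      show "((\<lambda>u. pdy f (u, t)) has_vector_derivative ?g (u, t)) (at u within UNIV)" for u t
        by (rule smooth_has_pdx[OF smooth_pd(2)[OF f]])
      show "(\<lambda>s. pdy f (u, s)) integrable_on cbox (y - 1) y'" for u
        using 1[OF y', of u] by auto
      show "continuous_on (UNIV \<times> cbox (y - 1) y') (\<lambda>(u, t). ?g (u, t))"
        using cont by (simp add: case_prod_beta')
    qed auto
    moreover have "integral (cbox (y - 1) y') (\<lambda>s. pdy f (u, s)) = f (u, y') - f (u, y - 1)" for u
      using 1[OF y', of u] by auto
    ultimately have "((\<lambda>u. f (u, y') - f (u, y - 1))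
        has_vector_derivative integral {y - 1..y'} (\<lambda>s. ?g (x, s))) (at x)"
      by simp
    moreover have "((\<lambda>u. f (u, y') - f (u, y - 1))
        has_vector_derivative pdx f (x, y') - pdx f (x, y - 1)) (at x)"
      by (intro has_vector_derivative_diff smooth_has_pdx f)
    ultimately have "integral {y - 1..y'} (\<lambda>s. ?g (x, s)) = pdx f (x, y') - pdx f (x, y - 1)"
      by (rule vector_derivative_unique_at)
    then show ?thesis by simp
  qed
  have "((\<lambda>y'. pdx f (x, y - 1) + integral {y - 1..y'} (\<lambda>s. ?g (x, s)))
      has_vector_derivative 0 + ?g (x, y)) (at y within {y - 1..y + 1})"
    by (intro has_vector_derivative_add has_vector_derivative_const integral_has_vector_derivative
        continuous_on_compose2[OF cont[of UNIV]] continuous_intros) auto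
  then have "((\<lambda>y'. pdx f (x, y - 1) + integral {y - 1..y'} (\<lambda>s. ?g (x, s)))
      has_vector_derivative ?g (x, y)) (at y within {y - 1..y + 1})"
    by simp
  then have "((\<lambda>y'. pdx f (x, y')) has_vector_derivative ?g (x, y)) (at y within {y - 1..y + 1})"
    by (rule has_vector_derivative_transform[rotated 2]) (simp, rule 2)
  then show "((\<lambda>y'. pdx f (x, y')) has_vector_derivative ?g (x, y)) (at y)"
    by (simp add: at_within_Icc_at)
qed

section \<open>Periodicity, wall conditions and convolution in x\<close>

definition x_periodic :: "(real \<times> real \<Rightarrow> complex) \<Rightarrow> bool" where
  "x_periodic f \<longleftrightarrow> (\<forall>x y. f (x + 2 * pi, y) = f (x, y))"

definition vanishes_near_walls :: "(real \<times> real \<Rightarrow> complex) \<Rightarrow> bool" where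
  "vanishes_near_walls f \<longleftrightarrow> (\<exists>r<1. \<forall>x y. \<bar>y\<bar> > r \<longrightarrow> f (x, y) = 0)"

lemma test_function_iff: "test_function f \<longleftrightarrow> smooth f \<and> x_periodic f \<and> vanishes_near_walls f"
  by (simp add: test_function_def smooth_def x_periodic_def vanishes_near_walls_def)

lemma x_periodic_pd:
  assumes f: "smooth f" "x_periodic f"
  shows "x_periodic (pdx f)" "x_periodic (pdy f)"
proof -
  have per: "f (x + 2 * pi, y) = f (x, y)" for x y
    using f by (simp add: x_periodic_def)
  have "((\<lambda>s. f (s + 2 * pi, y)) has_vector_derivative 1 *\<^sub>R pdx f (x + 2 * pi, y)) (at x)" for x y
  proof -
    have "((\<lambda>s. s + 2 * pi) has_vector_derivative 1) (at x)"
      using has_vector_derivative_add[OF has_vector_derivative_id has_vector_derivative_const] by simp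
    from vector_diff_chain_at[OF this smooth_has_pdx[OF f(1), of y]] show ?thesis
      by (simp add: o_def)
  qed
  then have "pdx f (x + 2 * pi, y) = pdx f (x, y)" for x y
    using vector_derivative_unique_at[OF _ smooth_has_pdx[OF f(1)]] by (simp add: per)
  then show "x_periodic (pdx f)" by (simp add: x_periodic_def)
  show "x_periodic (pdy f)"
    by (simp add: x_periodic_def pdy_def per)
qed

lemma vanishes_near_walls_pd:
  assumes f: "vanishes_near_walls f"
  shows "vanishes_near_walls (pdx f)" "vanishes_near_walls (pdy f)"
proof -
  obtain r where r: "r < 1" "\<And>x y. \<bar>y\<bar> > r \<Longrightarrow> f (x, y) = 0"
    using f by (auto simp: vanishes_near_walls_def)
  have "pdx f (x, y) = 0" if "\<bar>y\<bar> > r" for x y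
    using r(2)[OF that] by (simp add: pdx_def)
  then show "vanishes_near_walls (pdx f)" using r(1) by (auto simp: vanishes_near_walls_def)
  have "pdy f (x, y) = 0" if y: "\<bar>y\<bar> > r" for x y
  proof -
    have "open {s::real. \<bar>s\<bar> > r}"
      by (intro open_Collect_less continuous_intros)
    with has_vector_derivative_const[of 0 "at y"]
    have "((\<lambda>s. f (x, s)) has_vector_derivative 0) (at y)"
      by (rule has_vector_derivative_transform_within_open) (use y r(2) in simp_all)
    then show ?thesis by (simp add: pdy_def vector_derivative_at)
  qed
  then show "vanishes_near_walls (pdy f)" using r(1) by (auto simp: vanishes_near_walls_def)
qed

lemma test_function_pd:
  assumes "test_function f" shows "test_function (pdx f)" "test_function (pdy f)"
  using assms by (auto simp: test_function_iff smooth_pd x_periodic_pd vanishes_near_walls_pd)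

lemma test_function_mult:
  assumes "test_function f" "smooth g" "x_periodic g"
  shows "test_function (\<lambda>p. f p * g p)"
proof -
  obtain r where "r < 1" "\<And>x y. \<bar>y\<bar> > r \<Longrightarrow> f (x, y) = 0"
    using assms(1) by (auto simp: test_function_iff vanishes_near_walls_def)
  then have "vanishes_near_walls (\<lambda>p. f p * g p)"
    unfolding vanishes_near_walls_def by (intro exI[of _ r]) simp
  then show ?thesis
    using assms by (auto simp: test_function_iff smooth_mult x_periodic_def)
qed

lemma test_function_cnj: "test_function f \<Longrightarrow> test_function (\<lambda>p. cnj (f p))"
  by (auto simp: test_function_iff smooth_cnj x_periodic_def vanishes_near_walls_def)

definition xconv :: "(real \<Rightarrow> real) \<Rightarrow> (real \<times> real \<Rightarrow> complex) \<Rightarrow> real \<times> real \<Rightarrow> complex" where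
  "xconv b f = (\<lambda>(x, y). integral {0..2 * pi} (\<lambda>s. complex_of_real (b s) * f (x - s, y)))"

lemma continuous_on_shifted:
  fixes x :: real
  assumes "continuous_on UNIV b" "continuous_on UNIV f"
  shows "continuous_on S (\<lambda>s. complex_of_real (b s) * f (x - s, y))"
  by (intro continuous_on_mult continuous_on_of_real continuous_on_compose2[OF assms(2)]
      continuous_on_subset[OF assms(1)] continuous_on_Pair continuous_on_op_minus
      continuous_on_const) auto

lemma continuous_on_xconv:
  assumes b: "continuous_on UNIV b" and f: "continuous_on UNIV f"
  shows "continuous_on UNIV (xconv b f)"
proof -
  have "continuous_on (UNIV \<times> cbox 0 (2 * pi))
      (\<lambda>(p, s). complex_of_real (b s) * f (fst p - s, snd p))"
    unfolding case_prod_beta'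
    by (intro continuous_on_mult continuous_on_of_real continuous_on_compose2[OF f]
        continuous_on_compose2[OF b] continuous_on_Pair continuous_on_diff
        continuous_on_fst continuous_on_snd continuous_on_id) auto
  from integral_continuous_on_param[OF this] show ?thesis
    by (simp add: xconv_def case_prod_beta')
qed

lemma xconv_has_vector_derivative:
  assumes b: "continuous_on UNIV b" and f: "Ck (Suc k) f"
  shows "((\<lambda>s. xconv b f (s, y)) has_vector_derivative xconv b (pdx f) (x, y)) (at x)"
    "((\<lambda>s. xconv b f (x, s)) has_vector_derivative xconv b (pdy f) (x, y)) (at y)"
proof -
  have cf: "continuous_on UNIV f" "continuous_on UNIV (pdx f)" "continuous_on UNIV (pdy f)"
    using f by (auto intro: Ck_continuous)
  have c: "continuous_on S (\<lambda>q. complex_of_real (b (snd q)) * g (fst q - snd q, y))"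
      "continuous_on S (\<lambda>q. complex_of_real (b (snd q)) * g (x - snd q, fst q))"
    if "continuous_on UNIV g" for g and S :: "(real \<times> real) set"
    by (intro continuous_on_mult continuous_on_of_real continuous_on_compose2[OF that]
        continuous_on_compose2[OF b] continuous_on_snd continuous_on_fst continuous_on_id
        continuous_on_Pair continuous_on_diff continuous_on_const; simp)+
  have "((\<lambda>s. f (s - t, y)) has_vector_derivative pdx f (x - t, y)) (at x)" for x t
  proof -
    have "((\<lambda>s. s - t) has_vector_derivative 1) (at x)"
      using has_vector_derivative_diff[OF has_vector_derivative_id has_vector_derivative_const] by simp
    from vector_diff_chain_at[OF this Ck_has_pdx[OF f, of y]] show ?thesis
      by (simp add: o_def)
  qed
  then have "((\<lambda>s. integral (cbox 0 (2 * pi)) (\<lambda>t. complex_of_real (b t) * f (s - t, y)))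
      has_vector_derivative integral (cbox 0 (2 * pi)) (\<lambda>t. complex_of_real (b t) * pdx f (x - t, y)))
      (at x within UNIV)"
    using cf b
    by (intro leibniz_rule_vector_derivative)
      (auto simp: case_prod_beta' intro!: has_vector_derivative_mult_right
        integrable_continuous_real continuous_on_shifted c)
  then show "((\<lambda>s. xconv b f (s, y)) has_vector_derivative xconv b (pdx f) (x, y)) (at x)"
    by (simp add: xconv_def)
  have "((\<lambda>s. integral (cbox 0 (2 * pi)) (\<lambda>t. complex_of_real (b t) * f (x - t, s)))
      has_vector_derivative integral (cbox 0 (2 * pi)) (\<lambda>t. complex_of_real (b t) * pdy f (x - t, y)))
      (at y within UNIV)"
    using cf b
    by (intro leibniz_rule_vector_derivative)
      (auto simp: case_prod_beta' intro!: has_vector_derivative_mult_right Ck_has_pdy[OF f]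
        integrable_continuous_real continuous_on_shifted c)
  then show "((\<lambda>s. xconv b f (x, s)) has_vector_derivative xconv b (pdy f) (x, y)) (at y)"
    by (simp add: xconv_def)
qed

lemma pd_xconv:
  assumes "continuous_on UNIV b" "smooth f"
  shows "pdx (xconv b f) = xconv b (pdx f)" "pdy (xconv b f) = xconv b (pdy f)"
  using assms(2)
  by (auto intro!: pdx_eqI pdy_eqI
      xconv_has_vector_derivative[OF assms(1) smooth_def[THEN iffD1, rule_format]])

lemma smooth_xconv:
  assumes b: "continuous_on UNIV b" and f: "smooth f"
  shows "smooth (xconv b f)"
proof -
  have "Ck k (xconv b f)" if "Ck k f" for k
    using that
  proof (induction k arbitrary: f)
    case 0
    then show ?case by (simp add: continuous_on_xconv b)
  next
    case (Suc k)
    show ?case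
      by (rule Ck_SucI[OF continuous_on_xconv[OF b Ck_continuous[OF Suc.prems]]
            xconv_has_vector_derivative[OF b Suc.prems]])
        (use Suc in auto)
  qed
  then show ?thesis using f by (simp add: smooth_def)
qed

lemma test_function_xconv:
  assumes b: "continuous_on UNIV b" and f: "test_function f"
  shows "test_function (xconv b f)"
proof -
  have per: "f (x + 2 * pi - s, y) = f (x - s, y)" for x s y
    using f by (simp add: test_function_iff x_periodic_def diff_add_eq[symmetric])
  obtain r where r: "r < 1" "\<And>x y. \<bar>y\<bar> > r \<Longrightarrow> f (x, y) = 0"
    using f by (auto simp: test_function_iff vanishes_near_walls_def)
  show ?thesis
    unfolding test_function_iff
  proof (intro conjI)
    show "smooth (xconv b f)" using f by (intro smooth_xconv b) (simp add: test_function_iff)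
    show "x_periodic (xconv b f)" by (simp add: x_periodic_def xconv_def per)
    show "vanishes_near_walls (xconv b f)"
      unfolding vanishes_near_walls_def by (intro exI[of _ r]) (simp add: r xconv_def)
  qed
qed

section \<open>Integration over the channel\<close>

text \<open>
  The end points of the cell are included or excluded according to the measure, while the
  fundamental theorem of calculus works on closed intervals; the difference is a null set.
\<close>

lemma interval_integral_restrict:
  fixes f :: "real \<Rightarrow> complex"
  assumes S: "S \<in> sets lborel" "{a<..<b} \<subseteq> S" "S \<subseteq> {a..b}"
    and m: "f \<in> borel_measurable borel" and B: "\<And>x. x \<in> {a..b} \<Longrightarrow> cmod (f x) \<le> B"
  shows "integral\<^sup>L (restrict_space lborel S) f = integral {a..b} f"
    "integrable (restrict_space lborel S) f"
proof -
  have "emeasure lborel S \<le> emeasure lborel {a..b}" using S by (intro emeasure_mono) auto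
  also have "\<dots> < \<infinity>" by (simp add: emeasure_lborel_Icc_eq)
  finally have fin: "emeasure lborel S < \<infinity>" .
  have si: "set_integrable lborel S f"
  proof -
    have "integrable lborel (\<lambda>x. indicator S x *\<^sub>R f x)"
    proof (rule integrableI_bounded_set[where A = S and B = B])
      show "(\<lambda>x. indicator S x *\<^sub>R f x) \<in> borel_measurable lborel"
        using S(1) m by (intro borel_measurable_scaleR) auto
      show "AE x in lborel. x \<in> S \<longrightarrow> norm (indicator S x *\<^sub>R f x) \<le> B"
        using B S(3) by (intro AE_I2) (auto simp: indicator_def)
    qed (use S fin in auto)
    then show ?thesis by (simp add: set_integrable_def)
  qed
  show "integrable (restrict_space lborel S) f"
    using si S(1) by (subst integrable_restrict_space) (auto simp: set_integrable_def)
  have "integral\<^sup>L (restrict_space lborel S) f = (LINT x:S|lborel. f x)"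
    using S(1) by (subst integral_restrict_space) (auto simp: set_lebesgue_integral_def)
  also have "\<dots> = integral S f" by (rule set_borel_integral_eq_integral[OF si])
  also have "\<dots> = integral {a..b} f"
  proof (rule integral_spike_set)
    have sub: "{x \<in> S - {a..b}. f x \<noteq> 0} \<subseteq> {a, b}" "{x \<in> {a..b} - S. f x \<noteq> 0} \<subseteq> {a, b}"
      using S by force+
    show "negligible {x \<in> S - {a..b}. f x \<noteq> 0}" "negligible {x \<in> {a..b} - S. f x \<noteq> 0}"
      using negligible_subset[OF _ sub(1)] negligible_subset[OF _ sub(2)] by auto
  qed
  finally show "integral\<^sup>L (restrict_space lborel S) f = integral {a..b} f" .
qed

lemma torus_integral:
  fixes f :: "real \<Rightarrow> complex"
  assumes "f \<in> borel_measurable borel" "\<And>x. x \<in> {0..2 * pi} \<Longrightarrow> cmod (f x) \<le> B"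
  shows "integral\<^sup>L torus_measure f = integral {0..2 * pi} f" "integrable torus_measure f"
  unfolding torus_measure_def
  by (rule interval_integral_restrict[OF _ _ _ assms]; auto)+

lemma height_integral:
  fixes f :: "real \<Rightarrow> complex"
  assumes "f \<in> borel_measurable borel" "\<And>y. y \<in> {-1..1} \<Longrightarrow> cmod (f y) \<le> B"
  shows "integral\<^sup>L height_measure f = integral {-1..1} f" "integrable height_measure f"
  unfolding height_measure_def
  by (rule interval_integral_restrict[OF _ _ _ assms]; auto)+

lemma space_channel: "space channel = {0..<2 * pi} \<times> {-1<..<1}"
  by (auto simp: channel_def space_pair_measure torus_measure_def height_measure_def
      space_restrict_space)

lemma finite_measure_channel: "finite_measure channel"
  unfolding channel_def
  by (intro finite_measure_pair_measure finite_measure_torus finite_measure_height)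

interpretation channel: finite_measure channel by (rule finite_measure_channel)

lemma measurable_channel:
  assumes "f \<in> borel_measurable borel" shows "f \<in> borel_measurable channel"
proof -
  have "(\<lambda>x. x) \<in> borel_measurable torus_measure" "(\<lambda>x. x) \<in> borel_measurable height_measure"
    unfolding torus_measure_def height_measure_def
    by (intro measurable_restrict_space1; simp)+
  then have "(\<lambda>p. (fst p, snd p)) \<in> channel \<rightarrow>\<^sub>M borel \<Otimes>\<^sub>M borel"
    unfolding channel_def
    by (intro measurable_Pair measurable_compose[OF measurable_fst] measurable_compose[OF measurable_snd])
  then have "(\<lambda>p. p) \<in> channel \<rightarrow>\<^sub>M borel"
    by (simp add: borel_prod)
  from measurable_compose[OF this assms] show ?thesis by simp
qed

lemma bounded_on_channel:
  fixes f :: "real \<times> real \<Rightarrow> complex"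
  assumes "continuous_on UNIV f"
  obtains B where "\<And>x y. x \<in> {0..2 * pi} \<Longrightarrow> y \<in> {-1..1} \<Longrightarrow> cmod (f (x, y)) \<le> B"
proof -
  have "compact (f ` ({0..2 * pi} \<times> {-1..1}))"
    by (intro compact_continuous_image continuous_on_subset[OF assms] compact_Times) auto
  then have "bounded (f ` ({0..2 * pi} \<times> {-1..1}))" by (rule compact_imp_bounded)
  then show ?thesis unfolding bounded_iff by (auto intro: that)
qed

lemma integrable_channel_continuous:
  fixes f :: "real \<times> real \<Rightarrow> complex"
  assumes f: "continuous_on UNIV f" shows "integrable channel f"
proof -
  obtain B where "\<And>x y. x \<in> {0..2 * pi} \<Longrightarrow> y \<in> {-1..1} \<Longrightarrow> cmod (f (x, y)) \<le> B"
    using bounded_on_channel[OF f] by blast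
  then show ?thesis
    by (intro channel.integrable_const_bound[where B = B] measurable_channel AE_I2
        borel_measurable_continuous_onI f) (auto simp: space_channel)
qed

lemma square_integrable_continuous:
  assumes f: "continuous_on UNIV f" shows "square_integrable f"
  unfolding square_integrable_def
proof
  show "f \<in> borel_measurable channel"
    by (intro measurable_channel borel_measurable_continuous_onI f)
  have "integrable channel (\<lambda>p. complex_of_real ((cmod (f p))\<^sup>2))"
    by (intro integrable_channel_continuous continuous_intros f)
  then show "integrable channel (\<lambda>p. (cmod (f p))\<^sup>2)"
    using complex_of_real_integrable_eq by blast
qed

lemma continuous_on_section:
  assumes "continuous_on UNIV (f :: real \<times> real \<Rightarrow> complex)"
  shows "continuous_on S (\<lambda>x. f (x, y))" "continuous_on S (\<lambda>y. f (x, y))"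
  by (intro continuous_on_compose2[OF assms] continuous_intros; simp)+

lemma channel_integral_pdx:
  assumes f: "test_function f" shows "(\<integral>p. pdx f p \<partial>channel) = 0"
proof -
  have s: "smooth f" and p: "f (x + 2 * pi, y) = f (x, y)" for x y
    using f by (auto simp: test_function_iff x_periodic_def)
  have c: "continuous_on UNIV (pdx f)" by (intro smooth_continuous smooth_pd s)
  obtain B where B: "\<And>x y. x \<in> {0..2 * pi} \<Longrightarrow> y \<in> {-1..1} \<Longrightarrow> cmod (pdx f (x, y)) \<le> B"
    using bounded_on_channel[OF c] by blast
  have "(\<integral>x. pdx f (x, y) \<partial>torus_measure) = 0" if y: "y \<in> space height_measure" for y
  proof -
    have "y \<in> {-1..1}" using y by (auto simp: height_measure_def space_restrict_space)
    then have "(\<integral>x. pdx f (x, y) \<partial>torus_measure) = integral {0..2 * pi} (\<lambda>x. pdx f (x, y))"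
      by (intro torus_integral[where B = B] borel_measurable_continuous_onI continuous_on_section c B)
    also have "\<dots> = f (2 * pi, y) - f (0, y)"
      by (intro integral_unique fundamental_theorem_of_calculus smooth_has_pdx s) simp
    also have "\<dots> = 0" using p[of 0 y] by simp
    finally show ?thesis .
  qed
  then have "(\<integral>y. (\<integral>x. pdx f (x, y) \<partial>torus_measure) \<partial>height_measure) = 0"
    by (simp cong: Bochner_Integration.integral_cong)
  then show ?thesis
    using chan.integral_snd[of "\<lambda>x y. pdx f (x, y)"] integrable_channel_continuous[OF c]
    by (simp add: channel_def)
qed

lemma channel_integral_pdy:
  assumes f: "test_function f" shows "(\<integral>p. pdy f p \<partial>channel) = 0"
proof -
  have s: "smooth f" and w: "f (x, 1) = 0" "f (x, -1) = 0" for x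
    using f by (auto simp: test_function_iff vanishes_near_walls_def)
  have c: "continuous_on UNIV (pdy f)" by (intro smooth_continuous smooth_pd s)
  obtain B where B: "\<And>x y. x \<in> {0..2 * pi} \<Longrightarrow> y \<in> {-1..1} \<Longrightarrow> cmod (pdy f (x, y)) \<le> B"
    using bounded_on_channel[OF c] by blast
  have "(\<integral>y. pdy f (x, y) \<partial>height_measure) = 0" if x: "x \<in> space torus_measure" for x
  proof -
    have "x \<in> {0..2 * pi}" using x by (auto simp: torus_measure_def space_restrict_space)
    then have "(\<integral>y. pdy f (x, y) \<partial>height_measure) = integral {-1..1} (\<lambda>y. pdy f (x, y))"
      by (intro height_integral[where B = B] borel_measurable_continuous_onI continuous_on_section c B)
    also have "\<dots> = f (x, 1) - f (x, -1)"
      by (intro integral_unique fundamental_theorem_of_calculus smooth_has_pdy s) simp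
    finally show ?thesis by (simp add: w)
  qed
  then have "(\<integral>x. (\<integral>y. pdy f (x, y) \<partial>height_measure) \<partial>torus_measure) = 0"
    by (simp cong: Bochner_Integration.integral_cong)
  then show ?thesis
    using chan.integral_fst[of "\<lambda>x y. pdy f (x, y)"] integrable_channel_continuous[OF c]
    by (simp add: channel_def)
qed

section \<open>The periodic antiderivative\<close>

text \<open>
  Unrolled to the fundamental cell, a convolution becomes an integral operator whose kernel
  repeats \<open>b\<close> periodically.
\<close>

definition cell_kernel :: "(real \<Rightarrow> real) \<Rightarrow> real \<Rightarrow> real \<Rightarrow> real" where
  "cell_kernel b x x' = (if x' \<le> x then b (x - x') else b (x - x' + 2 * pi))"

lemma xconv_on_cell:
  assumes b: "continuous_on UNIV b" and f: "continuous_on UNIV f" "x_periodic f"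
    and x: "x \<in> {0..<2 * pi}"
  shows "xconv b f (x, y) = (\<integral>x'. complex_of_real (cell_kernel b x x') * f (x', y) \<partial>torus_measure)"
proof -
  define g where "g s = complex_of_real (b s) * f (x - s, y)" for s
  define h where "h x' = complex_of_real (cell_kernel b x x') * f (x', y)" for x'
  have cg: "continuous_on S g" for S unfolding g_def by (intro continuous_on_shifted b f)
  have per: "f (x' - 2 * pi, y) = f (x', y)" for x'
    using f(2) unfolding x_periodic_def by (metis diff_add_cancel)
  have h1: "h x' = g (x - x')" if "x' \<le> x" for x'
    using that by (simp add: h_def g_def cell_kernel_def)
  have h2: "h x' = g (x + 2 * pi - x')" if "x' > x" for x'
    using that per[of x'] by (simp add: h_def g_def cell_kernel_def algebra_simps)
  have c1: "continuous_on S (\<lambda>x'. g (c - x'))" for S c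
    by (intro continuous_on_compose2[OF cg[of UNIV]] continuous_intros) auto
  have i1: "(h has_integral integral {0..x} g) {0..x}"
  proof -
    have "(g has_integral integral {0..x} g) {0..x}"
      by (intro integrable_integral integrable_continuous_real cg)
    then have "((\<lambda>u. g (- u)) has_integral integral {0..x} g) {-x..-0}"
      unfolding has_integral_reflect_real .
    from has_integral_shift_real_ivl[OF this, of "-x"]
    have "((\<lambda>x'. g (x - x')) has_integral integral {0..x} g) {0..x}" by simp
    then show ?thesis by (rule has_integral_eq[rotated]) (simp add: h1)
  qed
  have i2: "(h has_integral integral {x..2 * pi} g) {x..2 * pi}"
  proof -
    have "(g has_integral integral {x..2 * pi} g) {x..2 * pi}"
      by (intro integrable_integral integrable_continuous_real cg)
    then have "((\<lambda>u. g (- u)) has_integral integral {x..2 * pi} g) {-(2 * pi)..-x}"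
      unfolding has_integral_reflect_real .
    from has_integral_shift_real_ivl[OF this, of "-(x + 2 * pi)"]
    have "((\<lambda>x'. g (x + 2 * pi - x')) has_integral integral {x..2 * pi} g) {x..2 * pi}"
      by (simp add: algebra_simps)
    then show ?thesis
      by (rule has_integral_spike_finite[of "{x}", rotated 2]) (auto simp: h2)
  qed
  have "(h has_integral integral {0..x} g + integral {x..2 * pi} g) {0..2 * pi}"
    using x by (intro has_integral_combine[OF _ _ i1 i2]) auto
  also have "integral {0..x} g + integral {x..2 * pi} g = integral {0..2 * pi} g"
    using x by (intro Henstock_Kurzweil_Integration.integral_combine integrable_continuous_real cg) auto
  finally have h: "integral {0..2 * pi} h = integral {0..2 * pi} g"
    by (rule integral_unique)
  have heq: "h = (\<lambda>x'. if x' \<le> x then g (x - x') else g (x + 2 * pi - x'))"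
    using h1 h2 by (auto simp: fun_eq_iff)
  obtain B1 where B1: "\<And>u. u \<in> {-(2 * pi)..4 * pi} \<Longrightarrow> cmod (g u) \<le> B1"
  proof -
    have "bounded (g ` {-(2 * pi)..4 * pi})"
      by (intro compact_imp_bounded compact_continuous_image cg) auto
    then obtain B where "\<forall>z \<in> g ` {-(2 * pi)..4 * pi}. cmod z \<le> B"
      unfolding bounded_iff ..
    then show ?thesis by (intro that[of B]) auto
  qed
  have "integral\<^sup>L torus_measure h = integral {0..2 * pi} h"
  proof (rule torus_integral)
    show "h \<in> borel_measurable borel"
      unfolding heq
      by (intro measurable_If borel_measurable_continuous_onI c1) simp_all
    show "cmod (h x') \<le> B1" if "x' \<in> {0..2 * pi}" for x'
      unfolding heq using that x by (auto intro!: B1)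
  qed
  then show ?thesis using h by (simp add: xconv_def g_def[abs_def] h_def[abs_def])
qed

text \<open>
  The cell formula only covers \<open>x\<close> in the fundamental cell; periodicity moves every other \<open>x\<close>
  there.
\<close>

lemma x_mean_eq_xconv:
  assumes "continuous_on UNIV f" "x_periodic f"
  shows "x_mean f y = xconv (\<lambda>_. 1 / (2 * pi)) f (x, y)"
proof -
  define k where "k = \<lfloor>x / (2 * pi)\<rfloor>"
  let ?x = "x - of_int k * (2 * pi)"
  have "of_int k \<le> x / (2 * pi)" "x / (2 * pi) < of_int k + 1"
    unfolding k_def by linarith+
  then have cell: "?x \<in> {0..<2 * pi}" by (auto simp: field_simps)
  have up: "f (x + real n * (2 * pi), y) = f (x, y)" for x y n
  proof (induction n)
    case (Suc n)
    then show ?case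
      using assms(2)[unfolded x_periodic_def, rule_format, of "x + real n * (2 * pi)" y]
      by (simp add: algebra_simps)
  qed simp
  have per: "f (u - of_int k * (2 * pi), y) = f (u, y)" for u
  proof (cases "k \<ge> 0")
    case True
    with up[of "u - of_int k * (2 * pi)" "nat k"] show ?thesis by simp
  next
    case False
    with up[of u "nat (- k)"] show ?thesis by simp
  qed
  have "f (?x - s, y) = f (x - s, y)" for s
    using per[of "x - s"] by (simp add: algebra_simps)
  then have "xconv (\<lambda>_. 1 / (2 * pi)) f (x, y) = xconv (\<lambda>_. 1 / (2 * pi)) f (?x, y)"
    by (simp add: xconv_def)
  also have "\<dots> = x_mean f y"
    by (subst xconv_on_cell[OF _ assms cell])
      (simp_all add: x_mean_def cell_kernel_def continuous_on_const)
  finally show ?thesis by simp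
qed

text \<open>
  The weight \<open>1/2 - s/(2\<pi>)\<close> is the sawtooth whose periodic derivative is the Dirac mass minus its
  mean; convolution with it integrates in \<open>x\<close> and removes the mean at the same time.
\<close>

definition saw :: "real \<Rightarrow> real" where
  "saw s = 1 / 2 - s / (2 * pi)"

abbreviation xint :: "(real \<times> real \<Rightarrow> complex) \<Rightarrow> real \<times> real \<Rightarrow> complex" where
  "xint \<equiv> xconv saw"

lemma continuous_saw: "continuous_on S saw"
  unfolding saw_def by (intro continuous_intros) auto

text \<open>
  Integration by parts: the sawtooth takes the values \<open>1/2\<close> and \<open>-1/2\<close> at the end points, so by
  periodicity the boundary terms add up to \<open>f\<close>, and its constant slope produces the mean.
\<close>

lemma xint_pdx:
  assumes f: "smooth f" "x_periodic f"
  shows "xint (pdx f) (x, y) = f (x, y) - x_mean f y"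
proof -
  have c: "continuous_on UNIV f" by (rule smooth_continuous[OF f(1)])
  have der: "((\<lambda>s. - (complex_of_real (saw s) * f (x - s, y))) has_vector_derivative
      complex_of_real (1 / (2 * pi)) * f (x - s, y) + complex_of_real (saw s) * pdx f (x - s, y))
      (at s within S)" for s S
  proof -
    have "((\<lambda>s. x - s) has_vector_derivative -1) (at s)"
      using has_vector_derivative_diff[OF has_vector_derivative_const has_vector_derivative_id] by simp
    from vector_diff_chain_at[OF this smooth_has_pdx[OF f(1), of y]]
    have 1: "((\<lambda>s. f (x - s, y)) has_vector_derivative - pdx f (x - s, y)) (at s within S)"
      by (simp add: o_def has_vector_derivative_at_within)
    have "(saw has_real_derivative - (1 / (2 * pi))) (at s within S)"
      unfolding saw_def by (auto intro!: derivative_eq_intros)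
    then have 2: "((\<lambda>s. complex_of_real (saw s)) has_vector_derivative
        complex_of_real (- (1 / (2 * pi)))) (at s within S)"
      by (rule has_vector_derivative_of_real)
    show ?thesis
      using has_vector_derivative_minus[OF has_vector_derivative_mult[OF 2 1]]
      by (simp add: algebra_simps)
  qed
  have "((\<lambda>s. complex_of_real (1 / (2 * pi)) * f (x - s, y) + complex_of_real (saw s) * pdx f (x - s, y))
      has_integral - (complex_of_real (saw (2 * pi)) * f (x - 2 * pi, y))
        - - (complex_of_real (saw 0) * f (x - 0, y))) {0..2 * pi}"
    by (intro fundamental_theorem_of_calculus der) simp
  moreover have "f (x - 2 * pi, y) = f (x, y)"
    using f(2) unfolding x_periodic_def by (metis diff_add_cancel)
  ultimately have "((\<lambda>s. complex_of_real (1 / (2 * pi)) * f (x - s, y)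
      + complex_of_real (saw s) * pdx f (x - s, y)) has_integral f (x, y)) {0..2 * pi}"
    by (simp add: saw_def)
  moreover have "((\<lambda>s. complex_of_real (1 / (2 * pi)) * f (x - s, y)
      + complex_of_real (saw s) * pdx f (x - s, y)) has_integral
      xconv (\<lambda>_. 1 / (2 * pi)) f (x, y) + xint (pdx f) (x, y)) {0..2 * pi}"
    unfolding xconv_def prod.case
    by (intro has_integral_add integrable_integral integrable_continuous_real continuous_on_shifted
        c smooth_continuous smooth_pd f continuous_saw continuous_on_const)
  ultimately have "f (x, y) = xconv (\<lambda>_. 1 / (2 * pi)) f (x, y) + xint (pdx f) (x, y)"
    by (rule has_integral_unique)
  then show ?thesis using x_mean_eq_xconv[OF c f(2), of y x] by simp
qed

section \<open>Square-integrable classes and their representatives\<close>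

lemma L2_rel_refl: "L2_rel f f \<longleftrightarrow> square_integrable f"
  by (simp add: L2_rel_def)

lemma square_integrable_rep: "square_integrable (rep_L2 u)"
  using Quotient3_rep_reflp[OF Quotient3_L2, of u] by (simp add: L2_rel_refl)

lemma to_L2_rep: "to_L2 (rep_L2 u) = u"
  by (rule Quotient3_abs_rep[OF Quotient3_L2])

lemma to_L2_eqI:
  assumes "square_integrable f" "square_integrable g" "AE p in channel. f p = g p"
  shows "to_L2 f = to_L2 g"
  using Quotient3_rel_abs[OF Quotient3_L2, of f g] assms by (simp add: L2_rel_def)

lemma AE_rep_to_L2:
  assumes "square_integrable f" shows "AE p in channel. rep_L2 (to_L2 f) p = f p"
  using Quotient3_rep_abs[OF Quotient3_L2, of f] assms by (simp add: L2_rel_def)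

lemma to_L2_add:
  "square_integrable f \<Longrightarrow> square_integrable g \<Longrightarrow> to_L2 f + to_L2 g = to_L2 (\<lambda>p. f p + g p)"
  by (simp add: plus_L2.abs_eq L2_rel_refl)

lemma to_L2_diff:
  "square_integrable f \<Longrightarrow> square_integrable g \<Longrightarrow> to_L2 f - to_L2 g = to_L2 (\<lambda>p. f p - g p)"
  by (simp add: minus_L2.abs_eq L2_rel_refl)

lemma to_L2_scaleR:
  "square_integrable f \<Longrightarrow> r *\<^sub>R to_L2 f = to_L2 (\<lambda>p. complex_of_real r * f p)"
  by (simp add: scaleR_L2.abs_eq L2_rel_refl)

lemma inner_to_L2:
  "square_integrable f \<Longrightarrow> square_integrable g \<Longrightarrow> to_L2 f \<bullet> to_L2 g = (\<integral>p. f p \<bullet> g p \<partial>channel)"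
  by (simp add: inner_L2.abs_eq L2_rel_refl)

lemma inner_to_L2_right:
  "square_integrable g \<Longrightarrow> u \<bullet> to_L2 g = (\<integral>p. rep_L2 u p \<bullet> g p \<partial>channel)"
  using inner_to_L2[OF square_integrable_rep, of g u] by (simp add: to_L2_rep)

lemma power2_norm_to_L2:
  assumes "square_integrable f"
  shows "(norm (to_L2 f))\<^sup>2 = (\<integral>p. (cmod (f p))\<^sup>2 \<partial>channel)"
  using assms by (simp add: norm_to_L2)

section \<open>Integral operators in the streamwise variable\<close>

definition kint :: "(real \<Rightarrow> real \<Rightarrow> real) \<Rightarrow> (real \<times> real \<Rightarrow> complex) \<Rightarrow> real \<times> real \<Rightarrow> complex" where
  "kint K f = (\<lambda>(x, y). \<integral>x'. complex_of_real (K x x') * f (x', y) \<partial>torus_measure)"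

text \<open>
  The operator acts on an arbitrarily chosen representative; \<open>kernel_op_to_L2\<close> shows that the choice
  is immaterial.
\<close>

definition kernel_op :: "(real \<Rightarrow> real \<Rightarrow> real) \<Rightarrow> L2 \<Rightarrow> L2" where
  "kernel_op K u = to_L2 (kint K (rep_L2 u))"

text \<open>
  Only the fundamental cell matters for the bound. A strictly positive bound makes the estimates
  below trivially true on sections of infinite norm, where \<open>0 * \<infinity>\<close> would be \<open>0\<close>.
\<close>

definition bounded_kernel :: "real \<Rightarrow> (real \<Rightarrow> real \<Rightarrow> real) \<Rightarrow> bool" where
  "bounded_kernel B K \<longleftrightarrow> B > 0 \<and> (\<lambda>(x, x'). K x x') \<in> borel_measurable (borel \<Otimes>\<^sub>M borel) \<and>
     (\<forall>x\<in>{0..<2 * pi}. \<forall>x'\<in>{0..<2 * pi}. \<bar>K x x'\<bar> \<le> B)"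

lemma space_torus: "space torus_measure = {0..<2 * pi}"
  by (simp add: torus_measure_def space_restrict_space)

lemma measurable_kernel:
  assumes "bounded_kernel B K"
  shows "(\<lambda>(x, x'). K x x') \<in> borel_measurable (torus_measure \<Otimes>\<^sub>M torus_measure)"
proof -
  have [measurable]: "(\<lambda>x. x) \<in> torus_measure \<rightarrow>\<^sub>M borel"
    unfolding torus_measure_def by (intro measurable_restrict_space1) simp
  have [measurable]: "(\<lambda>(x, x'). K x x') \<in> borel_measurable (borel \<Otimes>\<^sub>M borel)"
    using assms by (simp add: bounded_kernel_def)
  show ?thesis by measurable
qed

lemma measurable_kint:
  assumes K: "bounded_kernel B K" and f: "f \<in> borel_measurable channel"
  shows "kint K f \<in> borel_measurable channel"
proof -
  have [measurable]: "(\<lambda>(x, x'). K x x') \<in> borel_measurable (torus_measure \<Otimes>\<^sub>M torus_measure)"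
    by (rule measurable_kernel[OF K])
  have [measurable]: "f \<in> borel_measurable (torus_measure \<Otimes>\<^sub>M height_measure)"
    using f by (simp add: channel_def)
  show ?thesis unfolding kint_def channel_def by measurable
qed

lemma measurable_section:
  assumes "f \<in> borel_measurable channel" "y \<in> space height_measure"
  shows "(\<lambda>x. f (x, y)) \<in> borel_measurable torus_measure"
proof -
  have [measurable]: "f \<in> borel_measurable (torus_measure \<Otimes>\<^sub>M height_measure)"
    using assms by (simp add: channel_def)
  show ?thesis using assms(2) by measurable
qed

lemma measurable_kernel_section:
  assumes K: "bounded_kernel B K" and x: "x \<in> {0..<2 * pi}"
  shows "(\<lambda>x'. K x x') \<in> borel_measurable torus_measure"
proof -
  have [measurable]: "(\<lambda>(x, x'). K x x') \<in> borel_measurable (torus_measure \<Otimes>\<^sub>M torus_measure)"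
    by (rule measurable_kernel[OF K])
  have [measurable]: "x \<in> space torus_measure" using x by (simp add: space_torus)
  show ?thesis by measurable
qed

lemma integrable_section:
  assumes "h \<in> borel_measurable torus_measure" "integrable torus_measure (\<lambda>x. (cmod (h x))\<^sup>2)"
  shows "integrable torus_measure h"
proof (rule Bochner_Integration.integrable_bound[OF _ assms(1)])
  show "integrable torus_measure (\<lambda>x. 1 + (cmod (h x))\<^sup>2)"
    using assms(2) by simp
  have "c \<le> 1 + c\<^sup>2" if "c \<ge> 0" for c :: real
    using zero_le_power2[of "c - 1"] that unfolding power2_diff by simp
  then show "AE x in torus_measure. norm (h x) \<le> norm (1 + (cmod (h x))\<^sup>2)"
    by (simp add: abs_of_nonneg add_nonneg_nonneg)
qed

lemma kernel_times_section:
  assumes K: "bounded_kernel B K" and x: "x \<in> {0..<2 * pi}"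
    and h: "h \<in> borel_measurable torus_measure" "integrable torus_measure (\<lambda>x. (cmod (h x))\<^sup>2)"
  shows "(\<lambda>x'. complex_of_real (K x x') * h x') \<in> borel_measurable torus_measure"
    "integrable torus_measure (\<lambda>x'. (cmod (complex_of_real (K x x') * h x'))\<^sup>2)"
    "(\<integral>x'. (cmod (complex_of_real (K x x') * h x'))\<^sup>2 \<partial>torus_measure)
      \<le> B\<^sup>2 * (\<integral>x'. (cmod (h x'))\<^sup>2 \<partial>torus_measure)"
    "integrable torus_measure (\<lambda>x'. complex_of_real (K x x') * h x')"
proof -
  have [measurable]: "(\<lambda>x'. K x x') \<in> borel_measurable torus_measure"
    by (rule measurable_kernel_section[OF K x])
  note [measurable] = h(1)
  show m: "(\<lambda>x'. complex_of_real (K x x') * h x') \<in> borel_measurable torus_measure"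
    by measurable
  have le: "(cmod (complex_of_real (K x x') * h x'))\<^sup>2 \<le> B\<^sup>2 * (cmod (h x'))\<^sup>2"
    if "x' \<in> space torus_measure" for x'
  proof -
    have "\<bar>K x x'\<bar> \<le> B" using K x that by (simp add: bounded_kernel_def space_torus)
    then have "\<bar>K x x'\<bar> * cmod (h x') \<le> B * cmod (h x')" by (intro mult_right_mono) auto
    then show ?thesis
      unfolding norm_mult norm_of_real power_mult_distrib[symmetric]
      by (intro power_mono) auto
  qed
  show i: "integrable torus_measure (\<lambda>x'. (cmod (complex_of_real (K x x') * h x'))\<^sup>2)"
  proof (rule Bochner_Integration.integrable_bound)
    show "integrable torus_measure (\<lambda>x'. B\<^sup>2 * (cmod (h x'))\<^sup>2)" using h(2) by simp
    show "AE x' in torus_measure. norm ((cmod (complex_of_real (K x x') * h x'))\<^sup>2)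
        \<le> norm (B\<^sup>2 * (cmod (h x'))\<^sup>2)"
      by (rule AE_I2) (use le in \<open>simp add: abs_mult\<close>)
  qed measurable
  show "(\<integral>x'. (cmod (complex_of_real (K x x') * h x'))\<^sup>2 \<partial>torus_measure)
      \<le> B\<^sup>2 * (\<integral>x'. (cmod (h x'))\<^sup>2 \<partial>torus_measure)"
    unfolding integral_mult_right_zero[symmetric]
    by (rule integral_mono[OF i]) (use h(2) le in auto)
  show "integrable torus_measure (\<lambda>x'. complex_of_real (K x x') * h x')"
    by (rule integrable_section[OF m i])
qed

text \<open>
  Cauchy-Schwarz on each section. Extended integrals make the sections of infinite norm harmless.
\<close>

lemma kint_section_bound:
  assumes K: "bounded_kernel B K" and f: "f \<in> borel_measurable channel"
    and y: "y \<in> space height_measure"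
  shows "(\<integral>\<^sup>+x. ennreal ((cmod (kint K f (x, y)))\<^sup>2) \<partial>torus_measure)
    \<le> ennreal ((2 * pi * B)\<^sup>2) * (\<integral>\<^sup>+x. ennreal ((cmod (f (x, y)))\<^sup>2) \<partial>torus_measure)"
proof (cases "(\<integral>\<^sup>+x. ennreal ((cmod (f (x, y)))\<^sup>2) \<partial>torus_measure) = \<infinity>")
  case True
  have "B > 0" using K by (simp add: bounded_kernel_def)
  then have "(2 * pi * B)\<^sup>2 > 0" by simp
  then have "ennreal ((2 * pi * B)\<^sup>2) \<noteq> 0" by (simp only: ennreal_eq_0_iff not_le)
  then show ?thesis unfolding True by (simp add: ennreal_mult_top)
next
  case False
  note h = measurable_section[OF f y]
  have i: "integrable torus_measure (\<lambda>x. (cmod (f (x, y)))\<^sup>2)"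
    using False h by (intro integrableI_bounded) (auto simp: less_top)
  define I where "I = (\<integral>x. (cmod (f (x, y)))\<^sup>2 \<partial>torus_measure)"
  have bd: "(cmod (kint K f (x, y)))\<^sup>2 \<le> 2 * pi * B\<^sup>2 * I" if x: "x \<in> space torus_measure" for x
  proof -
    have x: "x \<in> {0..<2 * pi}" using x by (simp add: space_torus)
    note k = kernel_times_section[OF K x h i]
    have "(1 / (2 * pi))\<^sup>2 * (cmod (kint K f (x, y)))\<^sup>2
        = (cmod (complex_of_real (1 / (2 * pi)) * kint K f (x, y)))\<^sup>2"
      by (simp only: norm_mult norm_of_real power_mult_distrib power2_abs)
    also have "\<dots> \<le> (1 / (2 * pi)) * (\<integral>x'. (cmod (complex_of_real (K x x') * f (x', y)))\<^sup>2 \<partial>torus_measure)"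
      using x_mean_bound[OF k(1,2)] by (simp add: kint_def)
    also have "\<dots> \<le> (1 / (2 * pi)) * (B\<^sup>2 * I)"
      unfolding I_def by (intro mult_left_mono k(3)) auto
    finally show ?thesis by (simp add: power2_eq_square field_simps)
  qed
  have I0: "I \<ge> 0" unfolding I_def by simp
  have "(\<integral>\<^sup>+x. ennreal ((cmod (kint K f (x, y)))\<^sup>2) \<partial>torus_measure)
      \<le> (\<integral>\<^sup>+x. ennreal (2 * pi * B\<^sup>2 * I) \<partial>torus_measure)"
    using bd by (intro nn_integral_mono ennreal_leI) auto
  also have "\<dots> = ennreal (2 * pi * B\<^sup>2 * I) * ennreal (2 * pi)"
    using measure_torus by (simp add: torus.emeasure_eq_measure)
  also have "\<dots> = ennreal ((2 * pi * B)\<^sup>2) * ennreal I"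
  proof -
    have "2 * pi * B\<^sup>2 * I * (2 * pi) = (2 * pi * B)\<^sup>2 * I"
      by (simp add: power2_eq_square)
    moreover have "ennreal (2 * pi * B\<^sup>2 * I) * ennreal (2 * pi) = ennreal (2 * pi * B\<^sup>2 * I * (2 * pi))"
      using I0 by (intro ennreal_mult[symmetric]) auto
    moreover have "ennreal ((2 * pi * B)\<^sup>2) * ennreal I = ennreal ((2 * pi * B)\<^sup>2 * I)"
      using I0 by (intro ennreal_mult[symmetric]) auto
    ultimately show ?thesis by (simp only:)
  qed
  also have "ennreal I = (\<integral>\<^sup>+x. ennreal ((cmod (f (x, y)))\<^sup>2) \<partial>torus_measure)"
    unfolding I_def using nn_integral_eq_integral[OF i] by simp
  finally show ?thesis .
qed

lemma kint_bound:
  assumes K: "bounded_kernel B K" and f: "square_integrable f"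
  shows "square_integrable (kint K f)"
    "(\<integral>p. (cmod (kint K f p))\<^sup>2 \<partial>channel) \<le> (2 * pi * B)\<^sup>2 * (\<integral>p. (cmod (f p))\<^sup>2 \<partial>channel)"
proof -
  have fm: "f \<in> borel_measurable channel" and fi: "integrable channel (\<lambda>p. (cmod (f p))\<^sup>2)"
    using f by (auto simp: square_integrable_def)
  note km = measurable_kint[OF K fm]
  have [measurable]: "f \<in> borel_measurable (torus_measure \<Otimes>\<^sub>M height_measure)"
      "kint K f \<in> borel_measurable (torus_measure \<Otimes>\<^sub>M height_measure)"
    using fm km by (simp_all add: channel_def)
  have "(\<integral>\<^sup>+p. ennreal ((cmod (kint K f p))\<^sup>2) \<partial>channel)
      = (\<integral>\<^sup>+y. (\<integral>\<^sup>+x. ennreal ((cmod (kint K f (x, y)))\<^sup>2) \<partial>torus_measure) \<partial>height_measure)"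
    unfolding channel_def by (rule chan.nn_integral_snd[symmetric]) measurable
  also have "\<dots> \<le> (\<integral>\<^sup>+y. ennreal ((2 * pi * B)\<^sup>2) *
      (\<integral>\<^sup>+x. ennreal ((cmod (f (x, y)))\<^sup>2) \<partial>torus_measure) \<partial>height_measure)"
    by (intro nn_integral_mono kint_section_bound[OF K fm])
  also have "\<dots> = ennreal ((2 * pi * B)\<^sup>2) *
      (\<integral>\<^sup>+y. (\<integral>\<^sup>+x. ennreal ((cmod (f (x, y)))\<^sup>2) \<partial>torus_measure) \<partial>height_measure)"
    by (intro nn_integral_cmult) measurable
  also have "(\<integral>\<^sup>+y. (\<integral>\<^sup>+x. ennreal ((cmod (f (x, y)))\<^sup>2) \<partial>torus_measure) \<partial>height_measure)
      = (\<integral>\<^sup>+p. ennreal ((cmod (f p))\<^sup>2) \<partial>channel)"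
    unfolding channel_def by (rule chan.nn_integral_snd) measurable
  also have "\<dots> = ennreal (\<integral>p. (cmod (f p))\<^sup>2 \<partial>channel)"
    by (rule nn_integral_eq_integral[OF fi]) simp
  finally have bd: "(\<integral>\<^sup>+p. ennreal ((cmod (kint K f p))\<^sup>2) \<partial>channel)
      \<le> ennreal ((2 * pi * B)\<^sup>2 * (\<integral>p. (cmod (f p))\<^sup>2 \<partial>channel))"
    by (simp add: ennreal_mult)
  have ki: "integrable channel (\<lambda>p. (cmod (kint K f p))\<^sup>2)"
  proof (rule integrableI_bounded)
    show "(\<lambda>p. (cmod (kint K f p))\<^sup>2) \<in> borel_measurable channel" using km by measurable
    show "(\<integral>\<^sup>+p. ennreal (norm ((cmod (kint K f p))\<^sup>2)) \<partial>channel) < \<infinity>"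
      using le_less_trans[OF bd ennreal_less_top] by simp
  qed
  then show "square_integrable (kint K f)" using km by (simp add: square_integrable_def)
  have "ennreal (\<integral>p. (cmod (kint K f p))\<^sup>2 \<partial>channel)
      \<le> ennreal ((2 * pi * B)\<^sup>2 * (\<integral>p. (cmod (f p))\<^sup>2 \<partial>channel))"
    using bd nn_integral_eq_integral[OF ki] by simp
  then show "(\<integral>p. (cmod (kint K f p))\<^sup>2 \<partial>channel) \<le> (2 * pi * B)\<^sup>2 * (\<integral>p. (cmod (f p))\<^sup>2 \<partial>channel)"
    by (subst (asm) ennreal_le_iff) auto
qed

text \<open>
  Integral operators in \<open>x\<close> are computed section by section, on the almost all heights where the
  section is well behaved; this transfers such statements back to the channel.
\<close>

lemma AE_channel_sections:
  assumes "AE y in height_measure. P y" "{p \<in> space channel. Q p} \<in> sets channel"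
    "\<And>x y. x \<in> {0..<2 * pi} \<Longrightarrow> P y \<Longrightarrow> y \<in> space height_measure \<Longrightarrow> Q (x, y)"
  shows "AE p in channel. Q p"
proof -
  have "AE x in torus_measure. AE y in height_measure. Q (x, y)"
    using AE_space
  proof eventually_elim
    case (elim x)
    from assms(1) AE_space show ?case
      by eventually_elim (use elim assms(3) in \<open>auto simp: space_torus\<close>)
  qed
  then show ?thesis
    using assms(2) unfolding channel_def by (intro chan.AE_pair_measure) auto
qed

lemma kint_cong_AE:
  assumes K: "bounded_kernel B K" and fg: "L2_rel f g"
  shows "AE p in channel. kint K f p = kint K g p"
proof -
  have m: "f \<in> borel_measurable channel" "g \<in> borel_measurable channel"
    using fg by (auto simp: L2_rel_def square_integrable_def)
  have [measurable]: "f \<in> borel_measurable (torus_measure \<Otimes>\<^sub>M height_measure)"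
      "g \<in> borel_measurable (torus_measure \<Otimes>\<^sub>M height_measure)"
    using m by (auto simp: channel_def)
  have "AE p in torus_measure \<Otimes>\<^sub>M height_measure. f p = g p"
    using fg unfolding L2_rel_def channel_def by blast
  then have "AE x in torus_measure. AE y in height_measure. f (x, y) = g (x, y)"
    by (rule chan.AE_pair)
  then have ae: "AE y in height_measure. AE x in torus_measure. f (x, y) = g (x, y)"
    by (subst (asm) chan.AE_commute) measurable
  note [measurable] = measurable_kint[OF K m(1)] measurable_kint[OF K m(2)]
  show ?thesis
  proof (rule AE_channel_sections[OF ae])
    fix x y assume x: "x \<in> {0..<2 * pi}" and e: "AE x in torus_measure. f (x, y) = g (x, y)"
      and y: "y \<in> space height_measure"
    have [measurable]: "(\<lambda>x'. K x x') \<in> borel_measurable torus_measure"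
      by (rule measurable_kernel_section[OF K x])
    note [measurable] = measurable_section[OF m(1) y] measurable_section[OF m(2) y]
    show "kint K f (x, y) = kint K g (x, y)"
      unfolding kint_def prod.case by (intro integral_cong_AE) (use e in auto)
  qed measurable
qed

lemma kint_add_AE:
  assumes K: "bounded_kernel B K" and f: "square_integrable f" and g: "square_integrable g"
  shows "AE p in channel. kint K (\<lambda>p. f p + g p) p = kint K f p + kint K g p"
proof -
  have m: "f \<in> borel_measurable channel" "g \<in> borel_measurable channel"
      "(\<lambda>p. f p + g p) \<in> borel_measurable channel"
    using f g square_integrable_add[OF f g] by (auto simp: square_integrable_def)
  have i: "AE y in height_measure. integrable torus_measure (\<lambda>x. (cmod (f (x, y)))\<^sup>2)"
    if "square_integrable f" for f
    using that chan.AE_integrable_snd[of "\<lambda>x y. (cmod (f (x, y)))\<^sup>2"]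
    by (simp add: square_integrable_def channel_def case_prod_beta')
  have ae: "AE y in height_measure. integrable torus_measure (\<lambda>x. (cmod (f (x, y)))\<^sup>2)
      \<and> integrable torus_measure (\<lambda>x. (cmod (g (x, y)))\<^sup>2)"
    using i[OF f] i[OF g] by eventually_elim simp
  note [measurable] = measurable_kint[OF K m(1)] measurable_kint[OF K m(2)] measurable_kint[OF K m(3)]
  show ?thesis
  proof (rule AE_channel_sections[OF ae])
    fix x y assume x: "x \<in> {0..<2 * pi}" and y: "y \<in> space height_measure"
      and e: "integrable torus_measure (\<lambda>x. (cmod (f (x, y)))\<^sup>2)
        \<and> integrable torus_measure (\<lambda>x. (cmod (g (x, y)))\<^sup>2)"
    have "integrable torus_measure (\<lambda>x'. complex_of_real (K x x') * f (x', y))"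
      "integrable torus_measure (\<lambda>x'. complex_of_real (K x x') * g (x', y))"
      using kernel_times_section(4)[OF K x measurable_section[OF m(1) y]]
        kernel_times_section(4)[OF K x measurable_section[OF m(2) y]] e by auto
    then show "kint K (\<lambda>p. f p + g p) (x, y) = kint K f (x, y) + kint K g (x, y)"
      by (simp add: kint_def distrib_left)
  qed measurable
qed

lemma kernel_op_to_L2:
  assumes "bounded_kernel B K" "square_integrable f"
  shows "kernel_op K (to_L2 f) = to_L2 (kint K f)"
proof -
  have "L2_rel (rep_L2 (to_L2 f)) f"
    using assms(2) AE_rep_to_L2 square_integrable_rep by (simp add: L2_rel_def)
  from kint_cong_AE[OF assms(1) this] show ?thesis
    unfolding kernel_op_def
    by (intro to_L2_eqI kint_bound(1)[OF assms(1)] square_integrable_rep assms(2))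
qed

lemma norm_kernel_op_le:
  assumes K: "bounded_kernel B K"
  shows "norm (kernel_op K u) \<le> 2 * pi * B * norm u"
proof (rule power2_le_imp_le)
  have "(norm (kernel_op K u))\<^sup>2 \<le> (2 * pi * B)\<^sup>2 * (norm (to_L2 (rep_L2 u)))\<^sup>2"
    unfolding kernel_op_def
    using kint_bound[OF K square_integrable_rep[of u]]
    by (simp add: power2_norm_to_L2 square_integrable_rep)
  then show "(norm (kernel_op K u))\<^sup>2 \<le> (2 * pi * B * norm u)\<^sup>2"
    by (simp add: to_L2_rep power_mult_distrib)
  show "0 \<le> 2 * pi * B * norm u"
    using K by (simp add: bounded_kernel_def)
qed

lemma bounded_linear_kernel_op:
  assumes K: "bounded_kernel B K" shows "bounded_linear (kernel_op K)"
proof (rule bounded_linear_intro)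
  fix u v :: L2 and r :: real
  note s = square_integrable_rep
  note k = kint_bound(1)[OF K s]
  have "u + v = to_L2 (\<lambda>p. rep_L2 u p + rep_L2 v p)"
    using to_L2_add[OF s s, of u v] by (simp add: to_L2_rep)
  then have "kernel_op K (u + v) = to_L2 (kint K (\<lambda>p. rep_L2 u p + rep_L2 v p))"
    by (simp add: kernel_op_to_L2[OF K] square_integrable_add s)
  also have "\<dots> = to_L2 (\<lambda>p. kint K (rep_L2 u) p + kint K (rep_L2 v) p)"
    by (intro to_L2_eqI kint_add_AE[OF K] kint_bound(1)[OF K] square_integrable_add s k)
  also have "\<dots> = kernel_op K u + kernel_op K v"
    by (simp add: kernel_op_def to_L2_add k)
  finally show "kernel_op K (u + v) = kernel_op K u + kernel_op K v" .
  have "r *\<^sub>R u = to_L2 (\<lambda>p. complex_of_real r * rep_L2 u p)"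
    using to_L2_scaleR[OF s, of r u] by (simp add: to_L2_rep)
  then have "kernel_op K (r *\<^sub>R u) = to_L2 (kint K (\<lambda>p. complex_of_real r * rep_L2 u p))"
    by (simp add: kernel_op_to_L2[OF K] square_integrable_cmult s)
  also have "kint K (\<lambda>p. complex_of_real r * rep_L2 u p) = (\<lambda>p. complex_of_real r * kint K (rep_L2 u) p)"
    by (auto simp: kint_def fun_eq_iff mult.left_commute)
  also have "to_L2 \<dots> = r *\<^sub>R kernel_op K u"
    by (simp add: kernel_op_def to_L2_scaleR k)
  finally show "kernel_op K (r *\<^sub>R u) = r *\<^sub>R kernel_op K u" .
  show "norm (kernel_op K u) \<le> norm u * (2 * pi * B)"
    using norm_kernel_op_le[OF K, of u] by (simp add: mult.commute)
qed

lemma bounded_kernel_cell: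
  assumes b: "continuous_on UNIV b" and B: "B > 0" "\<And>s. s \<in> {0..2 * pi} \<Longrightarrow> \<bar>b s\<bar> \<le> B"
  shows "bounded_kernel B (cell_kernel b)"
  unfolding bounded_kernel_def
proof (intro conjI ballI B(1))
  have [measurable]: "b \<in> borel_measurable borel" by (rule borel_measurable_continuous_onI[OF b])
  show "(\<lambda>(x, x'). cell_kernel b x x') \<in> borel_measurable (borel \<Otimes>\<^sub>M borel)"
    unfolding cell_kernel_def by measurable
qed (auto simp: cell_kernel_def intro!: B(2))

text \<open>
  The antiderivative in \<open>x\<close> of mean zero, as an operator on \<open>L2\<close>: formally its \<open>x\<close>-derivative is
  \<^const>\<open>nonzero_modes\<close>.
\<close>

definition anti :: "L2 \<Rightarrow> L2" where
  "anti = kernel_op (cell_kernel saw)"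

lemma bounded_kernel_saw: "bounded_kernel (1 / 2) (cell_kernel saw)"
  by (rule bounded_kernel_cell[OF continuous_saw])
    (auto simp: saw_def abs_if field_simps)

lemma bounded_linear_anti: "bounded_linear anti"
  unfolding anti_def by (rule bounded_linear_kernel_op[OF bounded_kernel_saw])

lemma norm_anti_le: "norm (anti u) \<le> pi * norm u"
  using norm_kernel_op_le[OF bounded_kernel_saw, of u] by (simp add: anti_def)

lemma bounded_linear_nonzero_modes: "bounded_linear nonzero_modes"
proof -
  let ?K = "cell_kernel (\<lambda>_. 1 / (2 * pi))"
  have K: "bounded_kernel (1 / (2 * pi)) ?K"
    by (rule bounded_kernel_cell) (auto intro: continuous_on_const)
  have "nonzero_modes u = u - kernel_op ?K u" for u
  proof -
    have "nonzero_modes (to_L2 (rep_L2 u)) = to_L2 (\<lambda>p. rep_L2 u p - kint ?K (rep_L2 u) p)"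
      by (subst nonzero_modes.abs_eq)
        (simp_all add: L2_rel_refl square_integrable_rep case_prod_beta' kint_def x_mean_def
          cell_kernel_def)
    also have "\<dots> = to_L2 (rep_L2 u) - kernel_op ?K u"
      unfolding kernel_op_def
      by (simp add: to_L2_diff square_integrable_rep kint_bound(1)[OF K])
    finally show ?thesis by (simp add: to_L2_rep)
  qed
  then have eq: "nonzero_modes = (\<lambda>u. u - kernel_op ?K u)" by (rule ext)
  show ?thesis
    unfolding eq by (intro bounded_linear_sub bounded_linear_ident bounded_linear_kernel_op[OF K])
qed

section \<open>Test functions as elements of the Hilbert space\<close>

lemma test_function_sq: "test_function f \<Longrightarrow> square_integrable f"
  by (simp add: test_function_iff smooth_continuous square_integrable_continuous)

lemma test_function_smooth: "test_function f \<Longrightarrow> smooth f"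
  by (simp add: test_function_iff)

lemma inner_test_eq:
  assumes "test_function f" "test_function g"
  shows "to_L2 f \<bullet> to_L2 g = Re (\<integral>p. f p * cnj (g p) \<partial>channel)"
proof -
  have "integrable channel (\<lambda>p. f p * cnj (g p))"
    using assms by (intro integrable_channel_continuous continuous_on_mult continuous_on_cnj
        smooth_continuous test_function_smooth)
  then show ?thesis
    using assms by (simp add: inner_to_L2 test_function_sq inner_complex_def flip: integral_Re)
qed

lemma test_parts:
  assumes f: "test_function f" and g: "test_function g"
  shows "to_L2 (pdx f) \<bullet> to_L2 g = - (to_L2 f \<bullet> to_L2 (pdx g))"
    "to_L2 (pdy f) \<bullet> to_L2 g = - (to_L2 f \<bullet> to_L2 (pdy g))"
proof -
  note sf = test_function_smooth[OF f] and sg = test_function_smooth[OF g]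
  note sc = smooth_cnj[OF sg]
  have t: "test_function (\<lambda>p. f p * cnj (g p))"
    using test_function_mult[OF f] test_function_cnj[OF g] by (simp add: test_function_iff)
  have i: "integrable channel (\<lambda>p. h p * k p)" if "smooth h" "smooth k" for h k
    using that by (intro integrable_channel_continuous continuous_on_mult smooth_continuous)
  have ix: "integrable channel (\<lambda>p. f p * cnj (pdx g p))" "integrable channel (\<lambda>p. pdx f p * cnj (g p))"
    and iy: "integrable channel (\<lambda>p. f p * cnj (pdy g p))" "integrable channel (\<lambda>p. pdy f p * cnj (g p))"
    by (intro i smooth_cnj smooth_pd sf sg)+
  have "(\<integral>p. f p * cnj (pdx g p) \<partial>channel) + (\<integral>p. pdx f p * cnj (g p) \<partial>channel) = 0"
    using channel_integral_pdx[OF t] ix by (simp add: pd_mult[OF sf sc] pd_cnj[OF sg])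
  then show "to_L2 (pdx f) \<bullet> to_L2 g = - (to_L2 f \<bullet> to_L2 (pdx g))"
    by (simp add: inner_test_eq test_function_pd f g add_eq_0_iff)
  have "(\<integral>p. f p * cnj (pdy g p) \<partial>channel) + (\<integral>p. pdy f p * cnj (g p) \<partial>channel) = 0"
    using channel_integral_pdy[OF t] iy by (simp add: pd_mult[OF sf sc] pd_cnj[OF sg])
  then show "to_L2 (pdy f) \<bullet> to_L2 g = - (to_L2 f \<bullet> to_L2 (pdy g))"
    by (simp add: inner_test_eq test_function_pd f g add_eq_0_iff)
qed

lemma test_function_height:
  assumes "test_function f"
  shows "test_function (\<lambda>p. complex_of_real (snd p) * f p)"
  using test_function_mult[OF assms smooth_height] by (simp add: x_periodic_def mult.commute)

lemma pd_height_mult: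
  assumes f: "smooth f"
  shows "pdx (\<lambda>p. complex_of_real (snd p) * f p) = (\<lambda>p. complex_of_real (snd p) * pdx f p)"
    "pdy (\<lambda>p. complex_of_real (snd p) * f p) = (\<lambda>p. complex_of_real (snd p) * pdy f p + f p)"
  by (simp_all add: pd_mult[OF smooth_height f] pd_height)

lemma mult_y_eq: "mult_y u = to_L2 (\<lambda>p. complex_of_real (snd p) * rep_L2 u p)"
  and square_integrable_height_mult:
    "square_integrable f \<Longrightarrow> square_integrable (\<lambda>p. complex_of_real (snd p) * f p)"
  and mult_y_to_L2: "square_integrable f \<Longrightarrow>
    mult_y (to_L2 f) = to_L2 (\<lambda>p. complex_of_real (snd p) * f p)"
proof -
  have e: "(\<lambda>(x, y). complex_of_real y * f (x, y)) = (\<lambda>p. complex_of_real (snd p) * f p)"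
    for f :: "real \<times> real \<Rightarrow> complex"
    by (auto simp: fun_eq_iff)
  show a: "mult_y (to_L2 f) = to_L2 (\<lambda>p. complex_of_real (snd p) * f p)" if "square_integrable f" for f
    using that by (subst mult_y.abs_eq) (simp_all add: L2_rel_refl e)
  show "mult_y u = to_L2 (\<lambda>p. complex_of_real (snd p) * rep_L2 u p)"
    using a[OF square_integrable_rep, of u] by (simp add: to_L2_rep)
  show "square_integrable (\<lambda>p. complex_of_real (snd p) * f p)" if f: "square_integrable f"
    using rel_funD[OF mult_y.rsp, of f f] f by (simp add: L2_rel_refl e)
qed

lemma inner_mult_y: "mult_y u \<bullet> v = u \<bullet> mult_y v"
proof -
  note s = square_integrable_rep square_integrable_height_mult[OF square_integrable_rep]
  have "mult_y u \<bullet> to_L2 (rep_L2 v) = to_L2 (rep_L2 u) \<bullet> mult_y v"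
    by (simp add: mult_y_eq[of u] mult_y_eq[of v] inner_to_L2 s)
      (simp add: inner_complex_def algebra_simps)
  then show ?thesis by (simp add: to_L2_rep)
qed

lemma bounded_linear_mult_y: "bounded_linear mult_y"
proof (rule bounded_linear_intro)
  fix u v :: L2 and r :: real
  note s = square_integrable_rep square_integrable_height_mult[OF square_integrable_rep]
  have u: "u = to_L2 (rep_L2 u)" and v: "v = to_L2 (rep_L2 v)" by (simp_all add: to_L2_rep)
  show "mult_y (u + v) = mult_y u + mult_y v"
    unfolding mult_y_eq[of u] mult_y_eq[of v]
    by (subst u, subst v) (simp add: to_L2_add s mult_y_to_L2 square_integrable_add distrib_left)
  show "mult_y (r *\<^sub>R u) = r *\<^sub>R mult_y u"
    unfolding mult_y_eq[of u]
    by (subst u) (simp add: to_L2_scaleR s mult_y_to_L2 square_integrable_cmult mult.left_commute)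
  show "norm (mult_y u) \<le> norm u * 1"
  proof (rule power2_le_imp_le)
    have "(\<integral>p. (cmod (complex_of_real (snd p) * rep_L2 u p))\<^sup>2 \<partial>channel)
        \<le> (\<integral>p. (cmod (rep_L2 u p))\<^sup>2 \<partial>channel)"
    proof (rule integral_mono)
      fix p assume "p \<in> space channel"
      then have "\<bar>snd p\<bar> \<le> 1" by (auto simp: space_channel)
      then have "\<bar>snd p\<bar> * cmod (rep_L2 u p) \<le> cmod (rep_L2 u p)"
        by (intro mult_left_le_one_le) auto
      then show "(cmod (complex_of_real (snd p) * rep_L2 u p))\<^sup>2 \<le> (cmod (rep_L2 u p))\<^sup>2"
        by (intro power_mono) (auto simp: norm_mult)
    qed (use s in \<open>auto simp: square_integrable_def\<close>)
    then have "(norm (mult_y u))\<^sup>2 \<le> (norm (to_L2 (rep_L2 u)))\<^sup>2"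
      by (simp add: power2_norm_to_L2 s mult_y_eq)
    then show "(norm (mult_y u))\<^sup>2 \<le> (norm u * 1)\<^sup>2" by (simp add: to_L2_rep)
  qed simp
qed

section \<open>The antiderivative on test functions\<close>

lemma test_function_xint: "test_function f \<Longrightarrow> test_function (xint f)"
  by (rule test_function_xconv[OF continuous_saw])

lemma pd_xint: "smooth f \<Longrightarrow> pdx (xint f) = xint (pdx f)" "smooth f \<Longrightarrow> pdy (xint f) = xint (pdy f)"
  by (simp_all add: pd_xconv continuous_saw)

lemma anti_to_L2:
  assumes f: "test_function f" shows "anti (to_L2 f) = to_L2 (xint f)"
proof -
  have "anti (to_L2 f) = to_L2 (kint (cell_kernel saw) f)"
    unfolding anti_def by (rule kernel_op_to_L2[OF bounded_kernel_saw test_function_sq[OF f]])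
  also have "\<dots> = to_L2 (xint f)"
  proof (rule to_L2_eqI)
    show "AE p in channel. kint (cell_kernel saw) f p = xint f p"
      using f by (intro AE_I2) (auto simp: space_channel kint_def test_function_iff
          xconv_on_cell[OF continuous_saw smooth_continuous])
  qed (use f in \<open>auto intro: kint_bound(1)[OF bounded_kernel_saw] test_function_sq test_function_xint\<close>)
  finally show ?thesis .
qed

lemma nonzero_modes_to_L2:
  assumes f: "test_function f" shows "nonzero_modes (to_L2 f) = to_L2 (pdx (xint f))"
proof -
  have "pdx (xint f) = (\<lambda>(x, y). f (x, y) - x_mean f y)"
    using f by (auto simp: fun_eq_iff pd_xint test_function_iff xint_pdx)
  then show ?thesis
    using f by (subst nonzero_modes.abs_eq) (auto simp: L2_rel_refl test_function_sq)
qed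

text \<open>
  Differentiating \<open>xint f\<close> removes the mean of \<open>f\<close>, which \<open>xint\<close> does not see because the sawtooth
  integrates to zero.
\<close>

lemma xint_pdx_xint:
  assumes f: "test_function f" shows "xint (pdx (xint f)) = xint f"
proof -
  have s: "smooth f" "x_periodic f" using f by (auto simp: test_function_iff)
  have c: "continuous_on UNIV f" by (rule smooth_continuous[OF s(1)])
  have int0: "((\<lambda>s. complex_of_real (saw s)) has_integral 0) {0..2 * pi}"
  proof -
    have "(saw has_integral (2 * pi) / 2 - (2 * pi)\<^sup>2 / (4 * pi) - (0 / 2 - 0\<^sup>2 / (4 * pi))) {0..2 * pi}"
    proof (rule fundamental_theorem_of_calculus)
      fix s :: real
      have "((\<lambda>s. s / 2 - s\<^sup>2 / (4 * pi)) has_real_derivative saw s) (at s within {0..2 * pi})"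
        unfolding saw_def by (auto intro!: derivative_eq_intros simp: field_simps)
      then show "((\<lambda>s. s / 2 - s\<^sup>2 / (4 * pi)) has_vector_derivative saw s) (at s within {0..2 * pi})"
        by (simp add: has_real_derivative_iff_has_vector_derivative)
    qed simp
    then have "(saw has_integral 0) {0..2 * pi}" by (simp add: power2_eq_square)
    from has_integral_linear[OF this bounded_linear_of_real] show ?thesis by (simp add: o_def)
  qed
  have "xint (pdx (xint f)) (x, y) = xint f (x, y)" for x y
  proof -
    have "pdx (xint f) (u, y) = f (u, y) - x_mean f y" for u
      using s by (simp add: pd_xint xint_pdx)
    moreover have "((\<lambda>s. complex_of_real (saw s) * f (x - s, y) - complex_of_real (saw s) * x_mean f y)
        has_integral xint f (x, y) - 0 * x_mean f y) {0..2 * pi}"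
      unfolding xconv_def prod.case
      by (intro has_integral_diff has_integral_mult_left int0 integrable_integral
          integrable_continuous_real continuous_on_shifted continuous_saw c)
    ultimately show ?thesis
      by (simp add: xconv_def[of saw "pdx (xint f)"] right_diff_distrib integral_unique)
  qed
  then show ?thesis by (simp add: fun_eq_iff)
qed

text \<open>
  The antiderivative of a test function has mean zero in \<open>x\<close>, so it is orthogonal to every
  function of \<open>y\<close>.
\<close>

lemma xint_orthogonal_mean:
  assumes f: "test_function f" and g: "continuous_on UNIV (\<lambda>p::real \<times> real. c (snd p))"
  shows "to_L2 (xint f) \<bullet> to_L2 (\<lambda>p. c (snd p)) = 0"
proof -
  let ?F = "xint f"
  note t = test_function_xint[OF f]
  have s: "smooth ?F" "x_periodic ?F" and cF: "continuous_on UNIV ?F"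
    using t by (auto simp: test_function_iff smooth_continuous)
  have mean: "x_mean ?F y = 0" for y
    using xint_pdx[OF s, of 0 y] by (simp add: xint_pdx_xint[OF f])
  obtain B where B: "\<And>x y. x \<in> {0..2 * pi} \<Longrightarrow> y \<in> {-1..1} \<Longrightarrow> cmod (?F (x, y)) \<le> B"
    using bounded_on_channel[OF cF] by blast
  have inner: "(\<integral>x. ?F (x, y) \<bullet> c y \<partial>torus_measure) = 0" if y: "y \<in> space height_measure" for y
  proof -
    have "y \<in> {-1..1}" using y by (auto simp: height_measure_def space_restrict_space)
    then have "integrable torus_measure (\<lambda>x. ?F (x, y))"
      by (intro torus_integral[where B = B] borel_measurable_continuous_onI continuous_on_section cF B)
    then have "(\<integral>x. ?F (x, y) \<bullet> c y \<partial>torus_measure) = (\<integral>x. ?F (x, y) \<partial>torus_measure) \<bullet> c y"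
      by (rule integral_inner_left)
    also have "(\<integral>x. ?F (x, y) \<partial>torus_measure) = 0"
      using mean[of y] by (simp add: x_mean_def)
    finally show ?thesis by simp
  qed
  note sg = square_integrable_continuous[OF g] and sF = square_integrable_continuous[OF cF]
  have i: "integrable (torus_measure \<Otimes>\<^sub>M height_measure) (\<lambda>(x, y). ?F (x, y) \<bullet> c y)"
    using integrable_inner_channel[OF sF sg] by (simp add: channel_def case_prod_beta')
  have "to_L2 ?F \<bullet> to_L2 (\<lambda>p. c (snd p))
      = (\<integral>p. (case p of (x, y) \<Rightarrow> ?F (x, y) \<bullet> c y) \<partial>(torus_measure \<Otimes>\<^sub>M height_measure))"
    using inner_to_L2[OF sF sg] by (simp add: channel_def case_prod_beta')
  also have "\<dots> = (\<integral>y. (\<integral>x. ?F (x, y) \<bullet> c y \<partial>torus_measure) \<partial>height_measure)"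
    by (rule chan.integral_snd[OF i, symmetric])
  also have "\<dots> = 0" by (simp add: inner cong: Bochner_Integration.integral_cong)
  finally show ?thesis .
qed

lemma to_L2_split_mean:
  assumes f: "test_function f"
  shows "to_L2 f = to_L2 (pdx (xint f)) + to_L2 (\<lambda>p. x_mean f (snd p))"
    and "continuous_on UNIV (\<lambda>p::real \<times> real. x_mean f (snd p))"
proof -
  have s: "smooth f" "x_periodic f" using f by (auto simp: test_function_iff)
  have e: "(\<lambda>p::real \<times> real. x_mean f (snd p)) = (\<lambda>p. f p - pdx (xint f) p)"
    using s by (auto simp: fun_eq_iff pd_xint xint_pdx)
  show c: "continuous_on UNIV (\<lambda>p::real \<times> real. x_mean f (snd p))"
    unfolding e by (intro continuous_on_diff smooth_continuous test_function_smooth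
        test_function_pd test_function_xint f)
  have "pdx (xint f) p + x_mean f (snd p) = f p" for p
    using fun_cong[OF e, of p] by simp
  then show "to_L2 f = to_L2 (pdx (xint f)) + to_L2 (\<lambda>p. x_mean f (snd p))"
    using to_L2_add[OF test_function_sq[OF test_function_pd(1)[OF test_function_xint[OF f]]]
        square_integrable_continuous[OF c]] by simp
qed

text \<open>
  Both functions are split into the derivative of their antiderivative and their mean. The
  derivatives are moved by parts, and the means drop out by orthogonality.
\<close>

lemma anti_skew_test:
  assumes f: "test_function f" and g: "test_function g"
  shows "to_L2 (xint f) \<bullet> to_L2 g = - (to_L2 f \<bullet> to_L2 (xint g))"
proof -
  have "to_L2 (xint f) \<bullet> to_L2 g = to_L2 (xint f) \<bullet> to_L2 (pdx (xint g))"
    by (subst to_L2_split_mean(1)[OF g])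
      (simp add: inner_add_right xint_orthogonal_mean[OF f to_L2_split_mean(2)[OF g]])
  also have "\<dots> = - (to_L2 (pdx (xint f)) \<bullet> to_L2 (xint g))"
    using test_parts(1)[OF test_function_xint[OF f] test_function_xint[OF g]] by simp
  also have "to_L2 (pdx (xint f)) \<bullet> to_L2 (xint g) = to_L2 f \<bullet> to_L2 (xint g)"
    by (subst to_L2_split_mean(1)[OF f])
      (simp add: inner_add_left inner_commute[of "to_L2 (\<lambda>p. x_mean f (snd p))"]
        xint_orthogonal_mean[OF g to_L2_split_mean(2)[OF f]])
  finally show ?thesis .
qed

section \<open>Weak derivatives against test functions\<close>

lemma smooth_pd_powers:
  assumes "smooth f"
  shows "smooth ((pdx ^^ i) f)" "smooth ((pdy ^^ j) f)"
  using assms by (induction i; simp add: smooth_pd) (induction j; simp add: assms smooth_pd)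

lemma pd_powers_cnj:
  assumes "smooth f"
  shows "(pdx ^^ i) ((pdy ^^ j) (\<lambda>p. cnj (f p))) = (\<lambda>p. cnj ((pdx ^^ i) ((pdy ^^ j) f) p))"
proof -
  have y: "(pdy ^^ j) (\<lambda>p. cnj (f p)) = (\<lambda>p. cnj ((pdy ^^ j) f p))"
    by (induction j) (simp_all add: pd_cnj smooth_pd_powers assms)
  have "(pdx ^^ i) (\<lambda>p. cnj (g p)) = (\<lambda>p. cnj ((pdx ^^ i) g p))" if "smooth g" for g
    by (induction i) (simp_all add: pd_cnj smooth_pd_powers that)
  then show ?thesis by (simp add: y smooth_pd_powers assms)
qed

lemma test_function_pd_powers:
  assumes "test_function f" shows "test_function ((pdx ^^ i) ((pdy ^^ j) f))"
proof -
  have "test_function ((pdy ^^ j) f)" by (induction j) (simp_all add: assms test_function_pd)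
  then show ?thesis by (induction i) (simp_all add: test_function_pd)
qed

text \<open>
  Weak derivatives are defined by a bilinear pairing, whereas the inner product is the real part of
  the Hermitian one; conjugating the test function passes from one to the other.
\<close>

lemma weak_deriv_inner:
  assumes w: "weak_deriv i j u v" and f: "test_function f"
  shows "u \<bullet> to_L2 ((pdx ^^ i) ((pdy ^^ j) f)) = (- 1) ^ (i + j) * (v \<bullet> to_L2 f)"
proof -
  have re: "u \<bullet> to_L2 g = Re (\<integral>p. rep_L2 u p * cnj (g p) \<partial>channel)" if g: "test_function g" for u g
  proof -
    have gs: "square_integrable g" by (rule test_function_sq[OF g])
    have i: "integrable channel (\<lambda>p. rep_L2 u p \<bullet> h p)" if "square_integrable h" for h
      by (intro integrable_inner_channel square_integrable_rep that)
    have "integrable channel (\<lambda>p. rep_L2 u p * cnj (g p))"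
    proof -
      have "rep_L2 u p * cnj (g p) = complex_of_real (rep_L2 u p \<bullet> g p)
          + \<i> * complex_of_real (rep_L2 u p \<bullet> (\<i> * g p))" for p
        by (simp add: complex_eq_iff inner_complex_def)
      then show ?thesis
        using i[OF gs] i[OF square_integrable_cmult[OF gs, of \<i>]] by simp
    qed
    then show ?thesis
      by (simp add: inner_to_L2_right gs inner_complex_def flip: integral_Re)
  qed
  have "(\<integral>p. rep_L2 u p * cnj ((pdx ^^ i) ((pdy ^^ j) f) p) \<partial>channel)
      = (- 1) ^ (i + j) * (\<integral>p. rep_L2 v p * cnj (f p) \<partial>channel)"
    using w[unfolded weak_deriv_def, rule_format, OF test_function_cnj[OF f]]
    by (simp add: pd_powers_cnj test_function_smooth f)
  then have "Re (\<integral>p. rep_L2 u p * cnj ((pdx ^^ i) ((pdy ^^ j) f) p) \<partial>channel)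
      = Re (complex_of_real ((- 1) ^ (i + j)) * (\<integral>p. rep_L2 v p * cnj (f p) \<partial>channel))"
    by simp
  then show ?thesis
    using f by (simp add: re test_function_pd_powers del: of_real_power)
qed

section \<open>Consequences of the density of test functions\<close>

text \<open>
  Identities for \<open>L2\<close> functions are checked on test functions. Their density is carried along as an
  assumption because the existence of the semigroup provides it, see
  \<open>test_dense_if_ionic_semigroup\<close>.
\<close>

definition test_dense :: bool where
  "test_dense \<longleftrightarrow> (\<forall>u. \<exists>\<phi>. (\<forall>n::nat. test_function (\<phi> n)) \<and> (\<lambda>n. to_L2 (\<phi> n)) \<longlonglongrightarrow> u)"

lemma test_denseE:
  assumes "test_dense"
  obtains \<phi> :: "nat \<Rightarrow> _" where "\<And>n. test_function (\<phi> n)" "(\<lambda>n. to_L2 (\<phi> n)) \<longlonglongrightarrow> u"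
  using assms unfolding test_dense_def by blast

lemma inner_limit_eq:
  fixes f g :: "'a::real_inner"
  assumes "F \<longlonglongrightarrow> f" "G \<longlonglongrightarrow> g" "c \<longlonglongrightarrow> a" "\<And>n. F n \<bullet> G n = c n"
  shows "f \<bullet> g = a"
  using LIMSEQ_unique[OF tendsto_inner[OF assms(1,2)]] assms(3,4) by simp

lemma dense_eqI:
  assumes d: "test_dense" and e: "\<And>\<psi>. test_function \<psi> \<Longrightarrow> u \<bullet> to_L2 \<psi> = v \<bullet> to_L2 \<psi>"
  shows "u = v"
proof -
  obtain \<phi> where \<phi>: "\<And>n. test_function (\<phi> n)" "(\<lambda>n. to_L2 (\<phi> n)) \<longlonglongrightarrow> u - v"
    using test_denseE[OF d] by blast
  have "(u - v) \<bullet> (u - v) = 0"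
    by (rule inner_limit_eq[OF tendsto_const \<phi>(2) tendsto_const])
      (use e \<phi>(1) in \<open>auto simp: inner_diff_left\<close>)
  then show ?thesis by simp
qed

lemma dense_operator_eqI:
  fixes F G :: "L2 \<Rightarrow> L2"
  assumes d: "test_dense" and "bounded_linear F" "bounded_linear G"
    and e: "\<And>\<psi>. test_function \<psi> \<Longrightarrow> F (to_L2 \<psi>) = G (to_L2 \<psi>)"
  shows "F u = G u"
proof -
  obtain \<phi> where \<phi>: "\<And>n. test_function (\<phi> n)" "(\<lambda>n. to_L2 (\<phi> n)) \<longlonglongrightarrow> u"
    using test_denseE[OF d] by blast
  have "(\<lambda>n. F (to_L2 (\<phi> n))) \<longlonglongrightarrow> F u" "(\<lambda>n. G (to_L2 (\<phi> n))) \<longlonglongrightarrow> G u"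
    by (rule bounded_linear.tendsto[OF _ \<phi>(2)], fact)+
  then show ?thesis using e \<phi>(1) LIMSEQ_unique by simp
qed

lemma anti_skew:
  assumes d: "test_dense" shows "anti u \<bullet> v = - (u \<bullet> anti v)"
proof -
  note lim = bounded_linear.tendsto[OF bounded_linear_anti]
  have 1: "anti u \<bullet> to_L2 \<psi> = - (u \<bullet> to_L2 (xint \<psi>))" if \<psi>: "test_function \<psi>" for \<psi>
  proof -
    obtain \<phi> where \<phi>: "\<And>n. test_function (\<phi> n)" "(\<lambda>n. to_L2 (\<phi> n)) \<longlonglongrightarrow> u"
      using test_denseE[OF d] by blast
    show ?thesis
      by (rule inner_limit_eq[OF lim[OF \<phi>(2)] tendsto_const
            tendsto_minus[OF tendsto_inner[OF \<phi>(2) tendsto_const]]])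
        (simp add: anti_to_L2 \<phi>(1) anti_skew_test \<psi>)
  qed
  obtain \<phi> where \<phi>: "\<And>n. test_function (\<phi> n)" "(\<lambda>n. to_L2 (\<phi> n)) \<longlonglongrightarrow> v"
    using test_denseE[OF d] by blast
  show ?thesis
    by (rule inner_limit_eq[OF tendsto_const \<phi>(2)
          tendsto_minus[OF tendsto_inner[OF tendsto_const lim[OF \<phi>(2)]]]])
      (simp add: 1 \<phi>(1) anti_to_L2)
qed

text \<open>
  The Poincare inequality in \<open>x\<close>: functions of \<open>y\<close> alone have antiderivative zero.
\<close>

lemma norm_anti_le_nonzero_modes:
  assumes d: "test_dense" shows "norm (anti u) \<le> pi * norm (nonzero_modes u)"
proof -
  have "anti u = anti (nonzero_modes u)"
    by (rule dense_operator_eqI[OF d bounded_linear_anti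
          bounded_linear_compose[OF bounded_linear_anti bounded_linear_nonzero_modes]])
      (simp add: nonzero_modes_to_L2 anti_to_L2 test_function_pd test_function_xint xint_pdx_xint)
  then show ?thesis using norm_anti_le[of "nonzero_modes u"] by simp
qed

lemma anti_mult_y:
  assumes d: "test_dense" shows "anti (mult_y u) = mult_y (anti u)"
proof (rule dense_operator_eqI[OF d bounded_linear_compose[OF bounded_linear_anti bounded_linear_mult_y]
      bounded_linear_compose[OF bounded_linear_mult_y bounded_linear_anti]])
  show "anti (mult_y (to_L2 f)) = mult_y (anti (to_L2 f))" if f: "test_function f" for f
  proof -
    have "xint (\<lambda>p. complex_of_real (snd p) * f p) = (\<lambda>p. complex_of_real (snd p) * xint f p)"
      by (simp add: fun_eq_iff xconv_def mult.left_commute[of "complex_of_real (saw _)"])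
    then show ?thesis
      using f by (simp add: mult_y_to_L2 anti_to_L2 test_function_sq test_function_height test_function_xint)
  qed
qed

section \<open>Regular functions of the channel\<close>

text \<open>
  A function \<open>w\<close> together with its derivatives. The Dirichlet condition is encoded by approximation
  with test functions, and it is imposed on \<open>w\<close> and on \<open>w\<^sub>x\<close> at once since the derivatives of the
  approximants converge in the same strong sense; only \<open>w\<^sub>y\<^sub>y\<close> is a weak derivative. Antiderivatives of
  functions in the domain of the generator have this regularity, see \<open>regular_anti\<close>; with it, all
  integrations by parts of the energy method are limits of integrations by parts of test functions.
\<close>

definition regular :: "L2 \<Rightarrow> L2 \<Rightarrow> L2 \<Rightarrow> L2 \<Rightarrow> L2 \<Rightarrow> L2 \<Rightarrow> bool" where
  "regular w wx wy wxx wxy wyy \<longleftrightarrow>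
     (\<exists>\<phi>. (\<forall>n::nat. test_function (\<phi> n))
       \<and> (\<lambda>n. to_L2 (\<phi> n)) \<longlonglongrightarrow> w
       \<and> (\<lambda>n. to_L2 (pdx (\<phi> n))) \<longlonglongrightarrow> wx
       \<and> (\<lambda>n. to_L2 (pdy (\<phi> n))) \<longlonglongrightarrow> wy
       \<and> (\<lambda>n. to_L2 (pdx (pdx (\<phi> n)))) \<longlonglongrightarrow> wxx
       \<and> (\<lambda>n. to_L2 (pdx (pdy (\<phi> n)))) \<longlonglongrightarrow> wxy)
     \<and> (\<forall>\<psi>. test_function \<psi> \<longrightarrow> to_L2 \<psi> \<bullet> wyy = - (to_L2 (pdy \<psi>) \<bullet> wy))"

lemma regularE:
  assumes "regular w wx wy wxx wxy wyy"
  obtains \<phi> :: "nat \<Rightarrow> _" where "\<And>n. test_function (\<phi> n)"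
    "(\<lambda>n. to_L2 (\<phi> n)) \<longlonglongrightarrow> w" "(\<lambda>n. to_L2 (pdx (\<phi> n))) \<longlonglongrightarrow> wx"
    "(\<lambda>n. to_L2 (pdy (\<phi> n))) \<longlonglongrightarrow> wy" "(\<lambda>n. to_L2 (pdx (pdx (\<phi> n)))) \<longlonglongrightarrow> wxx"
    "(\<lambda>n. to_L2 (pdx (pdy (\<phi> n)))) \<longlonglongrightarrow> wxy"
    "\<And>\<psi>. test_function \<psi> \<Longrightarrow> to_L2 \<psi> \<bullet> wyy = - (to_L2 (pdy \<psi>) \<bullet> wy)"
proof -
  from assms[unfolded regular_def] show thesis
    by (elim conjE exE) (rule that; simp)
qed

text \<open>
  Integration by parts with the Couette weight. Only the \<open>y\<close>-derivative sees the weight, and the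
  term it leaves behind is the source of all decay.
\<close>

lemma test_height_parts:
  assumes "test_function f" "test_function g"
  shows "to_L2 (\<lambda>p. complex_of_real (snd p) * f p) = mult_y (to_L2 f)"
    "mult_y (to_L2 (pdx f)) \<bullet> to_L2 g = - (mult_y (to_L2 f) \<bullet> to_L2 (pdx g))"
    "mult_y (to_L2 (pdy f)) \<bullet> to_L2 g = - (to_L2 f \<bullet> to_L2 g) - mult_y (to_L2 f) \<bullet> to_L2 (pdy g)"
    "to_L2 (pdy (\<lambda>p. complex_of_real (snd p) * f p)) = mult_y (to_L2 (pdy f)) + to_L2 f"
proof -
  note t = test_function_height[OF assms(1)] and s = test_function_smooth[OF assms(1)]
  note q = test_function_sq[OF assms(1)] test_function_sq[OF test_function_pd(1)[OF assms(1)]]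
    test_function_sq[OF test_function_pd(2)[OF assms(1)]]
  show 1: "to_L2 (\<lambda>p. complex_of_real (snd p) * f p) = mult_y (to_L2 f)"
    by (simp add: mult_y_to_L2 q)
  show 2: "to_L2 (pdy (\<lambda>p. complex_of_real (snd p) * f p)) = mult_y (to_L2 (pdy f)) + to_L2 f"
    by (simp add: pd_height_mult s mult_y_to_L2 q square_integrable_height_mult to_L2_add)
  show "mult_y (to_L2 (pdx f)) \<bullet> to_L2 g = - (mult_y (to_L2 f) \<bullet> to_L2 (pdx g))"
    using test_parts(1)[OF t assms(2)] by (simp add: pd_height_mult s mult_y_to_L2 q)
  show "mult_y (to_L2 (pdy f)) \<bullet> to_L2 g = - (to_L2 f \<bullet> to_L2 g) - mult_y (to_L2 f) \<bullet> to_L2 (pdy g)"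
    using test_parts(2)[OF t assms(2)] unfolding 2 1 by (simp add: inner_add_left)
qed

lemmas mult_y_tendsto = bounded_linear.tendsto[OF bounded_linear_mult_y]

lemma regular_inner:
  assumes v: "regular v vx vy vxx vxy vyy" and w: "regular w wx wy wxx wxy wyy"
  shows "v \<bullet> wxx = - (vx \<bullet> wx)" "v \<bullet> wxy = - (vx \<bullet> wy)" "v \<bullet> wxy = - (vy \<bullet> wx)"
    "v \<bullet> wyy = - (vy \<bullet> wy)"
proof -
  obtain \<phi> where t: "\<And>n. test_function (\<phi> n)"
    and l: "(\<lambda>n. to_L2 (\<phi> n)) \<longlonglongrightarrow> v" "(\<lambda>n. to_L2 (pdx (\<phi> n))) \<longlonglongrightarrow> vx"
      "(\<lambda>n. to_L2 (pdy (\<phi> n))) \<longlonglongrightarrow> vy" "(\<lambda>n. to_L2 (pdx (pdx (\<phi> n)))) \<longlonglongrightarrow> vxx"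
      "(\<lambda>n. to_L2 (pdx (pdy (\<phi> n)))) \<longlonglongrightarrow> vxy"
    and yy: "\<And>\<psi>. test_function \<psi> \<Longrightarrow> to_L2 \<psi> \<bullet> vyy = - (to_L2 (pdy \<psi>) \<bullet> vy)"
    by (rule regularE[OF v]) (rule that)
  obtain \<eta> where t': "\<And>n. test_function (\<eta> n)"
    and l': "(\<lambda>n. to_L2 (\<eta> n)) \<longlonglongrightarrow> w" "(\<lambda>n. to_L2 (pdx (\<eta> n))) \<longlonglongrightarrow> wx"
      "(\<lambda>n. to_L2 (pdy (\<eta> n))) \<longlonglongrightarrow> wy" "(\<lambda>n. to_L2 (pdx (pdx (\<eta> n)))) \<longlonglongrightarrow> wxx"
      "(\<lambda>n. to_L2 (pdx (pdy (\<eta> n)))) \<longlonglongrightarrow> wxy"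
    and yy': "\<And>\<psi>. test_function \<psi> \<Longrightarrow> to_L2 \<psi> \<bullet> wyy = - (to_L2 (pdy \<psi>) \<bullet> wy)"
    by (rule regularE[OF w]) (rule that)
  note tp = test_function_pd[OF t] and tp' = test_function_pd[OF t']
  show "v \<bullet> wxx = - (vx \<bullet> wx)"
    by (rule inner_limit_eq[OF l(1) l'(4) tendsto_minus[OF tendsto_inner[OF l(2) l'(2)]]])
      (simp add: test_parts t tp')
  show "v \<bullet> wxy = - (vx \<bullet> wy)"
    by (rule inner_limit_eq[OF l(1) l'(5) tendsto_minus[OF tendsto_inner[OF l(2) l'(3)]]])
      (simp add: test_parts t tp')
  show "v \<bullet> wxy = - (vy \<bullet> wx)"
    by (rule inner_limit_eq[OF l(1) l'(5) tendsto_minus[OF tendsto_inner[OF l(3) l'(2)]]])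
      (simp add: test_parts t tp' test_function_smooth[OF t'] flip: pdy_pdx_commute)
  show "v \<bullet> wyy = - (vy \<bullet> wy)"
    by (rule inner_limit_eq[OF l(1) tendsto_const tendsto_minus[OF tendsto_inner[OF l(3) tendsto_const]]])
      (simp add: yy' t)
qed

lemma self_inner_test:
  assumes "test_function g"
  shows "to_L2 (pdx g) \<bullet> to_L2 g = 0" "to_L2 (pdy g) \<bullet> to_L2 g = 0"
    "mult_y (to_L2 (pdx g)) \<bullet> to_L2 g = 0" "mult_y (to_L2 (pdy g)) \<bullet> to_L2 g = - (to_L2 g \<bullet> to_L2 g) / 2"
  using test_parts[OF assms assms] test_height_parts[OF assms assms]
  by (simp_all add: inner_commute inner_mult_y)

text \<open>
  The transport terms \<open>w\<^sub>x\<close> and \<open>y w\<^sub>x\<close> are orthogonal to almost everything: what survives are the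
  commutator of \<open>y \<partial>\<^sub>x\<close> with \<open>\<partial>\<^sub>y\<close>, in two places, and the identity between \<open>w\<^sub>x\<^sub>x w\<^sub>y\<^sub>y\<close> and
  \<open>w\<^sub>x\<^sub>y\<^sup>2\<close>. The wall contributes nothing, because \<open>w\<^sub>x\<close> vanishes there as well.
\<close>

lemma regular_transport:
  assumes w: "regular w wx wy wxx wxy wyy"
  shows "wx \<bullet> w = 0" "wx \<bullet> wxx = 0" "wx \<bullet> wxy = 0" "wx \<bullet> wyy = 0"
    "mult_y wx \<bullet> w = 0" "mult_y wx \<bullet> wxx = 0" "mult_y wx \<bullet> wxy = - (wx \<bullet> wx) / 2"
    "mult_y wx \<bullet> wyy = - (wx \<bullet> wy)" "wxx \<bullet> wyy = wxy \<bullet> wxy"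
proof -
  obtain \<phi> where t: "\<And>n. test_function (\<phi> n)"
    and l: "(\<lambda>n. to_L2 (\<phi> n)) \<longlonglongrightarrow> w" "(\<lambda>n. to_L2 (pdx (\<phi> n))) \<longlonglongrightarrow> wx"
      "(\<lambda>n. to_L2 (pdy (\<phi> n))) \<longlonglongrightarrow> wy" "(\<lambda>n. to_L2 (pdx (pdx (\<phi> n)))) \<longlonglongrightarrow> wxx"
      "(\<lambda>n. to_L2 (pdx (pdy (\<phi> n)))) \<longlonglongrightarrow> wxy"
    and yy: "\<And>\<psi>. test_function \<psi> \<Longrightarrow> to_L2 \<psi> \<bullet> wyy = - (to_L2 (pdy \<psi>) \<bullet> wy)"
    by (rule regularE[OF w]) (rule that)
  note tx = test_function_pd(1)[OF t] and ty = test_function_pd(2)[OF t]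
  note comm = pdy_pdx_commute[OF test_function_smooth[OF t]]
    pdy_pdx_commute[OF test_function_smooth[OF tx]]
  show "wx \<bullet> w = 0"
    by (rule inner_limit_eq[OF l(2) l(1) tendsto_const]) (simp add: self_inner_test t)
  show "wx \<bullet> wxx = 0"
    by (rule inner_limit_eq[OF l(2) l(4) tendsto_const])
      (simp add: self_inner_test tx inner_commute[of "to_L2 (pdx (\<phi> _))"])
  show "wx \<bullet> wxy = 0"
    by (rule inner_limit_eq[OF l(2) l(5) tendsto_const])
      (simp add: self_inner_test tx inner_commute[of "to_L2 (pdx (\<phi> _))"] flip: comm)
  show "mult_y wx \<bullet> w = 0"
    by (rule inner_limit_eq[OF mult_y_tendsto[OF l(2)] l(1) tendsto_const]) (simp add: self_inner_test t)
  have c: "mult_y u \<bullet> v = mult_y v \<bullet> u" for u v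
    using inner_mult_y[of u v] by (simp add: inner_commute)
  show "mult_y wx \<bullet> wxx = 0"
    unfolding c[of wx]
    by (rule inner_limit_eq[OF mult_y_tendsto[OF l(4)] l(2) tendsto_const]) (simp add: self_inner_test tx)
  show "mult_y wx \<bullet> wxy = - (wx \<bullet> wx) / 2"
    unfolding c[of wx]
    by (rule inner_limit_eq[OF mult_y_tendsto[OF l(5)] l(2)
          tendsto_divide[OF tendsto_minus[OF tendsto_inner[OF l(2) l(2)]] tendsto_const]])
      (simp_all add: self_inner_test tx flip: comm)
  have wxy_wy: "wxy \<bullet> wy = 0"
    by (rule inner_limit_eq[OF l(5) l(3) tendsto_const]) (simp add: self_inner_test ty)
  have ywxy_wy: "mult_y wxy \<bullet> wy = 0"
    by (rule inner_limit_eq[OF mult_y_tendsto[OF l(5)] l(3) tendsto_const]) (simp add: self_inner_test ty)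
  have "wx \<bullet> wyy = - (wxy \<bullet> wy)"
    by (rule inner_limit_eq[OF l(2) tendsto_const tendsto_minus[OF tendsto_inner[OF l(5) tendsto_const]]])
      (simp add: yy tx comm)
  then show "wx \<bullet> wyy = 0" using wxy_wy by simp
  have "mult_y wx \<bullet> wyy = - ((mult_y wxy + wx) \<bullet> wy)"
  proof (rule inner_limit_eq[OF mult_y_tendsto[OF l(2)] tendsto_const
        tendsto_minus[OF tendsto_inner[OF tendsto_add[OF mult_y_tendsto[OF l(5)] l(2)] tendsto_const]]])
    fix n
    show "mult_y (to_L2 (pdx (\<phi> n))) \<bullet> wyy
        = - ((mult_y (to_L2 (pdx (pdy (\<phi> n)))) + to_L2 (pdx (\<phi> n))) \<bullet> wy)"
      using yy[OF test_function_height[OF tx[of n]]] test_height_parts(1,4)[OF tx tx, of n]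
      by (simp add: comm)
  qed
  then show "mult_y wx \<bullet> wyy = - (wx \<bullet> wy)" using ywxy_wy by (simp add: inner_add_left)
  have wy: "to_L2 (pdx g) \<bullet> wy = - (to_L2 g \<bullet> wxy)" if g: "test_function g" for g
    by (rule inner_limit_eq[OF tendsto_const l(3) tendsto_minus[OF tendsto_inner[OF tendsto_const l(5)]]])
      (simp add: test_parts g ty)
  show "wxx \<bullet> wyy = wxy \<bullet> wxy"
    by (rule inner_limit_eq[OF l(4) tendsto_const tendsto_inner[OF l(5) tendsto_const]])
      (simp add: yy tx test_function_pd comm wy ty)
qed

lemma regular_diff:
  assumes v: "regular v vx vy vxx vxy vyy" and w: "regular w wx wy wxx wxy wyy"
  shows "regular (v - w) (vx - wx) (vy - wy) (vxx - wxx) (vxy - wxy) (vyy - wyy)"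
proof -
  obtain \<phi> where t: "\<And>n. test_function (\<phi> n)"
    and l: "(\<lambda>n. to_L2 (\<phi> n)) \<longlonglongrightarrow> v" "(\<lambda>n. to_L2 (pdx (\<phi> n))) \<longlonglongrightarrow> vx"
      "(\<lambda>n. to_L2 (pdy (\<phi> n))) \<longlonglongrightarrow> vy" "(\<lambda>n. to_L2 (pdx (pdx (\<phi> n)))) \<longlonglongrightarrow> vxx"
      "(\<lambda>n. to_L2 (pdx (pdy (\<phi> n)))) \<longlonglongrightarrow> vxy"
    and yy: "\<And>\<psi>. test_function \<psi> \<Longrightarrow> to_L2 \<psi> \<bullet> vyy = - (to_L2 (pdy \<psi>) \<bullet> vy)"
    by (rule regularE[OF v]) (rule that)
  obtain \<eta> where t': "\<And>n. test_function (\<eta> n)"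
    and l': "(\<lambda>n. to_L2 (\<eta> n)) \<longlonglongrightarrow> w" "(\<lambda>n. to_L2 (pdx (\<eta> n))) \<longlonglongrightarrow> wx"
      "(\<lambda>n. to_L2 (pdy (\<eta> n))) \<longlonglongrightarrow> wy" "(\<lambda>n. to_L2 (pdx (pdx (\<eta> n)))) \<longlonglongrightarrow> wxx"
      "(\<lambda>n. to_L2 (pdx (pdy (\<eta> n)))) \<longlonglongrightarrow> wxy"
    and yy': "\<And>\<psi>. test_function \<psi> \<Longrightarrow> to_L2 \<psi> \<bullet> wyy = - (to_L2 (pdy \<psi>) \<bullet> wy)"
    by (rule regularE[OF w]) (rule that)
  \<comment> \<open>the factor \<open>- 1\<close> makes the closure under sums and products apply\<close>
  define D where "D n = (\<lambda>p. \<phi> n p + (- 1) * \<eta> n p)" for n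
  have D: "test_function (\<lambda>p. f p + (- 1) * g p)"
      "pdx (\<lambda>p. f p + (- 1) * g p) = (\<lambda>p. pdx f p + (- 1) * pdx g p)"
      "pdy (\<lambda>p. f p + (- 1) * g p) = (\<lambda>p. pdy f p + (- 1) * pdy g p)"
      "to_L2 (\<lambda>p. f p + (- 1) * g p) = to_L2 f - to_L2 g"
    if f: "test_function f" and g: "test_function g" for f g
  proof -
    note s = test_function_smooth[OF f] test_function_smooth[OF g]
    have d: "((\<lambda>u. f (u, y) + (- 1) * g (u, y)) has_vector_derivative pdx f (x, y) + (- 1) * pdx g (x, y)) (at x)"
      "((\<lambda>u. f (x, u) + (- 1) * g (x, u)) has_vector_derivative pdy f (x, y) + (- 1) * pdy g (x, y)) (at y)"
      for x y
      by (intro has_vector_derivative_add has_vector_derivative_mult_right smooth_has_pdx smooth_has_pdy s)+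
    show "pdx (\<lambda>p. f p + (- 1) * g p) = (\<lambda>p. pdx f p + (- 1) * pdx g p)"
      "pdy (\<lambda>p. f p + (- 1) * g p) = (\<lambda>p. pdy f p + (- 1) * pdy g p)"
      using d by (auto intro!: pdx_eqI pdy_eqI)
    show "to_L2 (\<lambda>p. f p + (- 1) * g p) = to_L2 f - to_L2 g"
      using f g by (simp add: to_L2_diff test_function_sq)
    obtain r where r: "r < 1" "\<And>x y. \<bar>y\<bar> > r \<Longrightarrow> f (x, y) = 0"
      using f by (auto simp: test_function_iff vanishes_near_walls_def)
    obtain r' where r': "r' < 1" "\<And>x y. \<bar>y\<bar> > r' \<Longrightarrow> g (x, y) = 0"
      using g by (auto simp: test_function_iff vanishes_near_walls_def)
    have "vanishes_near_walls (\<lambda>p. f p + (- 1) * g p)"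
      unfolding vanishes_near_walls_def by (intro exI[of _ "max r r'"]) (simp add: r r')
    moreover have "smooth (\<lambda>p. f p + (- 1) * g p)" by (intro smooth_add smooth_mult smooth_const s)
    moreover have "x_periodic (\<lambda>p. f p + (- 1) * g p)"
      using f g by (simp add: test_function_iff x_periodic_def)
    ultimately show "test_function (\<lambda>p. f p + (- 1) * g p)" by (simp only: test_function_iff)
  qed
  show ?thesis
    unfolding regular_def
  proof (intro conjI exI[of _ D] allI impI)
    show "test_function (D n)" for n unfolding D_def by (intro D t t')
    show "(\<lambda>n. to_L2 (D n)) \<longlonglongrightarrow> v - w"
      unfolding D_def D(4)[OF t t'] by (intro tendsto_diff l l')
    show "(\<lambda>n. to_L2 (pdx (D n))) \<longlonglongrightarrow> vx - wx"
      unfolding D_def D(2)[OF t t'] D(4)[OF test_function_pd(1)[OF t] test_function_pd(1)[OF t']]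
      by (intro tendsto_diff l l')
    show "(\<lambda>n. to_L2 (pdy (D n))) \<longlonglongrightarrow> vy - wy"
      unfolding D_def D(3)[OF t t'] D(4)[OF test_function_pd(2)[OF t] test_function_pd(2)[OF t']]
      by (intro tendsto_diff l l')
    show "(\<lambda>n. to_L2 (pdx (pdx (D n)))) \<longlonglongrightarrow> vxx - wxx"
      unfolding D_def D(2)[OF t t'] D(2)[OF test_function_pd(1)[OF t] test_function_pd(1)[OF t']]
        D(4)[OF test_function_pd(1)[OF test_function_pd(1)[OF t]]
          test_function_pd(1)[OF test_function_pd(1)[OF t']]]
      by (intro tendsto_diff l l')
    show "(\<lambda>n. to_L2 (pdx (pdy (D n)))) \<longlonglongrightarrow> vxy - wxy"
      unfolding D_def D(3)[OF t t'] D(2)[OF test_function_pd(2)[OF t] test_function_pd(2)[OF t']]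
        D(4)[OF test_function_pd(1)[OF test_function_pd(2)[OF t]]
          test_function_pd(1)[OF test_function_pd(2)[OF t']]]
      by (intro tendsto_diff l l')
    show "to_L2 \<psi> \<bullet> (vyy - wyy) = - (to_L2 (pdy \<psi>) \<bullet> (vy - wy))" if "test_function \<psi>" for \<psi>
      by (simp add: inner_diff_right yy yy' that)
  qed
qed

text \<open>
  If test functions approximate \<open>p\<close> in \<open>H\<^sup>1\<close>, then their antiderivatives approximate \<open>anti p\<close> in
  \<open>H\<^sup>1\<close>, and their \<open>x\<close>-derivatives, the approximants of \<open>p\<close> without mean, converge in \<open>H\<^sup>1\<close> too. This gain of
  one \<open>x\<close>-derivative is the reason for working with antiderivatives. The second derivatives of \<open>p\<close> are
  only weak; their antiderivatives are identified through the skew symmetry of \<^const>\<open>anti\<close>.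
\<close>

lemma regular_anti:
  assumes d: "test_dense" and p: "p \<in> H1_0"
    and wx: "weak_deriv 1 0 p px" and wxx: "weak_deriv 2 0 p pxx" and wyy: "weak_deriv 0 2 p pyy"
  shows "anti px = nonzero_modes p" "anti pxx = nonzero_modes px"
    "\<exists>wy wxy. regular (anti p) (nonzero_modes p) wy (nonzero_modes px) wxy (anti pyy)"
proof -
  obtain px' py \<phi> where px': "weak_deriv 1 0 p px'" and py: "weak_deriv 0 1 p py"
    and t: "\<And>n::nat. test_function (\<phi> n)" and l: "(\<lambda>n. to_L2 (\<phi> n)) \<longlonglongrightarrow> p"
      "(\<lambda>n. to_L2 (pdx (\<phi> n))) \<longlonglongrightarrow> px'" "(\<lambda>n. to_L2 (pdy (\<phi> n))) \<longlonglongrightarrow> py"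
    using p unfolding H1_0_def by blast
  note X = weak_deriv_inner[OF wx, simplified] and X' = weak_deriv_inner[OF px', simplified]
    and XX = weak_deriv_inner[OF wxx, simplified] and Y = weak_deriv_inner[OF py, simplified]
    and YY = weak_deriv_inner[OF wyy, simplified]
  have [simp]: "px' = px"
    by (rule dense_eqI[OF d]) (use X X' in fastforce)
  note an = bounded_linear.tendsto[OF bounded_linear_anti]
    and nz = bounded_linear.tendsto[OF bounded_linear_nonzero_modes]
  note s = test_function_smooth[OF t] and tx = test_function_pd(1)[OF t] and ty = test_function_pd(2)[OF t]
  note ti = test_function_xint
  show apx: "anti px = nonzero_modes p"
    using LIMSEQ_unique[OF an[OF l(2)], of "nonzero_modes p"] nz[OF l(1)]
    by (simp add: anti_to_L2 nonzero_modes_to_L2 tx t pd_xint s)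
  have lw: "(\<lambda>n. to_L2 (xint (\<phi> n))) \<longlonglongrightarrow> anti p"
    using an[OF l(1)] by (simp add: anti_to_L2 t)
  have lwx: "(\<lambda>n. to_L2 (pdx (xint (\<phi> n)))) \<longlonglongrightarrow> nonzero_modes p"
    using nz[OF l(1)] by (simp add: nonzero_modes_to_L2 t)
  have lwy: "(\<lambda>n. to_L2 (pdy (xint (\<phi> n)))) \<longlonglongrightarrow> anti py"
    using an[OF l(3)] by (simp add: anti_to_L2 ty pd_xint s)
  have lwxx: "(\<lambda>n. to_L2 (pdx (pdx (xint (\<phi> n))))) \<longlonglongrightarrow> nonzero_modes px"
    using nz[OF l(2)] by (simp add: nonzero_modes_to_L2 tx pd_xint s)
  have lwxy: "(\<lambda>n. to_L2 (pdx (pdy (xint (\<phi> n))))) \<longlonglongrightarrow> nonzero_modes py"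
    using nz[OF l(3)] by (simp add: nonzero_modes_to_L2 ty pd_xint s)
  show "anti pxx = nonzero_modes px"
  proof (rule dense_eqI[OF d])
    fix \<psi> assume \<psi>: "test_function \<psi>"
    note s\<psi> = test_function_smooth[OF \<psi>] and t\<psi> = test_function_pd(1)[OF \<psi>]
    have "anti pxx \<bullet> to_L2 \<psi> = - (pxx \<bullet> to_L2 (xint \<psi>))"
      by (simp add: anti_skew[OF d] anti_to_L2 \<psi>)
    also have "\<dots> = - (p \<bullet> to_L2 (pdx (pdx (xint \<psi>))))"
      using XX[OF ti[OF \<psi>]] by (simp add: numeral_2_eq_2)
    also have "\<dots> = px \<bullet> to_L2 (xint (pdx \<psi>))"
      using X[OF ti[OF t\<psi>]] by (simp add: pd_xint s\<psi>)
    also have "\<dots> = - (anti px \<bullet> to_L2 (pdx \<psi>))"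
      by (simp add: anti_skew[OF d] anti_to_L2 t\<psi>)
    also have "\<dots> = - (nonzero_modes p \<bullet> to_L2 (pdx \<psi>))" by (simp add: apx)
    also have "\<dots> = nonzero_modes px \<bullet> to_L2 \<psi>"
      by (rule inner_limit_eq[OF lwxx tendsto_const tendsto_minus[OF tendsto_inner[OF lwx tendsto_const]],
            symmetric]) (simp add: test_parts test_function_pd ti t \<psi>)
    finally show "anti pxx \<bullet> to_L2 \<psi> = nonzero_modes px \<bullet> to_L2 \<psi>" .
  qed
  have "to_L2 \<psi> \<bullet> anti pyy = - (to_L2 (pdy \<psi>) \<bullet> anti py)" if \<psi>: "test_function \<psi>" for \<psi>
  proof -
    note s\<psi> = test_function_smooth[OF \<psi>] and t\<psi> = test_function_pd(2)[OF \<psi>]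
    have "anti pyy \<bullet> to_L2 \<psi> = - (pyy \<bullet> to_L2 (xint \<psi>))"
      by (simp add: anti_skew[OF d] anti_to_L2 \<psi>)
    also have "\<dots> = - (p \<bullet> to_L2 (pdy (xint (pdy \<psi>))))"
      using YY[OF ti[OF \<psi>]] by (simp add: numeral_2_eq_2 pd_xint s\<psi>)
    also have "\<dots> = py \<bullet> to_L2 (xint (pdy \<psi>))"
      using Y[OF ti[OF t\<psi>]] by simp
    also have "\<dots> = - (anti py \<bullet> to_L2 (pdy \<psi>))"
      by (simp add: anti_skew[OF d] anti_to_L2 t\<psi>)
    finally show ?thesis by (simp add: inner_commute)
  qed
  then show "\<exists>wy wxy. regular (anti p) (nonzero_modes p) wy (nonzero_modes px) wxy (anti pyy)"
    unfolding regular_def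
    by (intro exI[of _ "anti py"] exI[of _ "nonzero_modes py"] exI[of _ "\<lambda>n. xint (\<phi> n)"] conjI)
      (simp_all add: lw lwx lwy lwxx lwxy ti t)
qed

section \<open>Orbits of the analytic semigroup\<close>

lemma scaleC_state_of_real: "scaleC_state (complex_of_real r) w = r *\<^sub>R w"
proof -
  have "scaleC_L2 (complex_of_real r) u = r *\<^sub>R u" for u
    by transfer (auto simp: L2_rel_def intro: square_integrable_cmult)
  then show ?thesis by (cases w) (simp add: scaleC_state_def)
qed

lemma has_vector_derivative_quotient:
  "(f has_vector_derivative D) (at x) \<longleftrightarrow> ((\<lambda>y. (f y - f x) /\<^sub>R (y - x)) \<longlongrightarrow> D) (at x)"
proof -
  have "(f has_vector_derivative D) (at x)
      \<longleftrightarrow> ((\<lambda>y. norm (f y - f x - (y - x) *\<^sub>R D) / norm (y - x)) \<longlongrightarrow> 0) (at x)"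
    by (simp add: has_vector_derivative_def has_derivative_iff_norm bounded_linear_scaleR_left)
  also have "\<dots> \<longleftrightarrow> ((\<lambda>y. norm ((f y - f x) /\<^sub>R (y - x) - D)) \<longlongrightarrow> 0) (at x)"
  proof (rule filterlim_cong[OF refl refl])
    show "\<forall>\<^sub>F y in at x. norm (f y - f x - (y - x) *\<^sub>R D) / norm (y - x)
        = norm ((f y - f x) /\<^sub>R (y - x) - D)"
      using eventually_neq_at_within[of x x UNIV]
    proof eventually_elim
      case (elim y)
      then have "f y - f x - (y - x) *\<^sub>R D = (y - x) *\<^sub>R ((f y - f x) /\<^sub>R (y - x) - D)"
        by (simp add: scaleR_diff_right)
      then show ?case using elim by simp
    qed
  qed
  also have "\<dots> \<longleftrightarrow> ((\<lambda>y. (f y - f x) /\<^sub>R (y - x)) \<longlongrightarrow> D) (at x)"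
    unfolding tendsto_norm_zero_iff by (rule LIM_zero_iff)
  finally show ?thesis .
qed

text \<open>
  Holomorphy in a sector gives differentiability in time for arbitrary initial data, hence orbits
  lie in the domain of the generator at every positive time.
\<close>

lemma orbit_derivative:
  assumes S: "analytic_semigroup S" and t: "t > 0"
  shows "\<exists>w'. (S t w, w') \<in> generator S \<and> ((\<lambda>s. S s w) has_vector_derivative w') (at t)"
proof -
  obtain \<theta> T where \<theta>: "0 < \<theta>" and TS: "\<And>t. t \<ge> 0 \<Longrightarrow> T (complex_of_real t) = S t"
    and der: "\<And>w z. z \<in> sector \<theta> \<Longrightarrow> \<exists>w'. ((\<lambda>\<zeta>. T \<zeta> w) has_derivative (\<lambda>h. scaleC_state h w')) (at z)"
    using S unfolding analytic_semigroup_def by blast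
  have "complex_of_real t \<in> sector \<theta>" using t \<theta> by (simp add: sector_def)
  then obtain w' where w': "((\<lambda>\<zeta>. T \<zeta> w) has_derivative (\<lambda>h. scaleC_state h w')) (at (complex_of_real t))"
    using der by blast
  have "((\<lambda>s. T (complex_of_real s) w) has_derivative (\<lambda>h. scaleC_state (complex_of_real h) w')) (at t)"
    using has_derivative_compose[where f = complex_of_real and g = "\<lambda>\<zeta>. T \<zeta> w", of complex_of_real t UNIV]
      w' bounded_linear_imp_has_derivative[OF bounded_linear_of_real, of "at t"] by blast
  then have "((\<lambda>s. T (complex_of_real s) w) has_vector_derivative w') (at t)"
    by (simp add: has_vector_derivative_def scaleC_state_of_real)
  then have d: "((\<lambda>s. S s w) has_vector_derivative w') (at t)"
    by (rule has_vector_derivative_transform_within_open[of _ _ _ "{0<..}"]) (use t TS in auto)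
  have "((\<lambda>y. (S y w - S t w) /\<^sub>R (y - t)) \<longlongrightarrow> w') (at t)"
    using d by (simp add: has_vector_derivative_quotient)
  then have "((\<lambda>h. (S (h + t) w - S t w) /\<^sub>R h) \<longlongrightarrow> w') (at 0)"
    by (subst (asm) LIM_offset_zero_iff) (simp_all add: add.commute)
  then have "((\<lambda>h. (S (h + t) w - S t w) /\<^sub>R h) \<longlongrightarrow> w') (at_right 0)"
    by (rule tendsto_mono[rotated]) (simp add: at_le)
  moreover have "\<forall>\<^sub>F h in at_right 0. (S (h + t) w - S t w) /\<^sub>R h = (1 / h) *\<^sub>R (S h (S t w) - S t w)"
    using eventually_at_right_less[of 0]
  proof eventually_elim
    case (elim h)
    have "S (h + t) = S h \<circ> S t"
      using S t elim unfolding analytic_semigroup_def C0_semigroup_def by simp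
    then show ?case by (simp add: divide_inverse)
  qed
  ultimately have "((\<lambda>h. (1 / h) *\<^sub>R (S h (S t w) - S t w)) \<longlongrightarrow> w') (at_right 0)"
    by (rule Lim_transform_eventually)
  with d show ?thesis by (intro exI[of _ w']) (simp add: generator_def)
qed

text \<open>
  The derivative at time \<open>t\<close> is the semigroup applied to the derivative at an earlier time, so it
  inherits strong continuity.
\<close>

lemma orbit_derivative_continuous:
  assumes S: "analytic_semigroup S"
    and D: "\<And>t. t > 0 \<Longrightarrow> ((\<lambda>s. S s w) has_vector_derivative D t) (at t)" and t: "t > 0"
  shows "isCont D t"
proof -
  have C: "\<And>t. t \<ge> 0 \<Longrightarrow> bounded_linear (S t)" "\<And>s t. s \<ge> 0 \<Longrightarrow> t \<ge> 0 \<Longrightarrow> S (s + t) = S s \<circ> S t"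
    "\<And>w. continuous_on {0..} (\<lambda>t. S t w)"
    using S unfolding analytic_semigroup_def C0_semigroup_def by auto
  define s where "s = t / 2"
  have s: "s > 0" "s < t" using t by (auto simp: s_def)
  have eq: "D r = S (r - s) (D s)" if r: "r > s" for r
  proof -
    have "((\<lambda>u. u - (r - s)) has_vector_derivative 1) (at r)"
      using has_vector_derivative_diff[OF has_vector_derivative_id has_vector_derivative_const] by simp
    from vector_diff_chain_at[OF this, of "\<lambda>u. S u w" "D s"] D[OF s(1)]
    have "((\<lambda>u. S (u - (r - s)) w) has_vector_derivative D s) (at r)"
      by (simp add: o_def)
    from bounded_linear.has_vector_derivative[OF C(1)[of "r - s"] this]
    have "((\<lambda>u. S (r - s) (S (u - (r - s)) w)) has_vector_derivative S (r - s) (D s)) (at r)"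
      using r by simp
    then have "((\<lambda>u. S u w) has_vector_derivative S (r - s) (D s)) (at r)"
    proof (rule has_vector_derivative_transform_within_open[of _ _ _ "{r - s<..}"])
      show "S (r - s) (S (u - (r - s)) w) = S u w" if "u \<in> {r - s<..}" for u
        using C(2)[of "r - s" "u - (r - s)"] that r by simp
    qed (use s in auto)
    then show ?thesis using D[of r] r s vector_derivative_unique_at by fastforce
  qed
  have "continuous_on {s<..} (\<lambda>r. S (r - s) (D s))"
    by (intro continuous_on_compose2[OF C(3)] continuous_intros) auto
  then have "continuous_on {s<..} D"
    by (rule continuous_on_eq) (simp add: eq)
  then show ?thesis using s by (simp add: continuous_on_eq_continuous_at)
qed

text \<open>
  Orbits enter the domain at once, and the domain consists of limits of test functions; strong
  continuity at time zero therefore makes test functions dense.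
\<close>

lemma test_dense_if_ionic_semigroup:
  assumes S: "analytic_semigroup S" and gen: "generator S = ionic_operator A E\<^sub>0 D\<^sub>p D\<^sub>m \<kappa>"
  shows "test_dense"
  unfolding test_dense_def
proof
  fix u :: L2
  have C: "S 0 = id" "continuous_on {0..} (\<lambda>t. S t (u, 0))"
    using S unfolding analytic_semigroup_def C0_semigroup_def by auto
  define v where "v n = fst (S (inverse (real (Suc n))) (u, 0))" for n
  have lim: "v \<longlonglongrightarrow> u"
  proof -
    have "(\<lambda>n. S (inverse (real (Suc n))) (u, 0)) \<longlonglongrightarrow> S 0 (u, 0)"
      by (rule continuous_on_tendsto_compose[OF C(2) LIMSEQ_inverse_real_of_nat]) auto
    from tendsto_fst[OF this] show ?thesis by (simp add: v_def[abs_def] C(1))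
  qed
  have "\<exists>f. test_function f \<and> norm (to_L2 f - v n) < inverse (real (Suc n))" for n
  proof -
    obtain w' where "(S (inverse (real (Suc n))) (u, 0), w') \<in> generator S"
      using orbit_derivative[OF S] by (metis inverse_positive_iff_positive of_nat_0_less_iff zero_less_Suc)
    then have "v n \<in> H1_0"
      unfolding gen ionic_operator_def v_def by auto
    then obtain \<phi> where \<phi>: "\<And>k::nat. test_function (\<phi> k)" "(\<lambda>k. to_L2 (\<phi> k)) \<longlonglongrightarrow> v n"
      unfolding H1_0_def by auto
    from LIMSEQ_D[OF \<phi>(2), of "inverse (real (Suc n))"] \<phi>(1) show ?thesis by auto
  qed
  then obtain \<phi> where \<phi>: "\<And>n. test_function (\<phi> n)" "\<And>n. norm (to_L2 (\<phi> n) - v n) < inverse (real (Suc n))"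
    by metis
  have "(\<lambda>n. to_L2 (\<phi> n) - v n) \<longlonglongrightarrow> 0"
    by (rule Lim_null_comparison[OF _ LIMSEQ_inverse_real_of_nat])
      (use \<phi>(2) in \<open>auto intro!: always_eventually less_imp_le\<close>)
  from tendsto_add[OF this lim] have "(\<lambda>n. to_L2 (\<phi> n)) \<longlonglongrightarrow> u" by simp
  with \<phi>(1) show "\<exists>\<phi>. (\<forall>n::nat. test_function (\<phi> n)) \<and> (\<lambda>n. to_L2 (\<phi> n)) \<longlonglongrightarrow> u"
    by blast
qed

text \<open>
  The part of the right-hand side that concerns one ion alone. The electric drift \<open>e\<close> enters as a
  translation in \<open>x\<close>.
\<close>

definition ionic_flux :: "real \<Rightarrow> real \<Rightarrow> real \<Rightarrow> L2 \<Rightarrow> L2 \<Rightarrow> L2 \<Rightarrow> L2" where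
  "ionic_flux A D e wx wxx wyy = D *\<^sub>R (wxx + wyy) - A *\<^sub>R mult_y wx - e *\<^sub>R wx"

text \<open>
  The antiderivatives satisfy the equations again, since \<^const>\<open>anti\<close> commutes with \<open>y\<close>,
  \<open>\<partial>\<^sub>x\<close> and \<open>\<partial>\<^sub>y\<close>, and their \<open>x\<close>-derivatives are the nonzero modes of the original functions.
\<close>

lemma ionic_operator_anti:
  assumes d: "test_dense" and op: "((p, m), (f, g)) \<in> ionic_operator A E\<^sub>0 D\<^sub>p D\<^sub>m \<kappa>"
  shows "\<exists>wy wxx wxy wyy. regular (anti p) (nonzero_modes p) wy wxx wxy wyy \<and>
      anti f = ionic_flux A D\<^sub>p (D\<^sub>p * E\<^sub>0) (nonzero_modes p) wxx wyy
        - (D\<^sub>p * \<kappa>) *\<^sub>R (anti p - anti m)"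
    "\<exists>wy wxx wxy wyy. regular (anti m) (nonzero_modes m) wy wxx wxy wyy \<and>
      anti g = ionic_flux A D\<^sub>m (- D\<^sub>m * E\<^sub>0) (nonzero_modes m) wxx wyy
        + (D\<^sub>m * \<kappa>) *\<^sub>R (anti p - anti m)"
proof -
  obtain px pxx pyy mx mxx myy where h: "p \<in> H1_0" "m \<in> H1_0"
    and wp: "weak_deriv 1 0 p px" "weak_deriv 2 0 p pxx" "weak_deriv 0 2 p pyy"
    and wm: "weak_deriv 1 0 m mx" "weak_deriv 2 0 m mxx" "weak_deriv 0 2 m myy"
    and f: "f = D\<^sub>p *\<^sub>R (pxx + pyy) - A *\<^sub>R mult_y px
                 - (D\<^sub>p * E\<^sub>0) *\<^sub>R px - (D\<^sub>p * \<kappa>) *\<^sub>R (p - m)"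
    and g: "g = D\<^sub>m *\<^sub>R (mxx + myy) - A *\<^sub>R mult_y mx
                 + (D\<^sub>m * E\<^sub>0) *\<^sub>R mx + (D\<^sub>m * \<kappa>) *\<^sub>R (p - m)"
    using op unfolding ionic_operator_def by auto
  interpret I: bounded_linear anti by (rule bounded_linear_anti)
  note P = regular_anti[OF d h(1) wp] and M = regular_anti[OF d h(2) wm]
  have "anti f = ionic_flux A D\<^sub>p (D\<^sub>p * E\<^sub>0) (nonzero_modes p) (nonzero_modes px) (anti pyy)
        - (D\<^sub>p * \<kappa>) *\<^sub>R (anti p - anti m)"
    unfolding f ionic_flux_def
    by (simp add: I.add I.diff I.scaleR anti_mult_y[OF d] P(1,2))
  then show "\<exists>wy wxx wxy wyy. regular (anti p) (nonzero_modes p) wy wxx wxy wyy \<and>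
      anti f = ionic_flux A D\<^sub>p (D\<^sub>p * E\<^sub>0) (nonzero_modes p) wxx wyy
        - (D\<^sub>p * \<kappa>) *\<^sub>R (anti p - anti m)"
    using P(3) by metis
  have "anti g = ionic_flux A D\<^sub>m (- D\<^sub>m * E\<^sub>0) (nonzero_modes m) (nonzero_modes mx) (anti myy)
        + (D\<^sub>m * \<kappa>) *\<^sub>R (anti p - anti m)"
    unfolding g ionic_flux_def
    by (simp add: I.add I.diff I.scaleR anti_mult_y[OF d] M(1,2))
  then show "\<exists>wy wxx wxy wyy. regular (anti m) (nonzero_modes m) wy wxx wxy wyy \<and>
      anti g = ionic_flux A D\<^sub>m (- D\<^sub>m * E\<^sub>0) (nonzero_modes m) wxx wyy
        + (D\<^sub>m * \<kappa>) *\<^sub>R (anti p - anti m)"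
    using M(3) by metis
qed

section \<open>The weighted energy\<close>

text \<open>
  This is \<open>\<parallel>w\<parallel>\<^sup>2 + 2\<delta> \<integral> \<parallel>(\<partial>\<^sub>y + A r \<partial>\<^sub>x) w\<parallel>\<^sup>2 dr\<close> with \<open>r\<close> ranging from \<open>0\<close> to \<open>\<tau>\<close>. Under
  free transport, \<open>(\<partial>\<^sub>y + A r \<partial>\<^sub>x) w\<close> is the \<open>y\<close>-derivative that \<open>w\<close> had a time \<open>r\<close> earlier, carried along
  by the flow; so the integral is the diffusive dissipation over the elapsed time.
\<close>

definition energy :: "real \<Rightarrow> real \<Rightarrow> real \<Rightarrow> L2 \<Rightarrow> L2 \<Rightarrow> L2 \<Rightarrow> real" where
  "energy \<delta> A \<tau> w wx wy = w \<bullet> w + 2 * \<delta> * \<tau> * (wy \<bullet> wy) + 2 * \<delta> * A * \<tau>\<^sup>2 * (wx \<bullet> wy)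
     + 2 / 3 * \<delta> * A\<^sup>2 * \<tau> ^ 3 * (wx \<bullet> wx)"

text \<open>
  The multiplier represents the energy as the quadratic form \<open>\<langle>w, M w\<rangle>\<close>, see
  \<open>inner_multiplier\<close>.
\<close>

definition multiplier :: "real \<Rightarrow> real \<Rightarrow> real \<Rightarrow> L2 \<Rightarrow> L2 \<Rightarrow> L2 \<Rightarrow> L2 \<Rightarrow> L2" where
  "multiplier \<delta> A \<tau> w wxx wxy wyy = w - (2 * \<delta> * \<tau>) *\<^sub>R wyy - (2 * \<delta> * A * \<tau>\<^sup>2) *\<^sub>R wxy
     - (2 / 3 * \<delta> * A\<^sup>2 * \<tau> ^ 3) *\<^sub>R wxx"

text \<open>
  Completing the square in \<open>w\<^sub>y\<close> costs \<open>1/2\<close> of the coefficient \<open>2/3\<close> of \<open>\<parallel>w\<^sub>x\<parallel>\<^sup>2\<close> and leaves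
  \<open>1/6\<close>.
\<close>

lemma energy_lower_bound:
  assumes "\<delta> \<ge> 0" "\<tau> \<ge> 0"
  shows "w \<bullet> w + 1 / 6 * \<delta> * A\<^sup>2 * \<tau> ^ 3 * (wx \<bullet> wx) \<le> energy \<delta> A \<tau> w wx wy"
proof -
  have "0 \<le> 2 * \<delta> * \<tau> * ((wy + (A * \<tau> / 2) *\<^sub>R wx) \<bullet> (wy + (A * \<tau> / 2) *\<^sub>R wx))"
    using assms by simp
  also have "\<dots> = 2 * \<delta> * \<tau> * (wy \<bullet> wy) + 2 * \<delta> * A * \<tau>\<^sup>2 * (wx \<bullet> wy)
      + 1 / 2 * \<delta> * A\<^sup>2 * \<tau> ^ 3 * (wx \<bullet> wx)"
    by (simp add: inner_add_left inner_add_right inner_commute[of wy wx] power2_eq_square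
        power3_eq_cube field_simps)
  finally show ?thesis unfolding energy_def by (simp add: algebra_simps)
qed

lemma energy_nonneg: "\<delta> \<ge> 0 \<Longrightarrow> \<tau> \<ge> 0 \<Longrightarrow> 0 \<le> energy \<delta> A \<tau> w wx wy"
  using energy_lower_bound[of \<delta> \<tau> w A wx wy]
  by (rule order_trans[rotated]) (auto intro!: add_nonneg_nonneg mult_nonneg_nonneg)

lemma inner_multiplier:
  assumes "regular w wx wy wxx wxy wyy"
  shows "w \<bullet> multiplier \<delta> A \<tau> w wxx wxy wyy = energy \<delta> A \<tau> w wx wy"
  using regular_inner[OF assms assms]
  by (simp add: multiplier_def energy_def inner_diff_right)

lemma inner_multiplier_symmetric:
  assumes v: "regular v vx vy vxx vxy vyy" and w: "regular w wx wy wxx wxy wyy"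
  shows "v \<bullet> multiplier \<delta> A \<tau> w wxx wxy wyy = w \<bullet> multiplier \<delta> A \<tau> v vxx vxy vyy"
  using regular_inner[OF v w] regular_inner[OF w v]
  by (simp add: multiplier_def inner_diff_right inner_commute)

lemma multiplier_diff:
  "multiplier \<delta> A \<tau> (v - w) (vxx - wxx) (vxy - wxy) (vyy - wyy)
    = multiplier \<delta> A \<tau> v vxx vxy vyy - multiplier \<delta> A \<tau> w wxx wxy wyy"
  by (simp add: multiplier_def scaleR_diff_right)

text \<open>
  The second summand is the derivative of the weights in time. Its \<open>w\<^sub>x w\<^sub>y\<close> and \<open>w\<^sub>x\<^sup>2\<close> terms cancel
  exactly against the shear commutators, its \<open>w\<^sub>y\<^sup>2\<close> term is absorbed by the diffusion because
  \<open>\<delta> \<le> D\<close>, and the diffusion of the weighted terms has a sign by two more squares. The drift is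
  orthogonal to the multiplier.
\<close>

lemma flux_dissipation:
  assumes w: "regular w wx wy wxx wxy wyy" and \<delta>: "0 \<le> \<delta>" "\<delta> \<le> D" and \<tau>: "0 \<le> \<tau>"
  shows "2 * (ionic_flux A D e wx wxx wyy \<bullet> multiplier \<delta> A \<tau> w wxx wxy wyy)
    + (2 * \<delta> * (wy \<bullet> wy) + 4 * \<delta> * A * \<tau> * (wx \<bullet> wy) + 2 * \<delta> * A\<^sup>2 * \<tau>\<^sup>2 * (wx \<bullet> wx)) \<le> 0"
proof -
  note t = regular_transport[OF w] and s = regular_inner[OF w w]
  define X where "X = wxx \<bullet> wxx"
  define Y where "Y = wyy \<bullet> wyy"
  define Z where "Z = wxy \<bullet> wxy"
  define P where "P = wxx \<bullet> wxy"
  define Q where "Q = wyy \<bullet> wxy"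
  define a where "a = wx \<bullet> wx"
  define b where "b = wy \<bullet> wy"
  let ?M = "multiplier \<delta> A \<tau> w wxx wxy wyy"
  have e: "wx \<bullet> ?M = 0"
    by (simp add: multiplier_def inner_diff_right t)
  have y: "mult_y wx \<bullet> ?M = 2 * \<delta> * \<tau> * (wx \<bullet> wy) + \<delta> * A * \<tau>\<^sup>2 * a"
    by (simp add: multiplier_def inner_diff_right t a_def)
  have yx: "wyy \<bullet> wxx = Z" using t(9) by (simp add: Z_def inner_commute)
  have lap: "(wxx + wyy) \<bullet> ?M = - a - b - 2 * \<delta> * \<tau> * (Z + Y) - 2 * \<delta> * A * \<tau>\<^sup>2 * (P + Q)
      - 2 / 3 * \<delta> * A\<^sup>2 * \<tau> ^ 3 * (X + Z)"
    using s(1,4) t(9) yx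
    by (simp add: multiplier_def inner_diff_right inner_add_left X_def Y_def Z_def P_def Q_def a_def b_def
        inner_commute[of wxx w] inner_commute[of wyy w])
  \<comment> \<open>the two squares that control the cross terms, with the multiples of \<open>\<tau>\<close> that make them fit\<close>
  have q1: "0 \<le> Y + A * \<tau> * Q + 1 / 4 * A\<^sup>2 * \<tau>\<^sup>2 * Z"
    using inner_ge_zero[of "wyy + (A * \<tau> / 2) *\<^sub>R wxy"]
    by (simp add: inner_add_left inner_add_right Y_def Q_def Z_def inner_commute[of wxy wyy]
        power2_eq_square algebra_simps)
  have q2: "0 \<le> Z + A * \<tau> * P + 1 / 4 * A\<^sup>2 * \<tau>\<^sup>2 * X"
    using inner_ge_zero[of "wxy + (A * \<tau> / 2) *\<^sub>R wxx"]
    by (simp add: inner_add_left inner_add_right X_def P_def Z_def inner_commute[of wxy wxx]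
        power2_eq_square algebra_simps)
  have pos: "0 \<le> X" "0 \<le> Z" "0 \<le> a" "0 \<le> b" by (simp_all add: X_def Z_def a_def b_def)
  have r: "0 \<le> 1 / 12 * A\<^sup>2 * \<tau>\<^sup>2 * (X + Z)" using pos by simp
  have "0 \<le> 2 * \<delta> * \<tau> * ((Y + A * \<tau> * Q + 1 / 4 * A\<^sup>2 * \<tau>\<^sup>2 * Z) + (Z + A * \<tau> * P + 1 / 4 * A\<^sup>2 * \<tau>\<^sup>2 * X)
      + 1 / 12 * A\<^sup>2 * \<tau>\<^sup>2 * (X + Z))"
    using \<delta>(1) \<tau>
    by (intro mult_nonneg_nonneg[OF _ add_nonneg_nonneg[OF add_nonneg_nonneg[OF q1 q2] r]]) auto
  also have "\<dots> = 2 * \<delta> * \<tau> * (Z + Y) + 2 * \<delta> * A * \<tau>\<^sup>2 * (P + Q) + 2 / 3 * \<delta> * A\<^sup>2 * \<tau> ^ 3 * (X + Z)"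
    by (simp add: power2_eq_square power3_eq_cube field_simps)
  finally have "(wxx + wyy) \<bullet> ?M \<le> - b" using lap pos by simp
  then have "D * ((wxx + wyy) \<bullet> ?M) \<le> D * (- b)" using \<delta> by (intro mult_left_mono) auto
  also have "\<dots> \<le> \<delta> * (- b)" using \<delta> pos by (simp add: mult_right_mono)
  finally have "2 * (D * ((wxx + wyy) \<bullet> ?M)) + 2 * \<delta> * b \<le> 0" by simp
  moreover have "ionic_flux A D e wx wxx wyy \<bullet> ?M
      = D * ((wxx + wyy) \<bullet> ?M) - 2 * \<delta> * A * \<tau> * (wx \<bullet> wy) - \<delta> * A\<^sup>2 * \<tau>\<^sup>2 * a"
    by (simp add: ionic_flux_def inner_diff_left e y algebra_simps power2_eq_square)
  ultimately show ?thesis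
    by (simp add: a_def b_def algebra_simps)
qed

lemma flux_x_dissipation:
  assumes w: "regular w wx wy wxx wxy wyy" and D: "0 \<le> D"
  shows "ionic_flux A D e wx wxx wyy \<bullet> (- wxx) \<le> 0"
proof -
  have "(wxx + wyy) \<bullet> wxx = wxx \<bullet> wxx + wxy \<bullet> wxy"
    using regular_transport(9)[OF w] by (simp add: inner_add_left inner_commute[of wyy wxx])
  then show ?thesis
    using D regular_transport(2,6)[OF w]
    by (simp add: ionic_flux_def inner_diff_left)
qed

text \<open>
  For a positive symmetric form the reaction \<open>p - m\<close> is dissipative when both diffusivities agree.
  In general only their difference can make the form grow.
\<close>

lemma coupling_growth:
  fixes p m :: "'a::real_inner"
  assumes \<kappa>: "\<kappa> \<ge> 0" and nn: "0 \<le> p \<bullet> Mp" "0 \<le> m \<bullet> Mm" "0 \<le> (p - m) \<bullet> (Mp - Mm)"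
    and sym: "p \<bullet> Mm = m \<bullet> Mp" and D: "D\<^sub>p \<ge> 0" "D\<^sub>m \<ge> 0"
  shows "2 * ((- ((D\<^sub>p * \<kappa>) *\<^sub>R (p - m))) \<bullet> Mp) + 2 * (((D\<^sub>m * \<kappa>) *\<^sub>R (p - m)) \<bullet> Mm)
    \<le> \<kappa> * \<bar>D\<^sub>p - D\<^sub>m\<bar> * (p \<bullet> Mp + m \<bullet> Mm)"
proof -
  let ?a = "p \<bullet> Mp" and ?b = "m \<bullet> Mm" and ?x = "p \<bullet> Mm"
  have x: "2 * ?x \<le> ?a + ?b"
    using nn(3) sym by (simp add: inner_diff_left inner_diff_right)
  have "2 * ((- ((D\<^sub>p * \<kappa>) *\<^sub>R (p - m))) \<bullet> Mp) + 2 * (((D\<^sub>m * \<kappa>) *\<^sub>R (p - m)) \<bullet> Mm)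
      = \<kappa> * ((D\<^sub>p + D\<^sub>m) * (2 * ?x) - 2 * D\<^sub>p * ?a - 2 * D\<^sub>m * ?b)"
    using sym by (simp add: inner_diff_left algebra_simps)
  also have "\<dots> \<le> \<kappa> * ((D\<^sub>p + D\<^sub>m) * (?a + ?b) - 2 * D\<^sub>p * ?a - 2 * D\<^sub>m * ?b)"
    using x D \<kappa> by (intro mult_left_mono diff_right_mono) auto
  also have "\<dots> = \<kappa> * ((D\<^sub>m - D\<^sub>p) * ?a + (D\<^sub>p - D\<^sub>m) * ?b)"
    by (simp add: algebra_simps)
  also have "\<dots> \<le> \<kappa> * (\<bar>D\<^sub>p - D\<^sub>m\<bar> * ?a + \<bar>D\<^sub>p - D\<^sub>m\<bar> * ?b)"
    using nn(1,2) \<kappa> by (intro mult_left_mono add_mono mult_right_mono) auto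
  finally show ?thesis by (simp add: algebra_simps)
qed

section \<open>Time derivatives of quadratic quantities\<close>

text \<open>
  By symmetry the increment of the form is \<open>\<langle>w s - w t, M s + M t\<rangle>\<close>, so continuity of
  \<open>M\<close> suffices.
\<close>

lemma symmetric_form_derivative:
  fixes w M :: "real \<Rightarrow> 'a::real_inner"
  assumes w: "(w has_vector_derivative f) (at t)" and M: "isCont M t" and t: "t > 0"
    and sym: "\<And>s. s > 0 \<Longrightarrow> w s \<bullet> M t = w t \<bullet> M s"
  shows "((\<lambda>s. w s \<bullet> M s) has_real_derivative 2 * (f \<bullet> M t)) (at t)"
  unfolding has_field_derivative_iff
proof (rule Lim_transform_eventually)
  have "((\<lambda>s. ((w s - w t) /\<^sub>R (s - t)) \<bullet> (M s + M t)) \<longlongrightarrow> f \<bullet> (M t + M t)) (at t)"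
    using w M by (intro tendsto_intros) (simp_all add: has_vector_derivative_quotient isCont_def)
  then show "((\<lambda>s. ((w s - w t) /\<^sub>R (s - t)) \<bullet> (M s + M t)) \<longlongrightarrow> 2 * (f \<bullet> M t)) (at t)"
    by (simp add: inner_add_right)
  have "\<forall>\<^sub>F s in at t. s > 0"
    using t by (intro eventually_at_topological[THEN iffD2] exI[of _ "{0<..}"]) auto
  then show "\<forall>\<^sub>F s in at t. ((w s - w t) /\<^sub>R (s - t)) \<bullet> (M s + M t) = (w s \<bullet> M s - w t \<bullet> M t) / (s - t)"
    by eventually_elim (simp add: sym inner_add_right inner_diff_left divide_inverse algebra_simps)
qed

lemma exponential_growth:
  fixes \<Phi> \<Phi>' :: "real \<Rightarrow> real"
  assumes "s \<le> t" and d: "\<And>r. s \<le> r \<Longrightarrow> r \<le> t \<Longrightarrow> (\<Phi> has_real_derivative \<Phi>' r) (at r)"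
    and le: "\<And>r. s \<le> r \<Longrightarrow> r \<le> t \<Longrightarrow> \<Phi>' r \<le> \<mu> * \<Phi> r"
  shows "\<Phi> t \<le> exp (\<mu> * (t - s)) * \<Phi> s"
proof -
  have "exp (- \<mu> * (t - s)) * \<Phi> t \<le> exp (- \<mu> * (s - s)) * \<Phi> s"
  proof (rule DERIV_nonpos_imp_nonincreasing[OF assms(1), where f = "\<lambda>r. exp (- \<mu> * (r - s)) * \<Phi> r"])
    fix r assume r: "s \<le> r" "r \<le> t"
    have "((\<lambda>r. exp (- \<mu> * (r - s)) * \<Phi> r) has_real_derivative
        exp (- \<mu> * (r - s)) * (\<Phi>' r - \<mu> * \<Phi> r)) (at r)"
      by (auto intro!: derivative_eq_intros d[OF r] simp: algebra_simps)
    moreover have "exp (- \<mu> * (r - s)) * (\<Phi>' r - \<mu> * \<Phi> r) \<le> 0"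
      using le[OF r] by (intro mult_nonneg_nonpos) auto
    ultimately show "\<exists>y. ((\<lambda>r. exp (- \<mu> * (r - s)) * \<Phi> r) has_real_derivative y) (at r) \<and> y \<le> 0"
      by blast
  qed
  then have "exp (\<mu> * (t - s)) * (exp (- \<mu> * (t - s)) * \<Phi> t) \<le> exp (\<mu> * (t - s)) * \<Phi> s"
    by (intro mult_left_mono) auto
  then show ?thesis by (simp add: exp_minus mult.assoc[symmetric])
qed

locale regular_evolution =
  fixes A D e :: real and w wx wy wxx wxy wyy f g :: "real \<Rightarrow> L2"
  assumes D_pos: "D > 0"
    and reg: "\<And>t. t > 0 \<Longrightarrow> regular (w t) (wx t) (wy t) (wxx t) (wxy t) (wyy t)"
    and deriv: "\<And>t. t > 0 \<Longrightarrow> (w has_vector_derivative f t) (at t)"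
    and equation: "\<And>t. t > 0 \<Longrightarrow> f t = ionic_flux A D e (wx t) (wxx t) (wyy t) + g t"
    and cont: "\<And>t. t > 0 \<Longrightarrow> isCont f t" "\<And>t. t > 0 \<Longrightarrow> isCont wx t" "\<And>t. t > 0 \<Longrightarrow> isCont g t"
begin

text \<open>
  The equation makes the Laplacian continuous in time, and the Laplacian controls every second
  derivative because \<open>\<parallel>\<Delta>w\<parallel>\<^sup>2 = \<parallel>w\<^sub>x\<^sub>x\<parallel>\<^sup>2 + 2\<parallel>w\<^sub>x\<^sub>y\<parallel>\<^sup>2 + \<parallel>w\<^sub>y\<^sub>y\<parallel>\<^sup>2\<close> under the Dirichlet condition.
\<close>

lemma second_derivatives_continuous:
  assumes t: "t > 0" shows "isCont wxx t" "isCont wxy t" "isCont wyy t"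
proof -
  have pos: "\<forall>\<^sub>F s in at t. s > 0"
    using t by (intro eventually_at_topological[THEN iffD2] exI[of _ "{0<..}"]) auto
  have lap: "(1 / D) *\<^sub>R (f s + A *\<^sub>R mult_y (wx s) + e *\<^sub>R wx s - g s) = wxx s + wyy s" if "s > 0" for s
    using equation[OF that] D_pos by (simp add: ionic_flux_def)
  have "((\<lambda>s. (1 / D) *\<^sub>R (f s + A *\<^sub>R mult_y (wx s) + e *\<^sub>R wx s - g s))
      \<longlongrightarrow> (1 / D) *\<^sub>R (f t + A *\<^sub>R mult_y (wx t) + e *\<^sub>R wx t - g t)) (at t)"
    using cont[OF t] by (intro tendsto_intros mult_y_tendsto) (simp_all add: isCont_def)
  then have "((\<lambda>s. wxx s + wyy s) \<longlongrightarrow> wxx t + wyy t) (at t)"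
    unfolding lap[OF t]
    by (rule Lim_transform_eventually) (use pos lap in \<open>auto elim: eventually_mono\<close>)
  then have lim: "((\<lambda>s. norm ((wxx s + wyy s) - (wxx t + wyy t))) \<longlongrightarrow> 0) (at t)"
    by (intro tendsto_norm_zero) (simp add: LIM_zero_iff)
  have bd: "norm (wxx s - wxx t) \<le> norm ((wxx s + wyy s) - (wxx t + wyy t))"
    "norm (wxy s - wxy t) \<le> norm ((wxx s + wyy s) - (wxx t + wyy t))"
    "norm (wyy s - wyy t) \<le> norm ((wxx s + wyy s) - (wxx t + wyy t))" if s: "s > 0" for s
  proof -
    define X Y Z where XYZ: "X = wxx s - wxx t" "Y = wyy s - wyy t" "Z = wxy s - wxy t"
    have "X \<bullet> Y = Z \<bullet> Z"
      using regular_transport(9)[OF regular_diff[OF reg[OF s] reg[OF t]]] by (simp add: XYZ)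
    then have "(norm (X + Y))\<^sup>2 = (norm X)\<^sup>2 + 2 * (norm Z)\<^sup>2 + (norm Y)\<^sup>2"
      unfolding power2_norm_eq_inner by (simp add: inner_add_left inner_add_right inner_commute[of Y X])
    then have "(norm X)\<^sup>2 \<le> (norm (X + Y))\<^sup>2" "(norm Z)\<^sup>2 \<le> (norm (X + Y))\<^sup>2"
      "(norm Y)\<^sup>2 \<le> (norm (X + Y))\<^sup>2"
      by auto
    then have "norm X \<le> norm (X + Y)" "norm Z \<le> norm (X + Y)" "norm Y \<le> norm (X + Y)"
      using power2_le_imp_le norm_ge_zero by blast+
    then show "norm (wxx s - wxx t) \<le> norm ((wxx s + wyy s) - (wxx t + wyy t))"
      "norm (wxy s - wxy t) \<le> norm ((wxx s + wyy s) - (wxx t + wyy t))"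
      "norm (wyy s - wyy t) \<le> norm ((wxx s + wyy s) - (wxx t + wyy t))"
      by (simp_all add: XYZ algebra_simps)
  qed
  have "((\<lambda>s. h s - h t) \<longlongrightarrow> 0) (at t)"
    if "\<And>s. s > 0 \<Longrightarrow> norm (h s - h t) \<le> norm ((wxx s + wyy s) - (wxx t + wyy t))" for h :: "real \<Rightarrow> L2"
    by (rule Lim_null_comparison[OF _ lim]) (use pos that in \<open>auto elim: eventually_mono\<close>)
  from this[OF bd(1)] this[OF bd(2)] this[OF bd(3)]
  show "isCont wxx t" "isCont wxy t" "isCont wyy t"
    by (simp_all add: isCont_def LIM_zero_iff)
qed

lemma quadratic_derivatives:
  assumes t: "t > 0"
  shows "((\<lambda>s. w s \<bullet> w s) has_real_derivative 2 * (f t \<bullet> w t)) (at t)"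
    "((\<lambda>s. wx s \<bullet> wx s) has_real_derivative - 2 * (f t \<bullet> wxx t)) (at t)"
    "((\<lambda>s. wx s \<bullet> wy s) has_real_derivative - 2 * (f t \<bullet> wxy t)) (at t)"
    "((\<lambda>s. wy s \<bullet> wy s) has_real_derivative - 2 * (f t \<bullet> wyy t)) (at t)"
proof -
  note i = regular_inner[OF reg reg] and c = second_derivatives_continuous[OF t]
  have wc: "isCont w t" using deriv[OF t] by (rule has_vector_derivative_continuous)
  show "((\<lambda>s. w s \<bullet> w s) has_real_derivative 2 * (f t \<bullet> w t)) (at t)"
    by (rule symmetric_form_derivative[OF deriv[OF t] wc t]) (rule inner_commute)
  have neg: "((\<lambda>s. h s) has_real_derivative - 2 * (f t \<bullet> M t)) (at t)"
    if M: "isCont M t" and h: "\<And>s. s > 0 \<Longrightarrow> h s = - (w s \<bullet> M s)"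
      and sym: "\<And>s. s > 0 \<Longrightarrow> w s \<bullet> M t = w t \<bullet> M s" for h M
  proof -
    have "((\<lambda>s. - (w s \<bullet> M s)) has_real_derivative - (2 * (f t \<bullet> M t))) (at t)"
      by (intro DERIV_minus symmetric_form_derivative[OF deriv[OF t] M t] sym)
    then have "(h has_real_derivative - (2 * (f t \<bullet> M t))) (at t)"
      by (rule has_field_derivative_transform_within_open[of _ _ _ "{0<..}"]) (use t h in auto)
    then show ?thesis by simp
  qed
  show "((\<lambda>s. wx s \<bullet> wx s) has_real_derivative - 2 * (f t \<bullet> wxx t)) (at t)"
    by (rule neg[OF c(1)]) (use i(1) t in \<open>auto simp: inner_commute\<close>)
  show "((\<lambda>s. wx s \<bullet> wy s) has_real_derivative - 2 * (f t \<bullet> wxy t)) (at t)"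
  proof (rule neg[OF c(2)])
    show "w s \<bullet> wxy t = w t \<bullet> wxy s" if "s > 0" for s
      using i(2)[OF that t] i(3)[OF t that] by (simp add: inner_commute)
  qed (use i(2) in auto)
  show "((\<lambda>s. wy s \<bullet> wy s) has_real_derivative - 2 * (f t \<bullet> wyy t)) (at t)"
    by (rule neg[OF c(3)]) (use i(4) t in \<open>auto simp: inner_commute\<close>)
qed

lemma energy_derivative:
  assumes t: "t > 0"
  shows "((\<lambda>r. energy \<delta> A (r - s) (w r) (wx r) (wy r)) has_real_derivative
    2 * (f t \<bullet> multiplier \<delta> A (t - s) (w t) (wxx t) (wxy t) (wyy t))
      + (2 * \<delta> * (wy t \<bullet> wy t) + 4 * \<delta> * A * (t - s) * (wx t \<bullet> wy t)
      + 2 * \<delta> * A\<^sup>2 * (t - s)\<^sup>2 * (wx t \<bullet> wx t))) (at t)"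
proof -
  have m: "f t \<bullet> multiplier \<delta> A (t - s) (w t) (wxx t) (wxy t) (wyy t)
      = f t \<bullet> w t - 2 * \<delta> * (t - s) * (f t \<bullet> wyy t) - 2 * \<delta> * A * (t - s)\<^sup>2 * (f t \<bullet> wxy t)
        - 2 / 3 * \<delta> * A\<^sup>2 * (t - s) ^ 3 * (f t \<bullet> wxx t)"
    by (simp add: multiplier_def inner_diff_right)
  show ?thesis
    unfolding energy_def m
    by (rule derivative_eq_intros quadratic_derivatives[OF t] refl)+
      (simp add: field_simps power2_eq_square power3_eq_cube)
qed

lemma energy_derivative_le:
  assumes t: "t > 0" "s \<le> t" and \<delta>: "0 \<le> \<delta>" "\<delta> \<le> D"
  shows "2 * (f t \<bullet> multiplier \<delta> A (t - s) (w t) (wxx t) (wxy t) (wyy t))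
      + (2 * \<delta> * (wy t \<bullet> wy t) + 4 * \<delta> * A * (t - s) * (wx t \<bullet> wy t)
      + 2 * \<delta> * A\<^sup>2 * (t - s)\<^sup>2 * (wx t \<bullet> wx t))
    \<le> 2 * (g t \<bullet> multiplier \<delta> A (t - s) (w t) (wxx t) (wxy t) (wyy t))"
  using flux_dissipation[OF reg[OF t(1)] \<delta>, of "t - s" A e] t(2)
  by (simp add: equation[OF t(1)] inner_add_left)

lemma x_energy_derivative_le:
  assumes t: "t > 0"
  shows "- 2 * (f t \<bullet> wxx t) \<le> 2 * (g t \<bullet> (- wxx t))"
  using flux_x_dissipation[OF reg[OF t], of D A e] D_pos
  by (simp add: equation[OF t] inner_add_left)

end

section \<open>Enhanced dissipation\<close>

text \<open>
  The common weight \<open>min D\<^sub>p D\<^sub>m\<close> serves both ions, which makes the two energies parts of one symmetric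
  form to which \<open>coupling_growth\<close> applies; the drifts may be different. The energy starts at
  \<open>\<parallel>w\<parallel>\<^sup>2\<close> and controls \<open>(t - s)\<^sup>3 \<parallel>w\<^sub>x\<parallel>\<^sup>2\<close> later.
\<close>

lemma regular_pair_growth:
  fixes A D\<^sub>p D\<^sub>m e\<^sub>p e\<^sub>m \<kappa> :: real
  assumes P: "regular_evolution A D\<^sub>p e\<^sub>p p px py pxx pxy pyy fp (\<lambda>t. - ((D\<^sub>p * \<kappa>) *\<^sub>R (p t - m t)))"
    and M: "regular_evolution A D\<^sub>m e\<^sub>m m mx my mxx mxy myy fm (\<lambda>t. (D\<^sub>m * \<kappa>) *\<^sub>R (p t - m t))"
    and \<kappa>: "\<kappa> \<ge> 0" and s: "0 < s" "s \<le> t"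
  shows "px t \<bullet> px t + mx t \<bullet> mx t
      \<le> exp (\<kappa> * \<bar>D\<^sub>p - D\<^sub>m\<bar> * (t - s)) * (px s \<bullet> px s + mx s \<bullet> mx s)"
    and "1 / 6 * min D\<^sub>p D\<^sub>m * A\<^sup>2 * (t - s) ^ 3 * (px t \<bullet> px t + mx t \<bullet> mx t)
      \<le> exp (\<kappa> * \<bar>D\<^sub>p - D\<^sub>m\<bar> * (t - s)) * (p s \<bullet> p s + m s \<bullet> m s)"
proof -
  interpret P: regular_evolution A D\<^sub>p e\<^sub>p p px py pxx pxy pyy fp "\<lambda>t. - ((D\<^sub>p * \<kappa>) *\<^sub>R (p t - m t))"
    by (rule P)
  interpret M: regular_evolution A D\<^sub>m e\<^sub>m m mx my mxx mxy myy fm "\<lambda>t. (D\<^sub>m * \<kappa>) *\<^sub>R (p t - m t)"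
    by (rule M)
  note D = P.D_pos M.D_pos
  let ?\<mu> = "\<kappa> * \<bar>D\<^sub>p - D\<^sub>m\<bar>"
  define \<delta> where "\<delta> = min D\<^sub>p D\<^sub>m"
  have \<delta>: "0 \<le> \<delta>" "\<delta> \<le> D\<^sub>p" "\<delta> \<le> D\<^sub>m" using D by (auto simp: \<delta>_def)
  show "px t \<bullet> px t + mx t \<bullet> mx t \<le> exp (?\<mu> * (t - s)) * (px s \<bullet> px s + mx s \<bullet> mx s)"
  proof (rule exponential_growth[OF s(2), where \<Phi> = "\<lambda>r. px r \<bullet> px r + mx r \<bullet> mx r"])
    fix r assume "s \<le> r"
    then have r: "r > 0" using s by simp
    show "((\<lambda>r. px r \<bullet> px r + mx r \<bullet> mx r) has_real_derivative
        - 2 * (fp r \<bullet> pxx r) + - 2 * (fm r \<bullet> mxx r)) (at r)"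
      by (intro DERIV_add P.quadratic_derivatives M.quadratic_derivatives r)
    note p = regular_inner[OF P.reg[OF r] P.reg[OF r]] and m = regular_inner[OF M.reg[OF r] M.reg[OF r]]
      and pm = regular_inner[OF P.reg[OF r] M.reg[OF r]] and mp = regular_inner[OF M.reg[OF r] P.reg[OF r]]
    have "2 * ((- ((D\<^sub>p * \<kappa>) *\<^sub>R (p r - m r))) \<bullet> (- pxx r)) + 2 * (((D\<^sub>m * \<kappa>) *\<^sub>R (p r - m r)) \<bullet> (- mxx r))
        \<le> ?\<mu> * (p r \<bullet> (- pxx r) + m r \<bullet> (- mxx r))"
    proof (rule coupling_growth[OF \<kappa>])
      have "(p r - m r) \<bullet> (- pxx r - - mxx r) = (px r - mx r) \<bullet> (px r - mx r)"
        by (simp add: inner_diff_left inner_diff_right p(1) m(1) pm(1) mp(1))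
      then show "0 \<le> (p r - m r) \<bullet> (- pxx r - - mxx r)" by simp
    qed (use D in \<open>simp_all add: p(1) m(1) pm(1) mp(1) inner_commute[of "mx r" "px r"]\<close>)
    also have "p r \<bullet> (- pxx r) + m r \<bullet> (- mxx r) = px r \<bullet> px r + mx r \<bullet> mx r"
      using p m by simp
    finally show "- 2 * (fp r \<bullet> pxx r) + - 2 * (fm r \<bullet> mxx r) \<le> ?\<mu> * (px r \<bullet> px r + mx r \<bullet> mx r)"
      using P.x_energy_derivative_le[OF r] M.x_energy_derivative_le[OF r] by linarith
  qed
  let ?Ep = "\<lambda>r. energy \<delta> A (r - s) (p r) (px r) (py r)"
  let ?Em = "\<lambda>r. energy \<delta> A (r - s) (m r) (mx r) (my r)"
  have "?Ep t + ?Em t \<le> exp (?\<mu> * (t - s)) * (?Ep s + ?Em s)"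
  proof (rule exponential_growth[OF s(2), where \<Phi> = "\<lambda>r. ?Ep r + ?Em r"])
    fix r assume sr: "s \<le> r"
    then have r: "r > 0" using s by simp
    let ?Mp = "multiplier \<delta> A (r - s) (p r) (pxx r) (pxy r) (pyy r)"
    let ?Mm = "multiplier \<delta> A (r - s) (m r) (mxx r) (mxy r) (myy r)"
    show "((\<lambda>r. ?Ep r + ?Em r) has_real_derivative
        (2 * (fp r \<bullet> ?Mp) + (2 * \<delta> * (py r \<bullet> py r) + 4 * \<delta> * A * (r - s) * (px r \<bullet> py r)
          + 2 * \<delta> * A\<^sup>2 * (r - s)\<^sup>2 * (px r \<bullet> px r)))
        + (2 * (fm r \<bullet> ?Mm) + (2 * \<delta> * (my r \<bullet> my r) + 4 * \<delta> * A * (r - s) * (mx r \<bullet> my r)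
          + 2 * \<delta> * A\<^sup>2 * (r - s)\<^sup>2 * (mx r \<bullet> mx r)))) (at r)"
      by (intro DERIV_add P.energy_derivative M.energy_derivative r)
    note reg = P.reg[OF r] M.reg[OF r]
    have "2 * ((- ((D\<^sub>p * \<kappa>) *\<^sub>R (p r - m r))) \<bullet> ?Mp) + 2 * (((D\<^sub>m * \<kappa>) *\<^sub>R (p r - m r)) \<bullet> ?Mm)
        \<le> ?\<mu> * (p r \<bullet> ?Mp + m r \<bullet> ?Mm)"
    proof (rule coupling_growth[OF \<kappa>])
      show "0 \<le> p r \<bullet> ?Mp" "0 \<le> m r \<bullet> ?Mm"
        using \<delta> sr by (auto simp: inner_multiplier[OF reg(1)] inner_multiplier[OF reg(2)]
            intro!: energy_nonneg)
      show "0 \<le> (p r - m r) \<bullet> (?Mp - ?Mm)"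
        unfolding multiplier_diff[symmetric] inner_multiplier[OF regular_diff[OF reg]]
        using \<delta> sr by (intro energy_nonneg) auto
      show "p r \<bullet> ?Mm = m r \<bullet> ?Mp" by (rule inner_multiplier_symmetric[OF reg])
    qed (use D in auto)
    also have "p r \<bullet> ?Mp + m r \<bullet> ?Mm = ?Ep r + ?Em r"
      by (simp add: inner_multiplier[OF reg(1)] inner_multiplier[OF reg(2)])
    finally show "(2 * (fp r \<bullet> ?Mp) + (2 * \<delta> * (py r \<bullet> py r) + 4 * \<delta> * A * (r - s) * (px r \<bullet> py r)
          + 2 * \<delta> * A\<^sup>2 * (r - s)\<^sup>2 * (px r \<bullet> px r)))
        + (2 * (fm r \<bullet> ?Mm) + (2 * \<delta> * (my r \<bullet> my r) + 4 * \<delta> * A * (r - s) * (mx r \<bullet> my r)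
          + 2 * \<delta> * A\<^sup>2 * (r - s)\<^sup>2 * (mx r \<bullet> mx r))) \<le> ?\<mu> * (?Ep r + ?Em r)"
      using P.energy_derivative_le[OF r sr \<delta>(1,2)] M.energy_derivative_le[OF r sr \<delta>(1,3)] by linarith
  qed
  also have "?Ep s + ?Em s = p s \<bullet> p s + m s \<bullet> m s"
    by (simp add: energy_def)
  finally have "?Ep t + ?Em t \<le> exp (?\<mu> * (t - s)) * (p s \<bullet> p s + m s \<bullet> m s)" .
  moreover have "1 / 6 * \<delta> * A\<^sup>2 * (t - s) ^ 3 * (px t \<bullet> px t) \<le> ?Ep t"
    "1 / 6 * \<delta> * A\<^sup>2 * (t - s) ^ 3 * (mx t \<bullet> mx t) \<le> ?Em t"
    using energy_lower_bound[OF \<delta>(1), of "t - s" "p t" A "px t" "py t"]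
      energy_lower_bound[OF \<delta>(1), of "t - s" "m t" A "mx t" "my t"] s
      inner_ge_zero[of "p t"] inner_ge_zero[of "m t"] by linarith+
  ultimately show "1 / 6 * min D\<^sub>p D\<^sub>m * A\<^sup>2 * (t - s) ^ 3 * (px t \<bullet> px t + mx t \<bullet> mx t)
      \<le> exp (?\<mu> * (t - s)) * (p s \<bullet> p s + m s \<bullet> m s)"
    unfolding \<delta>_def[symmetric] distrib_left by linarith
qed

text \<open>
  The previous estimates for the antiderivatives of an orbit. Since the \<open>x\<close>-derivatives of these are the
  nonzero modes of the orbit itself, the second estimate bounds the nonzero modes by their own value at
  an earlier time, with a factor that becomes small.
\<close>

lemma ionic_growth:
  assumes S: "analytic_semigroup S" and gen: "generator S = ionic_operator A E\<^sub>0 D\<^sub>p D\<^sub>m \<kappa>"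
    and pos: "D\<^sub>p > 0" "D\<^sub>m > 0" "\<kappa> \<ge> 0" and s: "0 < s" "s \<le> t"
  shows "(norm (state_nonzero_modes (S t w)))\<^sup>2
      \<le> exp (\<kappa> * \<bar>D\<^sub>p - D\<^sub>m\<bar> * (t - s)) * (norm (state_nonzero_modes (S s w)))\<^sup>2"
    and "1 / 6 * min D\<^sub>p D\<^sub>m * A\<^sup>2 * (t - s) ^ 3 * (norm (state_nonzero_modes (S t w)))\<^sup>2
      \<le> exp (\<kappa> * \<bar>D\<^sub>p - D\<^sub>m\<bar> * (t - s)) * (pi\<^sup>2 * (norm (state_nonzero_modes (S s w)))\<^sup>2)"
proof -
  note dense = test_dense_if_ionic_semigroup[OF S gen]
  define p m where "p t = fst (S t w)" and "m t = snd (S t w)" for t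
  obtain F where F: "\<And>t. t > 0 \<Longrightarrow> (S t w, F t) \<in> generator S"
    "\<And>t. t > 0 \<Longrightarrow> ((\<lambda>s. S s w) has_vector_derivative F t) (at t)"
    using orbit_derivative[OF S, of _ w] by metis
  have op: "((p t, m t), (fst (F t), snd (F t))) \<in> ionic_operator A E\<^sub>0 D\<^sub>p D\<^sub>m \<kappa>" if "t > 0" for t
    using F(1)[OF that] by (simp add: gen p_def m_def)
  have "\<forall>t. \<exists>q. t > 0 \<longrightarrow> (case q of (wy, wxx, wxy, wyy) \<Rightarrow>
      regular (anti (p t)) (nonzero_modes (p t)) wy wxx wxy wyy \<and>
      anti (fst (F t)) = ionic_flux A D\<^sub>p (D\<^sub>p * E\<^sub>0) (nonzero_modes (p t)) wxx wyy
        - (D\<^sub>p * \<kappa>) *\<^sub>R (anti (p t) - anti (m t)))"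
    using ionic_operator_anti(1)[OF dense op] by fastforce
  then obtain qp where qp: "\<And>t. t > 0 \<Longrightarrow> (case qp t of (wy, wxx, wxy, wyy) \<Rightarrow>
      regular (anti (p t)) (nonzero_modes (p t)) wy wxx wxy wyy \<and>
      anti (fst (F t)) = ionic_flux A D\<^sub>p (D\<^sub>p * E\<^sub>0) (nonzero_modes (p t)) wxx wyy
        - (D\<^sub>p * \<kappa>) *\<^sub>R (anti (p t) - anti (m t)))"
    by (rule choice[THEN exE]) blast
  have "\<forall>t. \<exists>q. t > 0 \<longrightarrow> (case q of (wy, wxx, wxy, wyy) \<Rightarrow>
      regular (anti (m t)) (nonzero_modes (m t)) wy wxx wxy wyy \<and>
      anti (snd (F t)) = ionic_flux A D\<^sub>m (- D\<^sub>m * E\<^sub>0) (nonzero_modes (m t)) wxx wyy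
        + (D\<^sub>m * \<kappa>) *\<^sub>R (anti (p t) - anti (m t)))"
    using ionic_operator_anti(2)[OF dense op] by fastforce
  then obtain qm where qm: "\<And>t. t > 0 \<Longrightarrow> (case qm t of (wy, wxx, wxy, wyy) \<Rightarrow>
      regular (anti (m t)) (nonzero_modes (m t)) wy wxx wxy wyy \<and>
      anti (snd (F t)) = ionic_flux A D\<^sub>m (- D\<^sub>m * E\<^sub>0) (nonzero_modes (m t)) wxx wyy
        + (D\<^sub>m * \<kappa>) *\<^sub>R (anti (p t) - anti (m t)))"
    by (rule choice[THEN exE]) blast
  have cont: "isCont F t" "isCont p t" "isCont m t" if t: "t > 0" for t
  proof -
    show "isCont F t" by (rule orbit_derivative_continuous[OF S F(2) t])
    have "isCont (\<lambda>s. S s w) t" using F(2)[OF t] by (rule has_vector_derivative_continuous)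
    then show "isCont p t" "isCont m t" unfolding p_def m_def by (intro continuous_fst continuous_snd; simp)+
  qed
  note ci = bounded_linear.isCont[OF bounded_linear_anti] bounded_linear.isCont[OF bounded_linear_nonzero_modes]
  have der: "((\<lambda>t. anti (p t)) has_vector_derivative anti (fst (F t))) (at t)"
    "((\<lambda>t. anti (m t)) has_vector_derivative anti (snd (F t))) (at t)" if "t > 0" for t
    unfolding p_def m_def
    by (intro bounded_linear.has_vector_derivative[OF bounded_linear_anti]
        bounded_linear.has_vector_derivative[OF bounded_linear_fst]
        bounded_linear.has_vector_derivative[OF bounded_linear_snd] F(2) that)+
  have P: "regular_evolution A D\<^sub>p (D\<^sub>p * E\<^sub>0) (\<lambda>t. anti (p t)) (\<lambda>t. nonzero_modes (p t))
      (\<lambda>t. fst (qp t)) (\<lambda>t. fst (snd (qp t))) (\<lambda>t. fst (snd (snd (qp t)))) (\<lambda>t. snd (snd (snd (qp t))))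
      (\<lambda>t. anti (fst (F t))) (\<lambda>t. - ((D\<^sub>p * \<kappa>) *\<^sub>R (anti (p t) - anti (m t))))"
    by unfold_locales
      (use pos qp cont der in \<open>auto simp: case_prod_beta' intro!: continuous_intros ci\<close>)
  have M: "regular_evolution A D\<^sub>m (- D\<^sub>m * E\<^sub>0) (\<lambda>t. anti (m t)) (\<lambda>t. nonzero_modes (m t))
      (\<lambda>t. fst (qm t)) (\<lambda>t. fst (snd (qm t))) (\<lambda>t. fst (snd (snd (qm t)))) (\<lambda>t. snd (snd (snd (qm t))))
      (\<lambda>t. anti (snd (F t))) (\<lambda>t. (D\<^sub>m * \<kappa>) *\<^sub>R (anti (p t) - anti (m t)))"
    by unfold_locales
      (use pos qm cont der in \<open>auto simp: case_prod_beta' intro!: continuous_intros ci\<close>)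
  have norm_sq: "(norm (state_nonzero_modes (S t w)))\<^sup>2
      = nonzero_modes (p t) \<bullet> nonzero_modes (p t) + nonzero_modes (m t) \<bullet> nonzero_modes (m t)" for t
    by (cases "S t w") (simp add: p_def m_def state_nonzero_modes_def norm_Pair power2_norm_eq_inner)
  note growth = regular_pair_growth[OF P M pos(3) s]
  show "(norm (state_nonzero_modes (S t w)))\<^sup>2
      \<le> exp (\<kappa> * \<bar>D\<^sub>p - D\<^sub>m\<bar> * (t - s)) * (norm (state_nonzero_modes (S s w)))\<^sup>2"
    unfolding norm_sq by (rule growth(1))
  have "anti u \<bullet> anti u \<le> pi\<^sup>2 * (nonzero_modes u \<bullet> nonzero_modes u)" for u
    using power_mono[OF norm_anti_le_nonzero_modes[OF dense, of u] norm_ge_zero, of 2]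
    by (simp add: power_mult_distrib power2_norm_eq_inner)
  then have "anti (p s) \<bullet> anti (p s) + anti (m s) \<bullet> anti (m s)
      \<le> pi\<^sup>2 * (norm (state_nonzero_modes (S s w)))\<^sup>2"
    unfolding norm_sq distrib_left by (intro add_mono)
  then have "exp (\<kappa> * \<bar>D\<^sub>p - D\<^sub>m\<bar> * (t - s)) * (anti (p s) \<bullet> anti (p s) + anti (m s) \<bullet> anti (m s))
      \<le> exp (\<kappa> * \<bar>D\<^sub>p - D\<^sub>m\<bar> * (t - s)) * (pi\<^sup>2 * (norm (state_nonzero_modes (S s w)))\<^sup>2)"
    by (intro mult_left_mono) auto
  with growth(2) show "1 / 6 * min D\<^sub>p D\<^sub>m * A\<^sup>2 * (t - s) ^ 3 * (norm (state_nonzero_modes (S t w)))\<^sup>2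
      \<le> exp (\<kappa> * \<bar>D\<^sub>p - D\<^sub>m\<bar> * (t - s)) * (pi\<^sup>2 * (norm (state_nonzero_modes (S s w)))\<^sup>2)"
    unfolding norm_sq by linarith
qed

text \<open>
  Estimates for orbits hold from positive times on; continuity at zero brings in the initial time.
\<close>

lemma decay_from_steps:
  fixes y :: "real \<Rightarrow> real"
  assumes cont: "continuous_on {0..} y" and nn: "\<And>t. 0 \<le> y t" and T: "T > 0"
    and short: "\<And>s t. 0 < s \<Longrightarrow> s \<le> t \<Longrightarrow> t \<le> s + T \<Longrightarrow> y t \<le> exp 1 * y s"
    and step: "\<And>s. 0 < s \<Longrightarrow> y (s + T) \<le> exp (- 1) * y s" and t: "t \<ge> 0"
  shows "y t \<le> exp 2 * exp (- t / T) * y 0"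
proof -
  have steps: "y (s + real n * T) \<le> exp (- real n) * y s" if s: "s > 0" for s n
  proof (induction n)
    case (Suc n)
    have "y (s + real n * T + T) \<le> exp (- 1) * y (s + real n * T)"
      using s T by (intro step) (simp add: add_pos_nonneg)
    also have "\<dots> \<le> exp (- 1) * (exp (- real n) * y s)" by (intro mult_left_mono Suc) auto
    finally show ?case by (simp add: algebra_simps exp_add[symmetric])
  qed simp
  define n where "n = nat \<lfloor>t / T\<rfloor>"
  have n: "real n \<le> t / T" "t / T < real n + 1"
    using t T by (auto simp: n_def of_nat_nat)
  then have nT: "real n * T \<le> t" "t \<le> real n * T + T"
    using T by (simp_all add: field_simps)
  have le: "y (s + t) \<le> exp 2 * exp (- t / T) * y s" if s: "s > 0" for s
  proof -
    have "y (s + t) \<le> exp 1 * y (s + real n * T)"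
      using s T nT by (intro short) (auto simp: add_pos_nonneg)
    also have "\<dots> \<le> exp 1 * (exp (- real n) * y s)"
      by (intro mult_left_mono steps s) auto
    also have "\<dots> = exp (1 - real n) * y s" by (simp add: exp_diff exp_minus field_simps)
    also have "\<dots> \<le> exp (2 + - t / T) * y s"
      using n nn by (intro mult_right_mono) auto
    finally show ?thesis by (simp only: exp_add)
  qed
  have lim: "((\<lambda>s. y (s + c)) \<longlongrightarrow> y c) (at_right 0)" if c: "c \<ge> 0" for c
  proof -
    have "continuous_on {0..} (\<lambda>s. y (s + c))"
      using c by (intro continuous_on_compose2[OF cont] continuous_intros) auto
    then have "((\<lambda>s. y (s + c)) \<longlongrightarrow> y (0 + c)) (at 0 within {0..})"
      unfolding continuous_on_def by (rule bspec) simp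
    then have "((\<lambda>s. y (s + c)) \<longlongrightarrow> y c) (at 0 within {0..})" by simp
    then show ?thesis by (auto intro: tendsto_within_subset)
  qed
  have "((\<lambda>s. exp 2 * exp (- t / T) * y s) \<longlongrightarrow> exp 2 * exp (- t / T) * y 0) (at_right 0)"
    using lim[of 0] by (intro tendsto_intros) simp
  moreover have "((\<lambda>s. y (s + t)) \<longlongrightarrow> y t) (at_right 0)" by (rule lim[OF t])
  moreover have "\<forall>\<^sub>F s in at_right 0. y (s + t) \<le> exp 2 * exp (- t / T) * y s"
    using eventually_at_right_less[of 0] by eventually_elim (rule le)
  ultimately show ?thesis
    by (rule tendsto_le[OF trivial_limit_at_right_real])
qed

text \<open>
  One step has length \<open>20 / \<nu>\<close>. As \<open>\<nu>\<^sup>3 = min D\<^sub>p D\<^sub>m A\<^sup>2\<close>, the smoothing factor over one step is at most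
  \<open>6 \<pi>\<^sup>2 exp 1 / 20\<^sup>3 \<le> exp (-2)\<close> for the square of the norm. The smallness of the coupling
  says that it produces at most a factor \<open>exp 1\<close> in that time.
\<close>

lemma ionic_decay:
  assumes sol: "ionic_solution A E\<^sub>0 D\<^sub>p D\<^sub>m \<kappa> a" and A: "A \<noteq> 0"
    and pos: "D\<^sub>p > 0" "D\<^sub>m > 0" "\<kappa> \<ge> 0"
    and \<nu>: "\<nu> = min D\<^sub>p D\<^sub>m powr (1/3) * \<bar>A\<bar> powr (2/3)"
    and weak: "20 * (\<kappa> * \<bar>D\<^sub>p - D\<^sub>m\<bar>) \<le> \<nu>" and t: "t \<ge> 0"
  shows "norm (state_nonzero_modes (a t)) \<le> exp 2 * exp (- (\<nu> / 20) * t) * norm (state_nonzero_modes (a 0))"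
proof -
  obtain S where S: "analytic_semigroup S" and gen: "generator S = ionic_operator A E\<^sub>0 D\<^sub>p D\<^sub>m \<kappa>"
    and a: "\<And>t. t \<ge> 0 \<Longrightarrow> a t = S t (a 0)"
    using sol unfolding ionic_solution_def by blast
  define y where "y t = norm (state_nonzero_modes (S t (a 0)))" for t
  let ?\<mu> = "\<kappa> * \<bar>D\<^sub>p - D\<^sub>m\<bar>" and ?\<delta> = "min D\<^sub>p D\<^sub>m"
  have \<nu>0: "\<nu> > 0" using A pos by (simp add: \<nu>)
  define T where "T = 20 / \<nu>"
  have T: "T > 0" using \<nu>0 by (simp add: T_def)
  have \<nu>3: "\<nu> ^ 3 = ?\<delta> * A\<^sup>2"
  proof -
    have "(?\<delta> powr (1/3)) ^ 3 = ?\<delta>" using pos by (simp add: powr_power)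
    moreover have "(\<bar>A\<bar> powr (2/3)) ^ 3 = A\<^sup>2" using A by (simp add: powr_power)
    ultimately show ?thesis by (simp add: \<nu> power_mult_distrib)
  qed
  have \<mu>T: "?\<mu> * r \<le> 1" if "0 \<le> r" "r \<le> T" for r
  proof -
    have "?\<mu> * r \<le> ?\<mu> * T" using that pos by (intro mult_left_mono) auto
    also have "\<dots> \<le> 1" using weak \<nu>0 by (simp add: T_def field_simps)
    finally show ?thesis .
  qed
  have "y t \<le> exp 2 * exp (- t / T) * y 0"
  proof (rule decay_from_steps[OF _ _ T _ _ t])
    have orbit: "continuous_on {0..} (\<lambda>t. S t (a 0))"
      using S unfolding analytic_semigroup_def C0_semigroup_def by blast
    have "bounded_linear state_nonzero_modes"
      unfolding state_nonzero_modes_def map_prod_def case_prod_beta'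
      by (intro bounded_linear_Pair bounded_linear_compose[OF bounded_linear_nonzero_modes]
          bounded_linear_fst bounded_linear_snd)
    from continuous_on_norm[OF bounded_linear.continuous_on[OF this orbit]]
    show "continuous_on {0..} y" unfolding y_def .
    show "0 \<le> y t" for t by (simp add: y_def)
    show "y t \<le> exp 1 * y s" if s: "0 < s" "s \<le> t" "t \<le> s + T" for s t
    proof (rule power2_le_imp_le)
      have "(y t)\<^sup>2 \<le> exp (?\<mu> * (t - s)) * (y s)\<^sup>2"
        unfolding y_def by (rule ionic_growth(1)[OF S gen pos s(1,2)])
      also have "\<dots> \<le> exp 2 * (y s)\<^sup>2"
        using \<mu>T[of "t - s"] s by (intro mult_right_mono) auto
      finally show "(y t)\<^sup>2 \<le> (exp 1 * y s)\<^sup>2"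
        by (simp add: power_mult_distrib exp_double[symmetric])
      show "0 \<le> exp 1 * y s" by (simp add: y_def)
    qed
    show "y (s + T) \<le> exp (- 1) * y s" if s: "0 < s" for s
    proof (rule power2_le_imp_le)
      have cube: "?\<delta> * A\<^sup>2 * T ^ 3 = 8000"
        unfolding \<nu>3[symmetric] T_def using \<nu>0 by (simp add: power_divide)
      have "1 / 6 * ?\<delta> * A\<^sup>2 * T ^ 3 * (y (s + T))\<^sup>2 \<le> exp (?\<mu> * T) * (pi\<^sup>2 * (y s)\<^sup>2)"
        using ionic_growth(2)[OF S gen pos s, of "s + T" "a 0"] T by (simp add: y_def)
      also have "\<dots> \<le> exp 1 * (4\<^sup>2 * (y s)\<^sup>2)"
        using \<mu>T[of T] T pi_less_4 pi_gt_zero by (intro mult_mono mult_right_mono power_mono) auto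
      also have "1 / 6 * ?\<delta> * A\<^sup>2 * T ^ 3 * (y (s + T))\<^sup>2 = 8000 / 6 * (y (s + T))\<^sup>2"
        using cube by (simp add: mult.assoc)
      finally have "(y (s + T))\<^sup>2 \<le> (12 / 1000 * exp 1) * (y s)\<^sup>2" by simp
      also have "\<dots> \<le> exp (- 2) * (y s)\<^sup>2"
      proof (intro mult_right_mono)
        have "exp (3::real) = exp 1 ^ 3" by (simp add: exp_of_nat_mult[symmetric])
        also have "\<dots> \<le> 3 ^ 3" by (intro power_mono exp_le) auto
        finally have "12 / 1000 * exp (3::real) \<le> 1" by simp
        then have "(12 / 1000 * exp (3::real)) * exp (- 2) \<le> 1 * exp (- 2)"
          by (intro mult_right_mono) auto
        then show "12 / 1000 * exp 1 \<le> exp (- 2 :: real)"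
          by (simp add: mult.assoc exp_add[symmetric])
      qed simp
      finally show "(y (s + T))\<^sup>2 \<le> (exp (- 1) * y s)\<^sup>2"
        by (simp add: power_mult_distrib exp_double[symmetric])
      show "0 \<le> exp (- 1) * y s" by (simp add: y_def)
    qed
  qed
  moreover have "- t / T = - (\<nu> / 20) * t" by (simp add: T_def)
  moreover have "y t = norm (state_nonzero_modes (a t))" "y 0 = norm (state_nonzero_modes (a 0))"
    using a[OF t] a[of 0] by (simp_all add: y_def)
  ultimately show ?thesis by (simp only:)
qed

theorem theorem2p4:
  shows "\<exists>\<epsilon> C d :: real. \<epsilon> > 0 \<and> C \<ge> 1 \<and> d > 0 \<and>
    (\<forall>A E\<^sub>0 D\<^sub>p D\<^sub>m lam c\<^sub>0 \<kappa> Dmin Dmax :: real.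
       A \<noteq> 0 \<longrightarrow> D\<^sub>p > 0 \<longrightarrow> D\<^sub>m > 0 \<longrightarrow> lam > 0 \<longrightarrow> c\<^sub>0 > 0 \<longrightarrow>
       \<kappa> = c\<^sub>0 / lam\<^sup>2 \<longrightarrow> Dmin = min D\<^sub>p D\<^sub>m \<longrightarrow> Dmax = max D\<^sub>p D\<^sub>m \<longrightarrow>
       (Dmax / \<bar>A\<bar> \<le> \<epsilon> \<longrightarrow>
        4 * C * \<kappa> * Dmax \<le> d * Dmin powr (1/3) * \<bar>A\<bar> powr (2/3) \<longrightarrow>
        (\<forall>a. ionic_solution A E\<^sub>0 D\<^sub>p D\<^sub>m \<kappa> a \<longrightarrow>
          (\<forall>t\<ge>0. norm (state_nonzero_modes (a t))
             \<le> C * exp (- (d / 2) * Dmin powr (1/3) * \<bar>A\<bar> powr (2/3) * t)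
                 * norm (state_nonzero_modes (a 0)))))
       \<and>
       (\<forall>D. D\<^sub>p = D \<longrightarrow> D\<^sub>m = D \<longrightarrow> D / \<bar>A\<bar> \<le> \<epsilon> \<longrightarrow>
        (\<forall>a. ionic_solution A E\<^sub>0 D\<^sub>p D\<^sub>m \<kappa> a \<longrightarrow>
          (\<forall>t\<ge>0. norm (state_nonzero_modes (a t))
             \<le> C * exp (- d * D powr (1/3) * \<bar>A\<bar> powr (2/3) * t)
                 * norm (state_nonzero_modes (a 0))))))"
proof (rule exI[of _ 1], rule exI[of _ "exp 2"], rule exI[of _ "1 / 20"], intro conjI allI impI)
  fix A E\<^sub>0 D\<^sub>p D\<^sub>m lam c\<^sub>0 \<kappa> Dmin Dmax t :: real and a
  assume h: "A \<noteq> 0" "D\<^sub>p > 0" "D\<^sub>m > 0" "lam > 0" "c\<^sub>0 > 0" "\<kappa> = c\<^sub>0 / lam\<^sup>2"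
    "Dmin = min D\<^sub>p D\<^sub>m" "Dmax = max D\<^sub>p D\<^sub>m"
    and weak: "4 * exp 2 * \<kappa> * Dmax \<le> 1 / 20 * Dmin powr (1/3) * \<bar>A\<bar> powr (2/3)"
    and sol: "ionic_solution A E\<^sub>0 D\<^sub>p D\<^sub>m \<kappa> a" and t: "0 \<le> t"
  \<comment> \<open>\<open>\<bar>D\<^sub>p - D\<^sub>m\<bar> \<le> Dmax\<close>, so the smallness condition makes the coupling weak on the time scale \<open>20 / \<nu>\<close>\<close>
  define \<nu> where "\<nu> = min D\<^sub>p D\<^sub>m powr (1/3) * \<bar>A\<bar> powr (2/3)"
  have \<kappa>: "\<kappa> \<ge> 0" and \<nu>: "\<nu> \<ge> 0" using h by (simp_all add: \<nu>_def)
  have "20 * (\<kappa> * \<bar>D\<^sub>p - D\<^sub>m\<bar>) \<le> 20 * (\<kappa> * Dmax)"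
    using h \<kappa> by (intro mult_left_mono) auto
  also have "\<dots> \<le> 20 * (4 * exp 2 * \<kappa> * Dmax)"
  proof -
    have "1 * (\<kappa> * Dmax) \<le> 4 * exp 2 * (\<kappa> * Dmax)"
    proof (rule mult_right_mono)
      have "1 \<le> exp (2::real)" by simp
      then show "1 \<le> 4 * exp (2::real)" by linarith
    qed (use h \<kappa> in simp)
    then show ?thesis by (simp add: ac_simps)
  qed
  also have "\<dots> \<le> \<nu>" using weak h by (simp add: \<nu>_def)
  finally have "norm (state_nonzero_modes (a t))
      \<le> exp 2 * exp (- (\<nu> / 20) * t) * norm (state_nonzero_modes (a 0))"
    by (rule ionic_decay[OF sol h(1-3) \<kappa> \<nu>_def _ t])
  also have "\<dots> \<le> exp 2 * exp (- (1 / 20 / 2) * \<nu> * t) * norm (state_nonzero_modes (a 0))"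
    using \<nu> t by (intro mult_right_mono mult_left_mono) (auto simp: mult_right_mono)
  finally show "norm (state_nonzero_modes (a t))
      \<le> exp 2 * exp (- (1 / 20 / 2) * Dmin powr (1/3) * \<bar>A\<bar> powr (2/3) * t)
        * norm (state_nonzero_modes (a 0))"
    by (simp add: \<nu>_def h mult.assoc)
next
  fix A E\<^sub>0 D\<^sub>p D\<^sub>m lam c\<^sub>0 \<kappa> D t :: real and a
  assume h: "A \<noteq> 0" "D\<^sub>p > 0" "D\<^sub>m > 0" "lam > 0" "c\<^sub>0 > 0" "\<kappa> = c\<^sub>0 / lam\<^sup>2" "D\<^sub>p = D" "D\<^sub>m = D"
    and sol: "ionic_solution A E\<^sub>0 D\<^sub>p D\<^sub>m \<kappa> a" and t: "0 \<le> t"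
  \<comment> \<open>for equal diffusivities the coupling does not make the energy grow at all\<close>
  have "\<kappa> \<ge> 0" using h by simp
  from ionic_decay[OF sol h(1-3) this refl _ t] h
  show "norm (state_nonzero_modes (a t))
      \<le> exp 2 * exp (- (1 / 20) * D powr (1/3) * \<bar>A\<bar> powr (2/3) * t)
        * norm (state_nonzero_modes (a 0))"
    by (simp add: mult.assoc)
qed simp_all

end
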